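(* Let $N\in\{2,3,5,7\}$ and let $p\neq N$ be a prime. Then every root of $ss_p^{(N* )}(X)$ lies in $\mathbb{F}_{p^2}$; that is, for every supersingular $j$-invariant $j\in\overline{\mathbb{F}}_p$, every root $Y\in\overline{\mathbb{F}}_p$ of $R_N(j,Y)=0$ lies in $\mathbb{F}_{p^2}$.
   Context: Define polynomials in $\mathbb{Z}[X,Y]$: $R_2(X,Y)=X^2-X(Y^2-207Y+3456)+(Y+144)^3$; $R_3(X,Y)=X^2-XY(Y^2-126Y+2944)+Y(Y+192)^3$; $R_5(X,Y)=X^2-X(Y^5-80Y^4+1890Y^3-12600Y^2+7776Y+3456)+(Y^2+216Y+144)^3$; $R_7(X,Y)=X^2-XY(Y^2-21Y+8)(Y^4-42Y^3+454Y^2-1008Y-1280)+Y^2(Y^2+224Y+448)^3$. (These are the relations $R_N(j(\tau),j_N^*(\tau))=0$ between the $j$-function and a Hauptmodul $j_N^*$ of the Fricke group $\Gamma_0^*(N)$.) The supersingular polynomial for $\Gamma_0^*(N)$ is $ss_p^{(N* )}(X)=\prod(X-j_N^* )\in\mathbb{F}_p[X]$, where $j_N^*$ runs over the distinct roots in $\overline{\mathbb{F}}_p$ of $R_N(j,Y)\equiv 0$ as $j$ runs over the supersingular $j$-invariants in characteristic $p$. *)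

theory Defs
  imports "HOL-Computational_Algebra.Computational_Algebra"
begin

text \<open>The relations R_N(X,Y) between j and the Hauptmodul j_N^* of the Fricke group,
  evaluated in an arbitrary commutative ring (integer coefficients via numerals).\<close>
definition R_N :: "nat \<Rightarrow> 'a::comm_ring_1 \<Rightarrow> 'a \<Rightarrow> 'a" where
  "R_N N X Y =
    (if N = 2 then X^2 - X * (Y^2 - 207*Y + 3456) + (Y + 144)^3
     else if N = 3 then X^2 - X * Y * (Y^2 - 126*Y + 2944) + Y * (Y + 192)^3
     else if N = 5 then X^2 - X * (Y^5 - 80*Y^4 + 1890*Y^3 - 12600*Y^2 + 7776*Y + 3456)
                        + (Y^2 + 216*Y + 144)^3
     else if N = 7 then X^2 - X * Y * (Y^2 - 21*Y + 8) * (Y^4 - 42*Y^3 + 454*Y^2 - 1008*Y - 1280)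
                        + Y^2 * (Y^2 + 224*Y + 448)^3
     else 0)"

text \<open>Weierstrass equation y^2 + a1 xy + a3 y = x^3 + a2 x^2 + a4 x + a6: standard quantities.\<close>
definition weier_b2 :: "'a::comm_ring_1 \<Rightarrow> 'a \<Rightarrow> 'a \<Rightarrow> 'a \<Rightarrow> 'a \<Rightarrow> 'a" where
  "weier_b2 a1 a2 a3 a4 a6 = a1^2 + 4*a2"
definition weier_b4 :: "'a::comm_ring_1 \<Rightarrow> 'a \<Rightarrow> 'a \<Rightarrow> 'a \<Rightarrow> 'a \<Rightarrow> 'a" where
  "weier_b4 a1 a2 a3 a4 a6 = 2*a4 + a1*a3"
definition weier_b6 :: "'a::comm_ring_1 \<Rightarrow> 'a \<Rightarrow> 'a \<Rightarrow> 'a \<Rightarrow> 'a \<Rightarrow> 'a" where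
  "weier_b6 a1 a2 a3 a4 a6 = a3^2 + 4*a6"
definition weier_b8 :: "'a::comm_ring_1 \<Rightarrow> 'a \<Rightarrow> 'a \<Rightarrow> 'a \<Rightarrow> 'a \<Rightarrow> 'a" where
  "weier_b8 a1 a2 a3 a4 a6 = a1^2*a6 + 4*a2*a6 - a1*a3*a4 + a2*a3^2 - a4^2"
definition weier_c4 :: "'a::comm_ring_1 \<Rightarrow> 'a \<Rightarrow> 'a \<Rightarrow> 'a \<Rightarrow> 'a \<Rightarrow> 'a" where
  "weier_c4 a1 a2 a3 a4 a6 = (weier_b2 a1 a2 a3 a4 a6)^2 - 24 * weier_b4 a1 a2 a3 a4 a6"
definition weier_disc :: "'a::comm_ring_1 \<Rightarrow> 'a \<Rightarrow> 'a \<Rightarrow> 'a \<Rightarrow> 'a \<Rightarrow> 'a" where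
  "weier_disc a1 a2 a3 a4 a6 =
     (let b2 = weier_b2 a1 a2 a3 a4 a6; b4 = weier_b4 a1 a2 a3 a4 a6;
          b6 = weier_b6 a1 a2 a3 a4 a6; b8 = weier_b8 a1 a2 a3 a4 a6
      in - (b2^2*b8) - 8*b4^3 - 27*b6^2 + 9*b2*b4*b6)"
definition weier_j :: "'a::field \<Rightarrow> 'a \<Rightarrow> 'a \<Rightarrow> 'a \<Rightarrow> 'a \<Rightarrow> 'a" where
  "weier_j a1 a2 a3 a4 a6 = (weier_c4 a1 a2 a3 a4 a6)^3 / weier_disc a1 a2 a3 a4 a6"

definition weier_cubic :: "'a::comm_ring_1 \<Rightarrow> 'a \<Rightarrow> 'a \<Rightarrow> 'a \<Rightarrow> 'a \<Rightarrow> 'a poly poly poly" where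
  "weier_cubic a1 a2 a3 a4 a6 =
    (let x = monom 1 1 :: 'a poly poly poly;
         y = [: monom 1 1 :] :: 'a poly poly poly;
         z = [: [: monom 1 1 :] :] :: 'a poly poly poly;
         c = (\<lambda>a. [: [: [: a :] :] :]) :: 'a \<Rightarrow> 'a poly poly poly
     in y^2*z + c a1*x*y*z + c a3*y*z^2 - x^3 - c a2*x^2*z - c a4*x*z^2 - c a6*z^3)"

text \<open>Hasse invariant of the plane cubic F in characteristic p: the coefficient of
  (xyz)^(p-1) in F^(p-1).  The curve is supersingular iff it vanishes.\<close>
definition hasse_invariant :: "nat \<Rightarrow> 'a::comm_ring_1 \<Rightarrow> 'a \<Rightarrow> 'a \<Rightarrow> 'a \<Rightarrow> 'a \<Rightarrow> 'a" where
  "hasse_invariant p a1 a2 a3 a4 a6 =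
     coeff (coeff (coeff ((weier_cubic a1 a2 a3 a4 a6)^(p-1)) (p-1)) (p-1)) (p-1)"

definition supersingular_j :: "'a::field \<Rightarrow> bool" where
  "supersingular_j j \<longleftrightarrow>
     (\<exists>a1 a2 a3 a4 a6. weier_disc a1 a2 a3 a4 a6 \<noteq> 0 \<and> j = weier_j a1 a2 a3 a4 a6
        \<and> hasse_invariant CHAR('a) a1 a2 a3 a4 a6 = 0)"

end

theory Submission
  imports Defs
begin

text \<open>
  Write a supersingular curve as \<open>y\<^sup>2 = f(x)\<close> and let \<open>Q\<close> be a point with abscissa \<open>x\<close>.  A Pade
  approximation of \<open>y\<close> at \<open>Q\<close> gives a function with divisor \<open>p Q + (- p Q) - (p + 1) O\<close>, whose coefficients
  depend polynomially on \<open>x\<^sup>p\<close>.  A vanishing Hasse invariant makes the invariant differential exact,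
  which excludes \<open>p\<close>-torsion, so the abscissa of \<open>p Q\<close> is a polynomial \<open>d(x\<^sup>p)\<close>.  Up to squares \<open>f \<circ> d\<close> is the
  Frobenius twist of \<open>f\<close>; counting critical points shows that \<open>d\<close> is affine or the \<open>p\<close>-th power of an affine
  map.  Thus multiplication by \<open>p\<close> acts on abscissas as \<open>x \<mapsto> \<alpha> x\<^sup>q + \<beta>\<close> with \<open>q \<in> {p, p\<^sup>2}\<close>, and since it preserves
  every subgroup \<open>C\<close> of order \<open>N\<close>, the modulus \<open>t\<close> of \<open>(E, C)\<close> satisfies \<open>t\<^sup>q = t\<close>.  For \<open>N = 2, 3, 5, 7\<close> the modulus is a
  Hauptmodul of \<open>\<Gamma>\<^sub>0(N)\<close>, the curve has an explicit model (Tate normal form), and the roots of \<open>R\<^sub>N(j, Y)\<close>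
  are \<open>Y = t + c / t + k\<close> for constants \<open>c\<close> and \<open>k\<close>.  In characteristic 2 and 3 the only supersingular invariant is \<open>j = 0\<close>.
\<close>

section \<open>Polynomials over fields of positive characteristic\<close>

text \<open>The group law never appears. A point is given by its abscissa x, and a multiple of it by
  a function a - b y with prescribed zeros, controlled through its norm a^2 - f b^2. Local
  expansions of y are avoided as well: with p = 2 n + 1 one has f^(n+1) = y^(p+1) = y^p y, and y^p
  is constant modulo (X - x)^p, so the polynomial f^(n+1) stands for y(Q)^p y. This is why the norms
  carry the factor f(x)^p. For N > 2 the residue of p modulo N tells which multiple of a point Q of
  order N has the abscissa of p Q. The parameters of the curve marked at p Q are the q-th powers of
  those at Q, and t does not depend on the generator of C, hence t^q = t. Both values of q lead to
  F_(p^2), since t^p = t implies t^(p^2) = t. The constant c is N^(12/(N-1)), and t -> c/t is the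
  Fricke involution, which exchanges the two factors of R_N(j, Y) written in terms of t.\<close>

declare mult_pCons_left [simp del] mult_pCons_right [simp del]

text \<open>Elimination with a pivot \<open>c i0 j0\<close>, by induction on the set of equations.
  It supplies the Pade approximant in \<open>ex_pade\<close>.\<close>

lemma homogeneous_system_nontrivial:
  fixes c :: "'i \<Rightarrow> 'j \<Rightarrow> 'a::field"
  assumes "finite J" "finite I" "card J < card I"
  shows "\<exists>x. (\<exists>i\<in>I. x i \<noteq> 0) \<and> (\<forall>j\<in>J. (\<Sum>i\<in>I. c i j * x i) = 0)"
  using assms
proof (induction J arbitrary: I c rule: finite_induct)
  case empty
  then obtain i where "i \<in> I" by fastforce
  then show ?case by (intro exI[of _ "\<lambda>_. 1"]) auto
next
  case (insert j0 J)
  show ?case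
  proof (cases "\<forall>i\<in>I. c i j0 = 0")
    case True
    have "card J < card I" using insert by simp
    then obtain x where x: "\<exists>i\<in>I. x i \<noteq> 0" "\<forall>j\<in>J. (\<Sum>i\<in>I. c i j * x i) = 0"
      using insert.IH[of I c] insert.prems by auto
    have "(\<Sum>i\<in>I. c i j0 * x i) = 0" using True by simp
    with x show ?thesis by (intro exI[of _ x]) auto
  next
    case False
    then obtain i0 where i0: "i0 \<in> I" "c i0 j0 \<noteq> 0" by auto
    define c' where "c' = (\<lambda>i j. c i j - c i j0 * c i0 j / c i0 j0)"
    have "card J < card (I - {i0})"
      using insert i0 by (simp add: card_Diff_singleton)
    then obtain x where x: "\<exists>i\<in>I - {i0}. x i \<noteq> 0"
        "\<forall>j\<in>J. (\<Sum>i\<in>I - {i0}. c' i j * x i) = 0"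
      using insert.IH[of "I - {i0}" c'] insert.prems by auto
    define s where "s = (\<Sum>i\<in>I - {i0}. c i j0 * x i)"
    define x' where "x' = x(i0 := - s / c i0 j0)"
    have sum_x': "(\<Sum>i\<in>I. c i j * x' i) = - c i0 j * s / c i0 j0 + (\<Sum>i\<in>I - {i0}. c i j * x i)" for j
    proof -
      have "(\<Sum>i\<in>I. c i j * x' i) = c i0 j * x' i0 + (\<Sum>i\<in>I - {i0}. c i j * x' i)"
        using i0 insert.prems by (simp add: sum.remove)
      also have "(\<Sum>i\<in>I - {i0}. c i j * x' i) = (\<Sum>i\<in>I - {i0}. c i j * x i)"
        by (intro sum.cong) (auto simp: x'_def)
      finally show ?thesis by (simp add: x'_def)
    qed
    have "(\<Sum>i\<in>I. c i j * x' i) = 0" if "j \<in> J" for j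
    proof -
      have "0 = (\<Sum>i\<in>I - {i0}. c' i j * x i)" using x that by simp
      also have "\<dots> = (\<Sum>i\<in>I - {i0}. c i j * x i) - (c i0 j / c i0 j0) * s"
        unfolding s_def sum_distrib_left sum_subtractf[symmetric]
        by (intro sum.cong) (auto simp: c'_def field_simps)
      finally show ?thesis using sum_x'[of j] by (simp add: field_simps)
    qed
    moreover have "(\<Sum>i\<in>I. c i j0 * x' i) = 0"
      using sum_x'[of j0] i0 by (simp add: s_def)
    moreover have "\<exists>i\<in>I. x' i \<noteq> 0" using x by (auto simp: x'_def)
    ultimately show ?thesis by (intro exI[of _ x']) auto
  qed
qed

text \<open>Over an algebraically closed field divisibility is a matter of root multiplicities; one
  root of \<open>b\<close> is split off at each step.\<close>

lemma dvd_if_order_le: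
  fixes a b :: "'a::alg_closed_field poly"
  assumes "b \<noteq> 0" "a \<noteq> 0" "\<And>r. order r b \<le> order r a"
  shows "b dvd a"
  using assms
proof (induction "degree b" arbitrary: a b)
  case 0
  then obtain c where "b = [:c:]" by (metis degree_eq_zeroE)
  with 0 show ?case by (auto intro: is_unit_triv unit_imp_dvd simp: is_unit_const_poly_iff dvd_field_iff)
next
  case (Suc m)
  then obtain r where r: "poly b r = 0" using alg_closed_imp_poly_has_root[of b] by auto
  then obtain b' where b': "b = [:-r, 1:] * b'" by (auto simp: poly_eq_0_iff_dvd elim: dvdE)
  have "order r b > 0" using r Suc.prems by (simp add: order_gt_0_iff)
  then have "order r a > 0" using Suc.prems(3)[of r] by simp
  then have "poly a r = 0" using Suc.prems by (simp add: order_gt_0_iff)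
  then obtain a' where a': "a = [:-r, 1:] * a'" by (auto simp: poly_eq_0_iff_dvd elim: dvdE)
  have nz: "a' \<noteq> 0" "b' \<noteq> 0" using Suc.prems a' b' by auto
  have "degree b' = m" using Suc.hyps(2) nz by (simp add: b' degree_mult_eq)
  moreover have "order s b' \<le> order s a'" for s
    using Suc.prems(3)[of s] Suc.prems(1,2) unfolding a' b' by (simp add: order_mult)
  ultimately have "b' dvd a'" using Suc.hyps(1)[of b' a'] nz by auto
  then show ?case unfolding a' b' by (rule mult_dvd_mono[OF dvd_refl])
qed

lemma infinite_UNIV_alg_closed: "infinite (UNIV :: 'a::alg_closed_field set)"
proof
  assume fin: "finite (UNIV :: 'a set)"
  define P where "P = (\<Prod>a\<in>(UNIV :: 'a set). [:-a, 1:]) + 1"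
  have deg: "degree (\<Prod>a\<in>(UNIV :: 'a set). [:-a, 1:]) = card (UNIV :: 'a set)"
    by (subst degree_prod_eq_sum_degree) auto
  have "card (UNIV :: 'a set) > 0" using fin by (simp add: card_gt_0_iff)
  then have "degree P > 0" unfolding P_def using deg by (subst degree_add_eq_left) auto
  then obtain x where "poly P x = 0" using alg_closed_imp_poly_has_root by blast
  moreover have "poly P x = 1" unfolding P_def using fin by (auto simp: poly_prod)
  ultimately show False by simp
qed

lemma poly_eqI_alg_closed:
  fixes P Q :: "'a::alg_closed_field poly"
  assumes "\<And>x. poly P x = poly Q x"
  shows "P = Q"
proof (rule ccontr)
  assume "P \<noteq> Q"
  then have "finite {x. poly (P - Q) x = 0}" by (intro poly_roots_finite) auto
  moreover have "{x. poly (P - Q) x = 0} = UNIV" using assms by auto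
  ultimately show False using infinite_UNIV_alg_closed by metis
qed

lemma diff_power_CHAR:
  fixes x y :: "'a::comm_ring_1"
  assumes "prime CHAR('a)"
  shows "(x - y) ^ CHAR('a) = x ^ CHAR('a) - y ^ CHAR('a)"
  using freshmans_dream[OF assms refl, of "x - y" y] by (simp add: algebra_simps)

lemma power_CHAR_inj:
  fixes x y :: "'a::idom"
  assumes "prime CHAR('a)" "x ^ CHAR('a) = y ^ CHAR('a)"
  shows "x = y"
  using diff_power_CHAR[OF assms(1), of x y] assms by auto

lemma two_neq_0_if_CHAR:
  assumes "CHAR('a::semiring_1) > 2"
  shows "(2 :: 'a) \<noteq> 0"
proof
  assume "(2 :: 'a) = 0"
  then have "of_nat 2 = (0 :: 'a)" by simp
  then have "CHAR('a) dvd 2" by (simp only: of_nat_eq_0_iff_char_dvd)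
  then have "CHAR('a) \<le> 2" by (rule dvd_imp_le) simp
  then show False using assms by simp
qed

text \<open>Only exponents divisible by p survive, the coefficients have p-th roots, and Frobenius
  is additive.\<close>

lemma pderiv_eq_0_imp_power_CHAR:
  fixes d :: "'a::alg_closed_field poly"
  assumes p: "prime CHAR('a)" and d: "pderiv d = 0"
  shows "\<exists>\<delta>. d = \<delta> ^ CHAR('a)"
proof -
  let ?p = "CHAR('a)"
  have p0: "?p > 0" using p by (simp add: prime_gt_0_nat)
  have zero: "coeff d i = 0" if "\<not> ?p dvd i" for i
  proof -
    obtain m where m: "i = Suc m" using \<open>\<not> ?p dvd i\<close> by (cases i) auto
    have "of_nat (Suc m) * coeff d (Suc m) = 0" using d coeff_pderiv[of d m] by simp
    moreover have "of_nat (Suc m) \<noteq> (0::'a)" using that m by (simp only: of_nat_eq_0_iff_char_dvd not_False_eq_True)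
    ultimately show ?thesis using m by simp
  qed
  have "\<exists>r. \<forall>x::'a. r x ^ ?p = x"
    using nth_root_exists[OF p0] by metis
  then obtain r where r: "\<And>x::'a. r x ^ ?p = x" by auto
  define \<delta> where "\<delta> = (\<Sum>i\<le>degree d. monom (r (coeff d (?p * i))) i)"
  have "\<delta> ^ ?p = (\<Sum>i\<le>degree d. monom (r (coeff d (?p * i))) i ^ ?p)"
    unfolding \<delta>_def using p by (subst freshmans_dream_sum) auto
  also have "\<dots> = (\<Sum>i\<le>degree d. monom (coeff d (?p * i)) (?p * i))"
    by (simp add: monom_power r mult.commute)
  also have "\<dots> = d"
  proof (rule poly_eqI)
    fix m
    show "coeff (\<Sum>i\<le>degree d. monom (coeff d (?p * i)) (?p * i)) m = coeff d m"
    proof (cases "?p dvd m")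
      case True
      then obtain t where t: "m = ?p * t" by auto
      have "coeff (\<Sum>i\<le>degree d. monom (coeff d (?p * i)) (?p * i)) m
          = (\<Sum>i\<le>degree d. if i = t then coeff d (?p * i) else 0)"
        using p0 t by (simp add: coeff_sum)
      also have "\<dots> = (if t \<le> degree d then coeff d m else 0)" by (simp add: t)
      also have "\<dots> = coeff d m"
      proof (cases "t \<le> degree d")
        case False
        have "t \<le> ?p * t" using p0 by simp
        then have "degree d < m" using False t by linarith
        then show ?thesis using False by (simp add: coeff_eq_0)
      qed simp
      finally show ?thesis .
    next
      case False
      then have "coeff (\<Sum>i\<le>degree d. monom (coeff d (?p * i)) (?p * i)) m = 0"
        by (auto simp: coeff_sum intro!: sum.neutral)
      with zero[OF False] show ?thesis by simp
    qed
  qed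
  finally show ?thesis by metis
qed

lemma pcompose_linear: "pcompose [:-u, 1:] d = d - [:u:]" for d :: "'a::comm_ring_1 poly"
proof -
  have "[:-u, 1:] = [:0, 1:] - [:u:]" by simp
  then show ?thesis by (simp only: pcompose_diff) (simp add: pcompose_pCons mult_pCons_right)
qed

lemma pcompose_cubic:
  "pcompose ([:-u1, 1:] * [:-u2, 1:] * [:-u3, 1:]) d = (d - [:u1:]) * (d - [:u2:]) * (d - [:u3:])"
  for d :: "'a::comm_ring_1 poly"
  by (simp add: pcompose_mult pcompose_linear)

text \<open>If \<open>\<phi> \<circ> d\<close> and \<open>\<psi>\<close> agree up to squares, then \<open>\<phi> \<circ> d = \<psi> R\<^sup>2\<close>, where \<open>R\<close> divides the
  derivative of \<open>d\<close> because \<open>\<phi>\<close> is separable; but \<open>2 deg R = 3 deg d - 3\<close>.\<close>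
lemma degree_eq_1_if_cubic_square:
  fixes d a b :: "'a::alg_closed_field poly"
  assumes u: "u1 \<noteq> u2" "u1 \<noteq> u3" "u2 \<noteq> u3" and v: "v1 \<noteq> v2" "v1 \<noteq> v3" "v2 \<noteq> v3"
    and deg: "degree d > 0" and b: "b \<noteq> 0"
    and eq: "(d - [:u1:]) * (d - [:u2:]) * (d - [:u3:]) * ([:-v1, 1:] * [:-v2, 1:] * [:-v3, 1:]) * b\<^sup>2 = a\<^sup>2"
    and d': "pderiv d \<noteq> 0"
  shows "degree d = 1"
proof -
  define \<phi> where "\<phi> = [:-u1, 1:] * [:-u2, 1:] * [:-u3, 1:]"
  define \<psi> where "\<psi> = [:-v1, 1:] * [:-v2, 1:] * [:-v3, 1:]"
  have comp: "pcompose \<phi> d = (d - [:u1:]) * (d - [:u2:]) * (d - [:u3:])"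
    unfolding \<phi>_def by (rule pcompose_cubic)
  have deg_lin: "degree (d - [:u:]) = degree d" for u
    using deg degree_add_eq_left[of "- [:u:]" d] by (simp del: minus_pCons)
  have nz: "d - [:u:] \<noteq> 0" for u
    using deg deg_lin[of u] by (metis degree_0 less_irrefl)
  have nz\<phi>: "pcompose \<phi> d \<noteq> 0" unfolding comp using nz by (simp del: diff_pCons)
  have nz\<psi>: "\<psi> \<noteq> 0" unfolding \<psi>_def by (simp)
  have a: "a \<noteq> 0"
    using eq b nz\<phi> nz\<psi> unfolding comp[symmetric] \<psi>_def[symmetric] by auto
  have "b dvd a"
  proof (rule dvd_if_order_le[OF b a])
    fix r
    have "b\<^sup>2 dvd a\<^sup>2" using eq by (metis dvd_triv_right)
    then have "order r (b\<^sup>2) \<le> order r (a\<^sup>2)" using a by (intro dvd_imp_order_le) auto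
    then show "order r b \<le> order r a" using a b by (simp add: power2_eq_square order_mult)
  qed
  then obtain g where g: "a = b * g" by (elim dvdE)
  have g2: "pcompose \<phi> d * \<psi> = g\<^sup>2"
    using eq b unfolding comp[symmetric] \<psi>_def[symmetric] g by (simp add: power2_eq_square)
  \<comment> \<open>\<open>\<psi>\<close> divides the square of \<open>g\<close> and has three
    distinct roots.\<close>
  have "\<psi> dvd g"
  proof -
    have zero: "poly g v = 0" if "poly \<psi> v = 0" for v
      using arg_cong[OF g2, of "\<lambda>h. poly h v"] that by simp
    have "poly g v1 = 0" by (intro zero) (simp add: \<psi>_def)
    then obtain g1 where g1: "g = [:-v1, 1:] * g1" by (auto simp: poly_eq_0_iff_dvd elim: dvdE)
    have "poly g v2 = 0" by (intro zero) (simp add: \<psi>_def)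
    then have "poly g1 v2 = 0" using v unfolding g1 by simp
    then obtain g2 where g2: "g1 = [:-v2, 1:] * g2" by (auto simp: poly_eq_0_iff_dvd elim: dvdE)
    have "poly g v3 = 0" by (intro zero) (simp add: \<psi>_def)
    then have "poly g2 v3 = 0" using v unfolding g1 g2 by simp
    then obtain g3 where g3: "g2 = [:-v3, 1:] * g3" by (auto simp: poly_eq_0_iff_dvd elim: dvdE)
    show ?thesis unfolding g1 g2 g3 \<psi>_def by (simp only: mult.assoc dvd_def) blast
  qed
  then obtain R where R: "g = \<psi> * R" by (elim dvdE)
  have eqR: "pcompose \<phi> d = \<psi> * R\<^sup>2"
    using g2 nz\<psi> unfolding R by (simp add: power2_eq_square)
  have R0: "R \<noteq> 0" using eqR nz\<phi> by auto
  \<comment> \<open>Differentiating the identity leaves one factor \<open>R\<close> on the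
    right.\<close>
  have "pcompose (pderiv \<phi>) d * pderiv d = R * (pderiv \<psi> * R + 2 * \<psi> * pderiv R)"
    using arg_cong[OF eqR, of pderiv]
    by (simp add: pderiv_pcompose pderiv_mult power2_eq_square algebra_simps)
  then have Rdvd: "R dvd pcompose (pderiv \<phi>) d * pderiv d" by simp
  have \<phi>': "poly (pderiv \<phi>) x = (x - u2) * (x - u3) + (x - u1) * (x - u3) + (x - u1) * (x - u2)" for x
    by (simp add: \<phi>_def pderiv_mult pderiv_pCons algebra_simps)
  \<comment> \<open>At a root of \<open>R\<close> the value of \<open>d\<close> is a root of
    \<open>\<phi>\<close>, and all roots of \<open>\<phi>\<close> are simple.\<close>
  have sep: "poly (pcompose (pderiv \<phi>) d) r \<noteq> 0" if "poly R r = 0" for r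
  proof -
    have "poly (pcompose \<phi> d) r = 0" using eqR that by simp
    then have "poly d r = u1 \<or> poly d r = u2 \<or> poly d r = u3" unfolding comp by auto
    then show ?thesis using u
      by (auto simp: poly_pcompose \<phi>')
  qed
  have nz': "pcompose (pderiv \<phi>) d * pderiv d \<noteq> 0"
  proof
    assume "pcompose (pderiv \<phi>) d * pderiv d = 0"
    then have "pcompose (pderiv \<phi>) d = 0" using d' by simp
    moreover obtain r where r: "poly d r = u1"
      using alg_closed_imp_poly_has_root[of "d - [:u1:]"] deg deg_lin by auto
    moreover have "poly (pderiv \<phi>) u1 = (u1 - u2) * (u1 - u3)"
      by (simp add: \<phi>')
    ultimately show False using u by (metis poly_0 poly_pcompose mult_eq_0_iff right_minus_eq)
  qed
  have "R dvd pderiv d"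
  proof (rule dvd_if_order_le[OF R0 d'])
    fix r
    show "order r R \<le> order r (pderiv d)"
    proof (cases "poly R r = 0")
      case True
      have "order r R \<le> order r (pcompose (pderiv \<phi>) d * pderiv d)"
        using Rdvd nz' by (intro dvd_imp_order_le)
      also have "\<dots> = order r (pderiv d)"
        using nz' order_0I[OF sep[OF True]] by (simp add: order_mult)
      finally show ?thesis .
    qed (simp add: order_0I)
  qed
  then have "degree R \<le> degree (pderiv d)" using d' by (rule dvd_imp_degree_le)
  also have "\<dots> \<le> degree d - 1" by (rule degree_le) (auto simp: coeff_pderiv coeff_eq_0)
  finally have "degree R \<le> degree d - 1" .
  \<comment> \<open>Together with \<open>degree R \<le> degree d - 1\<close> this gives
    \<open>degree d \<le> 1\<close>.\<close>
  moreover have "3 * degree d = 3 + 2 * degree R"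
  proof -
    have "degree (pcompose \<phi> d) = 3 * degree d"
      unfolding comp using nz by (simp add: degree_mult_eq deg_lin del: diff_pCons)
    moreover have "degree \<psi> = 3" unfolding \<psi>_def by (simp add: degree_mult_eq)
    ultimately show ?thesis
      using eqR nz\<psi> R0 by (simp add: degree_mult_eq power2_eq_square)
  qed
  ultimately show ?thesis using deg by linarith
qed

section \<open>Derivations in characteristic p\<close>

lemma derivation_funpow_mult:
  fixes D :: "'b::comm_ring_1 \<Rightarrow> 'b"
  assumes add: "\<And>u v. D (u + v) = D u + D v" and mult: "\<And>u v. D (u * v) = u * D v + v * D u"
  shows "(D ^^ m) (u * v) = (\<Sum>i\<le>m. of_nat (m choose i) * (D ^^ i) u * (D ^^ (m - i)) v)"
proof (induction m)
  case (Suc m)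
  have D0: "D 0 = 0" using add[of 0 0] by simp
  have D1: "D 1 = 0" using mult[of 1 1] by simp
  have Dnat: "D (of_nat j) = 0" for j by (induction j) (simp_all add: D0 D1 add)
  have Dsum: "D (\<Sum>i\<in>A. g i) = (\<Sum>i\<in>A. D (g i))" if "finite A" for g :: "nat \<Rightarrow> 'b" and A
    using that by (induction A rule: finite_induct) (simp_all add: D0 add)
  let ?t = "\<lambda>i j. (D ^^ i) u * (D ^^ j) v"
  have "(D ^^ Suc m) (u * v) = (\<Sum>i\<le>m. D (of_nat (m choose i) * ?t i (m - i)))"
    using Suc by (simp add: Dsum mult.assoc)
  also have "\<dots> = (\<Sum>i\<le>m. of_nat (m choose i) * ?t i (Suc m - i) + of_nat (m choose i) * ?t (Suc i) (m - i))"
    by (intro sum.cong refl) (simp add: mult Dnat Suc_diff_le algebra_simps)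
  also have "\<dots> = (\<Sum>i\<le>m. of_nat (m choose i) * ?t i (Suc m - i))
      + (\<Sum>i\<le>m. of_nat (m choose i) * ?t (Suc i) (m - i))"
    by (simp add: sum.distrib)
  also have "(\<Sum>i\<le>m. of_nat (m choose i) * ?t i (Suc m - i))
      = (\<Sum>i\<le>Suc m. of_nat (m choose i) * ?t i (Suc m - i))"
    by (simp add: binomial_eq_0)
  also have "\<dots> = ?t 0 (Suc m) + (\<Sum>i\<le>m. of_nat (m choose Suc i) * ?t (Suc i) (m - i))"
    by (subst sum.atMost_Suc_shift) simp
  also have "?t 0 (Suc m) + (\<Sum>i\<le>m. of_nat (m choose Suc i) * ?t (Suc i) (m - i))
        + (\<Sum>i\<le>m. of_nat (m choose i) * ?t (Suc i) (m - i))
      = ?t 0 (Suc m) + (\<Sum>i\<le>m. of_nat (Suc m choose Suc i) * ?t (Suc i) (m - i))"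
    by (simp add: sum.distrib[symmetric] algebra_simps)
  also have "\<dots> = (\<Sum>i\<le>Suc m. of_nat (Suc m choose i) * ?t i (Suc m - i))"
    by (simp only: sum.atMost_Suc_shift) simp
  finally show ?case by (simp add: mult.assoc)
qed simp

text \<open>The p-th iterate of a derivation is again a derivation: the inner binomial coefficients
  of the Leibniz rule vanish in characteristic p.\<close>

lemma derivation_funpow_CHAR_mult:
  fixes D :: "'b::comm_ring_1 \<Rightarrow> 'b"
  assumes add: "\<And>u v. D (u + v) = D u + D v" and mult: "\<And>u v. D (u * v) = u * D v + v * D u"
    and p: "prime CHAR('b)"
  shows "(D ^^ CHAR('b)) (u * v) = u * (D ^^ CHAR('b)) v + v * (D ^^ CHAR('b)) u"
proof -
  let ?p = "CHAR('b)"
  have p0: "?p > 0" using p prime_gt_0_nat by blast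
  have "(D ^^ ?p) (u * v) = (\<Sum>i\<le>?p. of_nat (?p choose i) * (D ^^ i) u * (D ^^ (?p - i)) v)"
    by (rule derivation_funpow_mult[OF add mult])
  also have "\<dots> = (\<Sum>i\<in>{0, ?p}. of_nat (?p choose i) * (D ^^ i) u * (D ^^ (?p - i)) v)"
  proof (rule sum.mono_neutral_right)
    show "\<forall>i\<in>{..?p} - {0, ?p}. of_nat (?p choose i) * (D ^^ i) u * (D ^^ (?p - i)) v = 0"
    proof
      fix i assume "i \<in> {..?p} - {0, ?p}"
      then have "?p dvd (?p choose i)" using p by (intro dvd_choose_prime) auto
      then show "of_nat (?p choose i) * (D ^^ i) u * (D ^^ (?p - i)) v = 0"
        using of_nat_eq_0_iff_char_dvd[where 'a='b, of "?p choose i"] by simp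
    qed
  qed auto
  also have "\<dots> = u * (D ^^ ?p) v + v * (D ^^ ?p) u" using p0 by (simp add: algebra_simps)
  finally show ?thesis .
qed

lemma poly_derivation_eq_pderiv:
  fixes T :: "'a::idom poly \<Rightarrow> 'a poly"
  assumes "\<And>u v. T (u + v) = T u + T v" "\<And>u v. T (u * v) = u * T v + v * T u" "\<And>c. T [:c:] = 0"
  shows "T u = pderiv u * T [:0, 1:]"
proof (induction u)
  case 0
  then show ?case using assms(3)[of 0] by simp
next
  case (pCons c u)
  have eq: "pCons c u = [:c:] + [:0, 1:] * u" by (simp add: mult_pCons_left)
  have "T (pCons c u) = u * T [:0, 1:] + [:0, 1:] * (pderiv u * T [:0, 1:])"
    unfolding eq assms(1) assms(2) assms(3) using pCons by simp
  also have "\<dots> = pderiv (pCons c u) * T [:0, 1:]"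
    by (simp add: pderiv_pCons mult_pCons_left mult_pCons_right algebra_simps)
  finally show ?case .
qed

lemma pderiv_power_CHAR: "pderiv (u ^ CHAR('a)) = 0" for u :: "'a::idom poly"
proof (cases "CHAR('a)")
  case (Suc m)
  have "of_nat (Suc m) = (0 :: 'a)" using of_nat_CHAR Suc by metis
  then show ?thesis unfolding Suc pderiv_power_Suc by (simp only: smult_0_left mult_zero_left)
qed simp

text \<open>Since \<open>D G\<close> is a constant of the derivation \<open>D = f\<^sup>n\<^sup>+\<^sup>1 d/dX\<close>, the derivation \<open>D\<^sup>p\<close> kills \<open>G\<close> and
  so vanishes, whereas the hypotheses make \<open>a\<close> an eigenvector of \<open>D\<^sup>2\<close> for a nonzero eigenvalue.\<close>
lemma no_eigenvector_if_exact:
  fixes f a b G :: "'a::idom poly"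
  assumes p: "prime CHAR('a)" "CHAR('a) = 2 * n + 1"
    and f: "f \<noteq> 0" and G: "pderiv G = f ^ n"
    and a: "a \<noteq> 0" and \<gamma>: "\<gamma> \<noteq> 0"
    and a': "pderiv a = smult \<gamma> b" and b': "smult (2 * \<gamma>) a = pderiv f * b + 2 * f * pderiv b"
  shows False
proof -
  let ?p = "CHAR('a)"
  \<comment> \<open>As \<open>f ^ (n + 1)\<close> is y^(p+1), this is the invariant derivation y
    d/dx of y^2 = f multiplied by its constant y^p; the factor keeps \<open>D\<close> inside the
    polynomials.\<close>
  define D where "D = (\<lambda>u. f ^ (n + 1) * pderiv u)"
  define T where "T = D ^^ ?p"
  have D_add: "D (u + v) = D u + D v" for u v by (simp add: D_def pderiv_add algebra_simps)
  have D_mult: "D (u * v) = u * D v + v * D u" for u v by (simp add: D_def pderiv_mult algebra_simps)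
  have D0: "D 0 = 0" by (simp add: D_def)
  have T0: "(D ^^ m) 0 = 0" for m by (induction m) (simp_all add: D0)
  have T_add: "(D ^^ m) (u + v) = (D ^^ m) u + (D ^^ m) v" for m u v
    by (induction m) (simp_all add: D_add)
  have n: "n > 0" using p prime_gt_1_nat[of ?p] by (cases n) auto
  have T_const: "T u = 0" if "D u = 0" for u
  proof -
    have "T u = (D ^^ (2 * n)) (D u)" unfolding T_def p(2) Suc_eq_plus1[symmetric] by (simp only: funpow_Suc_right o_apply)
    then show ?thesis using that T0 by simp
  qed
  have T_eq: "T u = pderiv u * T [:0, 1:]" for u
  proof (rule poly_derivation_eq_pderiv)
    show "T (u * v) = u * T v + v * T u" for u v
      using derivation_funpow_CHAR_mult[OF D_add D_mult, of u v] p(1) by (simp add: T_def)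
    show "T [:c:] = 0" for c by (rule T_const) (simp add: D_def)
  qed (simp add: T_def T_add)
  have fp: "f ^ (n + 1) * f ^ n = f ^ ?p"
    unfolding power_add[symmetric] p(2) by (rule arg_cong[of _ _ "\<lambda>m. f ^ m"]) simp
  have "D G = f ^ ?p" using fp G by (simp add: D_def)
  then have DDG: "D (D G) = 0" by (simp add: D_def pderiv_power_CHAR)
  have "T G = (D ^^ (2 * n - 1)) (D (D G))"
  proof -
    have "?p = Suc (Suc (2 * n - 1))" using n p(2) by simp
    then show ?thesis unfolding T_def by (simp only: funpow_Suc_right o_apply)
  qed
  then have "T G = 0" using DDG T0 by simp
  then have "f ^ n * T [:0, 1:] = 0" using T_eq[of G] G by metis
  then have "T [:0, 1:] = 0" using f by simp
  then have T_zero: "T u = 0" for u by (subst T_eq) simp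
  have two: "(2 :: 'a) \<noteq> 0" using two_neq_0_if_CHAR[where 'a = 'a] p(2) n by simp
  have "of_nat (2 * n + 1) = (0 :: 'a)" using p(2) of_nat_CHAR by metis
  \<comment> \<open>\<open>n + 1\<close> is one half, because 2 (n + 1) = p + 1.\<close>
  then have two_n: "2 * of_nat (n + 1) = (1 :: 'a)" by (simp add: algebra_simps)
  \<comment> \<open>\<open>B\<close> is y^p times the function b y. Up to factors, \<open>D\<close>
    exchanges \<open>a\<close> and \<open>B\<close>.\<close>
  define B where "B = f ^ (n + 1) * b"
  have smult2: "smult 2 u = 2 * u" for u :: "'a poly"
    unfolding one_add_one[symmetric] smult_add_left distrib_right by simp
  have half: "smult (of_nat (n + 1)) (pderiv f * b) + f * pderiv b = smult \<gamma> a"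
  proof -
    have "smult 2 (smult (of_nat (n + 1)) (pderiv f * b) + f * pderiv b)
        = smult (2 * of_nat (n + 1)) (pderiv f * b) + smult 2 (f * pderiv b)"
      by (simp only: smult_add_right smult_smult)
    also have "\<dots> = pderiv f * b + 2 * f * pderiv b"
      unfolding two_n smult2 by (simp add: mult.assoc)
    also have "\<dots> = smult 2 (smult \<gamma> a)" by (simp add: b'[symmetric])
    finally show ?thesis using two by (metis smult_cancel)
  qed
  have DB: "D B = smult \<gamma> (f ^ ?p * a)"
  proof -
    have "pderiv (f ^ (n + 1)) = smult (of_nat (n + 1)) (f ^ n) * pderiv f"
      using pderiv_power_Suc[of f n] by simp
    then have "pderiv B = f ^ n * (smult (of_nat (n + 1)) (pderiv f * b) + f * pderiv b)"
      by (simp add: B_def pderiv_mult algebra_simps)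
    then show ?thesis unfolding half D_def fp[symmetric] by (simp add: algebra_simps)
  qed
  have Da: "D a = smult \<gamma> B" by (simp add: D_def B_def a')
  have D_smult: "D (smult c u) = smult c (D u)" for c u by (simp add: D_def pderiv_smult)
  have D_fp: "D (f ^ ?p * u) = f ^ ?p * D u" for u
    by (simp add: D_def pderiv_mult pderiv_power_CHAR algebra_simps)
  define E where "E = smult (\<gamma>\<^sup>2) (f ^ ?p)"
  have DDa: "D (D a) = E * a" by (simp add: Da DB D_smult E_def power2_eq_square)
  have DDE: "D (D (E ^ m * a)) = E ^ Suc m * a" for m
  proof (induction m)
    case (Suc m)
    have "D (D (E ^ Suc m * a)) = E * D (D (E ^ m * a))"
      by (simp add: E_def D_smult D_fp mult.assoc)
    then show ?case using Suc by (simp add: mult.assoc)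
  qed (simp add: DDa)
  have "(D ^^ (2 * m)) a = E ^ m * a" for m
  proof (induction m)
    case (Suc m)
    have "(D ^^ (2 * Suc m)) a = D (D ((D ^^ (2 * m)) a))" by simp
    then show ?case using Suc DDE by simp
  qed simp
  then have "(D ^^ (2 * ?p)) a = E ^ ?p * a" .
  moreover have "(D ^^ (2 * ?p)) a = T (T a)" by (simp add: T_def mult_2 funpow_add)
  ultimately have "E ^ ?p * a = 0" using T_zero by simp
  then show False using a \<gamma> f by (simp add: E_def)
qed

section \<open>Supersingular cubics have no p-torsion\<close>

lemma linear_dvd_diff_const: "[:-x, 1:] dvd u - [:poly u x:]" for u :: "'a::comm_ring_1 poly"
  by (simp add: poly_eq_0_iff_dvd[symmetric])

lemma smult_conv_const_mult: "smult c u = [:c:] * u" for u :: "'a::comm_semiring_0 poly"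
  by (simp add: mult_pCons_left)

text \<open>For i < 2 p - 1 the only exponent with i + 1 divisible by p is i = p - 1, so a single
  coefficient is the whole obstruction to integration.\<close>

lemma ex_antiderivative:
  fixes u :: "'a::field poly"
  assumes "CHAR('a) > 0" "coeff u (CHAR('a) - 1) = 0" "degree u < 2 * CHAR('a) - 1"
  shows "\<exists>G. pderiv G = u"
proof
  let ?p = "CHAR('a)"
  define G where "G = (\<Sum>i\<le>degree u. monom (coeff u i / of_nat (Suc i)) (Suc i))"
  have "pderiv G = (\<Sum>i\<le>degree u. monom (of_nat (Suc i) * (coeff u i / of_nat (Suc i))) i)"
    unfolding G_def higher_pderiv_sum[of 1, simplified] by (simp add: pderiv_monom)
  also have "\<dots> = (\<Sum>i\<le>degree u. monom (coeff u i) i)"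
  proof (intro sum.cong refl)
    fix i assume "i \<in> {..degree u}"
    then have i: "Suc i < 2 * ?p" using assms by simp
    show "monom (of_nat (Suc i) * (coeff u i / of_nat (Suc i))) i = monom (coeff u i) i"
    proof (cases "of_nat (Suc i) = (0 :: 'a)")
      case True
      then have "?p dvd Suc i" by (simp only: of_nat_eq_0_iff_char_dvd)
      then obtain m where m: "Suc i = ?p * m" by (elim dvdE)
      then have "m = 1" using i by (cases m) auto
      then have "i = ?p - 1" using m by simp
      then show ?thesis using assms True by simp
    qed simp
  qed
  also have "\<dots> = u" by (simp add: poly_as_sum_of_monoms)
  finally show "pderiv G = u" .
qed

lemma degree_eq_0_if_pderiv_eq_0:
  fixes u :: "'a::idom poly"
  assumes "pderiv u = 0" "degree u < CHAR('a)"
  shows "degree u = 0"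
proof (rule ccontr)
  assume "degree u \<noteq> 0"
  then obtain m where m: "degree u = Suc m" by (cases "degree u") auto
  have "of_nat (Suc m) * lead_coeff u = 0" using coeff_pderiv[of u m] assms m by simp
  moreover have "lead_coeff u \<noteq> 0" using \<open>degree u \<noteq> 0\<close> by (metis degree_0 leading_coeff_0_iff)
  ultimately have "of_nat (Suc m) = (0 :: 'a)" by (metis mult_eq_0_iff)
  then have "CHAR('a) dvd Suc m" by (simp only: of_nat_eq_0_iff_char_dvd)
  then have "CHAR('a) \<le> Suc m" by (rule dvd_imp_le) simp
  then show False using m assms by simp
qed

text \<open>\<open>hasse\<close> is the vanishing of the classical Hasse invariant of y^2 = f, the
  coefficient of x^(p-1) in f^((p-1)/2).\<close>

locale supersingular_cubic =
  fixes e1 e2 e3 :: "'a::alg_closed_field" and n p :: nat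
  assumes CHAR: "CHAR('a) = p" and prime_p: "prime p" and p_eq: "p = 2 * n + 1" and n_ge_2: "n \<ge> 2"
    and distinct: "e1 \<noteq> e2" "e1 \<noteq> e3" "e2 \<noteq> e3"
    and hasse: "coeff (([:-e1, 1:] * [:-e2, 1:] * [:-e3, 1:]) ^ n) (2 * n) = 0"
begin

definition f :: "'a poly" where "f = [:-e1, 1:] * [:-e2, 1:] * [:-e3, 1:]"

lemma two_neq_0: "(2 :: 'a) \<noteq> 0"
  using two_neq_0_if_CHAR[where 'a = 'a] CHAR p_eq n_ge_2 by simp

lemma four_neq_0: "(4 :: 'a) \<noteq> 0"
  using two_neq_0 by (metis mult_2 mult_eq_0_iff numeral_Bit0)

lemma f_neq_0 [simp]: "f \<noteq> 0" by (simp add: f_def)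

lemma degree_f: "degree f = 3" by (simp add: f_def degree_mult_eq)

lemma poly_f: "poly f x = (x - e1) * (x - e2) * (x - e3)" by (simp add: f_def)

lemma poly_f_eq_0_iff: "poly f x = 0 \<longleftrightarrow> x = e1 \<or> x = e2 \<or> x = e3" by (simp add: poly_f)

text \<open>This is the exactness of dx/y, which equals d(G / y^p) because G' = y^(p-1).\<close>

lemma ex_G: "\<exists>G. pderiv G = f ^ n"
  using hasse n_ge_2
  by (intro ex_antiderivative) (simp_all add: CHAR p_eq f_def[symmetric] degree_power_eq degree_f)

lemma linear_power_CHAR: "[:-x, 1:] ^ p = [:0, 1:] ^ p - [:x ^ p:]" for x :: 'a
proof -
  have "[:-x, 1:] = [:0, 1:] - [:x:]" by simp
  then show ?thesis
    using diff_power_CHAR[of "[:0, 1:] :: 'a poly" "[:x:]"] prime_p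
    by (simp only: semiring_char_poly poly_const_pow CHAR)
qed

lemma f_power_CHAR_cong: "[:-x, 1:] ^ p dvd f ^ p - [:poly f x ^ p:]"
proof -
  have "f ^ p - [:poly f x ^ p:] = (f - [:poly f x:]) ^ p"
    using diff_power_CHAR[of f "[:poly f x:]"] prime_p by (simp only: semiring_char_poly poly_const_pow CHAR)
  then show ?thesis using dvd_power_same[OF linear_dvd_diff_const] by metis
qed

lemma f_power_even: "(f ^ (n + 1))\<^sup>2 = f * f ^ p"
  by (simp add: p_eq power_mult[symmetric] power_add[symmetric] mult_2 power2_eq_square)

text \<open>Modulo (X - x)^p the polynomial f^p is the constant f(x)^p, so a^2 - f(x)^p f b^2 may be
  read as the difference of the squares of a and b f^(n+1).\<close>

lemma norm_dvd_if_cong: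
  assumes "m \<le> p" "[:-x, 1:] ^ m dvd a - b * f ^ (n + 1)"
  shows "[:-x, 1:] ^ m dvd a\<^sup>2 - [:poly f x ^ p:] * f * b\<^sup>2"
proof -
  have "a\<^sup>2 - [:poly f x ^ p:] * f * b\<^sup>2
      = (a - b * f ^ (n + 1)) * (a + b * f ^ (n + 1)) + b\<^sup>2 * f * (f ^ p - [:poly f x ^ p:])"
    using f_power_even by (simp add: algebra_simps power2_eq_square)
  moreover have "[:-x, 1:] ^ m dvd f ^ p - [:poly f x ^ p:]"
    using f_power_CHAR_cong assms(1) power_le_dvd by blast
  ultimately show ?thesis using assms(2) by simp
qed

text \<open>A solution would be a function with divisor \<open>p (Q - O)\<close> on the curve \<open>y\<^sup>2 = f\<close>, where \<open>Q\<close> has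
  abscissa \<open>x\<close>; its logarithmic derivative makes it an eigenvector of the invariant derivation.\<close>
lemma no_p_torsion:
  assumes x: "poly f x \<noteq> 0" and b: "b \<noteq> 0" and deg: "degree a \<le> n + 1" "degree b \<le> n - 1"
    and cong: "[:-x, 1:] ^ p dvd a - b * f ^ (n + 1)"
    and norm: "a\<^sup>2 - [:poly f x ^ p:] * f * b\<^sup>2 = [:\<kappa>:] * [:-x, 1:] ^ p"
  shows False
proof -
  define u where "u = [:-x, 1:]"
  have u0: "u \<noteq> 0" by (simp add: u_def)
  have deg_u: "degree (u ^ m) = m" for m by (simp add: u_def degree_linear_power)
  define c where "c = poly f x ^ p"
  have c: "c \<noteq> 0" using x by (simp add: c_def)
  define b2 where "b2 = [:c:] * f * b\<^sup>2"
  have b2: "b2 \<noteq> 0" using b c by (simp add: b2_def)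
  have degb2: "degree b2 = 3 + 2 * degree b"
    using b c by (simp add: b2_def degree_mult_eq degree_f power2_eq_square)
  have eq: "a\<^sup>2 - b2 = [:\<kappa>:] * u ^ p" using norm by (simp add: b2_def c_def u_def)
  have dega2: "degree (a\<^sup>2) = 2 * degree a" by (cases "a = 0") (simp_all add: degree_power_eq)
  \<comment> \<open>The degree of \<open>a\<^sup>2\<close> is even and that of \<open>b2\<close> is
    odd, so the norm cannot vanish.\<close>
  have \<kappa>: "\<kappa> \<noteq> 0"
  proof
    assume "\<kappa> = 0"
    then have "a\<^sup>2 = b2" using eq by simp
    then have "2 * degree a = 3 + 2 * degree b" using dega2 degb2 by simp
    then show False by presburger
  qed
  have deg_rhs: "degree ([:\<kappa>:] * u ^ p) = p" using \<kappa> u0 by (simp add: degree_mult_eq deg_u)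
  \<comment> \<open>With \<open>degree a = n + 1\<close> the norm would have degree 2 n + 2 instead
    of p.\<close>
  have dega: "degree a \<le> n"
  proof (rule ccontr)
    assume "\<not> degree a \<le> n"
    then have "degree a = n + 1" using deg by simp
    moreover have "degree b2 < degree (a\<^sup>2)" using degb2 dega2 deg calculation n_ge_2 by simp
    then have "degree (a\<^sup>2 - b2) = degree (a\<^sup>2)"
      using degree_add_eq_left[of "- b2" "a\<^sup>2"] by simp
    ultimately show False using eq deg_rhs dega2 p_eq by simp
  qed
  have "degree (a\<^sup>2 - b2) = p" using eq deg_rhs by simp
  moreover have "degree (a\<^sup>2 - b2) \<le> max (degree (a\<^sup>2)) (degree b2)" by (rule degree_diff_le_max)
  ultimately have degb: "degree b = n - 1" using degb2 dega2 dega deg p_eq n_ge_2 by auto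
  have a0: "a \<noteq> 0"
  proof
    assume "a = 0"
    then have "poly ([:\<kappa>:] * u ^ p) e1 = 0" using arg_cong[OF eq, of "\<lambda>h. poly h e1"] by (simp add: b2_def poly_f)
    then have "e1 = x" using \<kappa> by (simp add: u_def)
    then show False using x poly_f_eq_0_iff by simp
  qed
  \<comment> \<open>A common root can only be x. Dividing it out lowers the order of the congruence
    by one but that of the norm by two, so the norm would vanish at x to order p + 1.\<close>
  have coprime: "poly a r \<noteq> 0" if "poly b r = 0" for r
  proof
    assume "poly a r = 0"
    then have "poly ([:\<kappa>:] * u ^ p) r = 0"
      using arg_cong[OF eq, of "\<lambda>h. poly h r"] that by (simp add: b2_def)
    then have "r = x" using \<kappa> by (simp add: u_def)
    then have "u dvd a" "u dvd b" using that \<open>poly a r = 0\<close> by (simp_all add: u_def poly_eq_0_iff_dvd)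
    then obtain a1 b1 where ab: "a = u * a1" "b = u * b1" by (auto elim!: dvdE)
    have "u * u ^ (p - 1) dvd u * (a1 - b1 * f ^ (n + 1))"
      using cong p_eq by (simp add: ab u_def[symmetric] algebra_simps power_Suc[symmetric] del: power_Suc)
    then have "u ^ (p - 1) dvd a1 - b1 * f ^ (n + 1)" using u0 by (simp only: dvd_mult_cancel_left) simp
    then have "u ^ (p - 1) dvd a1\<^sup>2 - [:poly f x ^ p:] * f * b1\<^sup>2"
      unfolding u_def by (intro norm_dvd_if_cong) auto
    then have "u\<^sup>2 * u ^ (p - 1) dvd u\<^sup>2 * (a1\<^sup>2 - [:c:] * f * b1\<^sup>2)"
      unfolding c_def by (intro mult_dvd_mono) auto
    also have "u\<^sup>2 * (a1\<^sup>2 - [:c:] * f * b1\<^sup>2) = [:\<kappa>:] * u ^ p"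
      using eq by (simp add: b2_def ab algebra_simps power2_eq_square)
    finally have "u ^ (2 + (p - 1)) dvd [:\<kappa>:] * u ^ p" by (simp only: power_add)
    then have "degree (u ^ (2 + (p - 1))) \<le> degree ([:\<kappa>:] * u ^ p)"
      using \<kappa> u0 by (intro dvd_imp_degree_le) auto
    then show False unfolding deg_rhs deg_u using p_eq by simp
  qed
  \<comment> \<open>The norm is a constant times a p-th power, so its derivative is zero.\<close>
  have deriv: "2 * a * pderiv a = [:c:] * b * (pderiv f * b + 2 * f * pderiv b)"
  proof -
    have "pderiv ([:\<kappa>:] * u ^ p) = 0" using pderiv_power_CHAR[of u] by (simp add: pderiv_mult CHAR)
    then have "pderiv (a\<^sup>2) = pderiv b2" using arg_cong[OF eq, of pderiv] by (simp add: pderiv_diff)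
    then show ?thesis by (simp add: b2_def pderiv_mult power2_eq_square algebra_simps)
  qed
  \<comment> \<open>A constant \<open>a\<close> would give (e1 - x)^p = (e2 - x)^p, against the
    injectivity of Frobenius.\<close>
  have a': "pderiv a \<noteq> 0"
  proof
    assume "pderiv a = 0"
    then have "degree a = 0" using dega p_eq CHAR by (intro degree_eq_0_if_pderiv_eq_0) auto
    then obtain a0 where a0: "a = [:a0:]" by (rule degree_eq_zeroE)
    have "\<kappa> * (e - x) ^ p = a0\<^sup>2" if "poly f e = 0" for e
      using arg_cong[OF eq, of "\<lambda>h. poly h e"] that by (simp add: a0 b2_def u_def)
    then have "\<kappa> * (e1 - x) ^ p = \<kappa> * (e2 - x) ^ p" by (simp add: poly_f)
    then have "(e1 - x) ^ p = (e2 - x) ^ p" using \<kappa> by simp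
    then have "e1 - x = e2 - x" using power_CHAR_inj[of "e1 - x" "e2 - x"] CHAR prime_p by simp
    then show False using distinct by simp
  qed
  \<comment> \<open>\<open>b\<close> divides 2 a a' and shares no root with \<open>a\<close>. By
    degrees the quotient of a' by b is then a constant.\<close>
  have "b dvd pderiv a"
  proof (rule dvd_if_order_le[OF b a'])
    fix r
    show "order r b \<le> order r (pderiv a)"
    proof (cases "poly b r = 0")
      case True
      have nz: "[:2:] * a * pderiv a \<noteq> 0" using two_neq_0 a0 a' by simp
      have "[:2 :: 'a:] = 2" by (simp add: numeral_poly)
      then have "b dvd [:2:] * a * pderiv a" using deriv by simp
      then have "order r b \<le> order r ([:2:] * a * pderiv a)" using nz by (intro dvd_imp_order_le)
      also have "\<dots> = order r (pderiv a)"
        using nz order_0I[OF coprime[OF True]] two_neq_0 order_0I[of "[:2:]" r] by (simp add: order_mult)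
      finally show ?thesis .
    qed (simp add: order_0I)
  qed
  then obtain w where w: "pderiv a = b * w" by (elim dvdE)
  have "degree (pderiv a) \<le> degree a - 1" by (rule degree_le) (auto simp: coeff_pderiv coeff_eq_0)
  then have "degree b + degree w \<le> n - 1" using w a' b dega by (simp add: degree_mult_eq)
  then have "degree w = 0" using degb by simp
  then obtain g where g: "w = [:g:]" by (rule degree_eq_zeroE)
  have g0: "g \<noteq> 0" using a' w g by auto
  \<comment> \<open>Scaling \<open>b\<close> by a square root of f(x)^p brings both differential
    equations into the form of an eigenvector, with eigenvalue parameter g / h.\<close>
  obtain h where h: "h\<^sup>2 = c" using nth_root_exists[of 2 c] by auto
  have h0: "h \<noteq> 0" using h c by auto
  obtain G where G: "pderiv G = f ^ n" using ex_G by blast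
  define b' where "b' = smult h b"
  have "[:2 * g:] = 2 * [:g:]" by (simp add: numeral_poly mult_pCons_left)
  then have "b * ([:2 * g:] * a) = b * ([:c:] * (pderiv f * b + 2 * f * pderiv b))"
    using deriv unfolding w g by (simp only: ac_simps)
  then have 2: "smult (2 * g) a = smult c (pderiv f * b + 2 * f * pderiv b)"
    using b by (simp add: smult_conv_const_mult)
  show False
  proof (rule no_eigenvector_if_exact[OF _ _ f_neq_0 G a0])
    show "prime CHAR('a)" "CHAR('a) = 2 * n + 1" using CHAR prime_p p_eq by simp_all
    show "g / h \<noteq> 0" using g0 h0 by simp
    show "pderiv a = smult (g / h) b'" using h0 by (simp add: b'_def w g mult_pCons_right)
    have "smult h (smult (2 * (g / h)) a) = smult h (pderiv f * b' + 2 * f * pderiv b')"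
      using 2 h0 by (simp add: b'_def pderiv_smult h[symmetric] power2_eq_square smult_add_right mult.assoc)
    then show "smult (2 * (g / h)) a = pderiv f * b' + 2 * f * pderiv b'" using h0 by (metis smult_cancel)
  qed
qed

end

section \<open>Multiplication by p\<close>

text \<open>Exponents are written as r + t m. For m = p the digit r will be an exponent of X and t
  an exponent of the parameter that stands for X^p.\<close>

lemma poly_eq_sum_digits:
  fixes h :: "'a::comm_monoid_add poly"
  assumes "degree h < m * T"
  shows "(\<Sum>t<T. \<Sum>r<m. monom (coeff h (r + t * m)) (r + t * m)) = h"
proof -
  have "(\<Sum>t<T. \<Sum>r<m. monom (coeff h (r + t * m)) (r + t * m))
      = (\<Sum>t<T. \<Sum>i = t * m..<t * m + m. monom (coeff h i) i)"
  proof (rule sum.cong[OF refl])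
    fix t
    show "(\<Sum>r<m. monom (coeff h (r + t * m)) (r + t * m)) = (\<Sum>i = t * m..<t * m + m. monom (coeff h i) i)"
      using sum.shift_bounds_nat_ivl[of "\<lambda>i. monom (coeff h i) i" 0 "t * m" m]
      by (simp add: add.commute lessThan_atLeast0)
  qed
  also have "\<dots> = (\<Sum>i<T * m. monom (coeff h i) i)" by (rule sum.nat_group)
  also have "\<dots> = (\<Sum>i\<le>degree h. monom (coeff h i) i)"
    using assms by (intro sum.mono_neutral_right) (auto simp: coeff_eq_0 mult.commute)
  also have "\<dots> = h" by (rule poly_as_sum_of_monoms)
  finally show ?thesis .
qed

lemma diff_dvd_poly_diff: "x - y dvd poly A x - poly A y" for x :: "'a::comm_ring_1"
proof -
  obtain K where K: "A - [:poly A y:] = [:-y, 1:] * K"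
    using linear_dvd_diff_const[of y A] by (elim dvdE)
  have "poly A x - poly A y = (x - y) * poly K x" using arg_cong[OF K, of "\<lambda>h. poly h x"] by simp
  then show ?thesis by simp
qed

text \<open>Elements of \<open>'a poly poly\<close> are read as polynomials in X, the inner
  variable, and a parameter S, the outer one, which is specialised to X^p or to a constant s = x^p.
  The bound concerns X.\<close>

definition inner_degree_le :: "'a::zero poly poly \<Rightarrow> nat \<Rightarrow> bool" where
  "inner_degree_le A m \<longleftrightarrow> (\<forall>j. degree (coeff A j) \<le> m)"

lemma inner_degree_le_diff:
  "inner_degree_le A m \<Longrightarrow> inner_degree_le B m \<Longrightarrow> inner_degree_le (A - B) m"
  for A :: "'a::ab_group_add poly poly"
  by (simp add: inner_degree_le_def degree_diff_le)

lemma inner_degree_le_mult: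
  fixes A :: "'a::comm_semiring_0 poly poly"
  assumes "inner_degree_le A m" "inner_degree_le B k"
  shows "inner_degree_le (A * B) (m + k)"
  unfolding inner_degree_le_def coeff_mult
proof (intro allI degree_sum_le)
  fix i j
  have "degree (coeff A j * coeff B (i - j)) \<le> degree (coeff A j) + degree (coeff B (i - j))"
    by (rule degree_mult_le)
  also have "\<dots> \<le> m + k" using assms by (intro add_mono) (auto simp: inner_degree_le_def)
  finally show "degree (coeff A j * coeff B (i - j)) \<le> m + k" .
qed auto

lemma inner_degree_le_mono: "inner_degree_le A m \<Longrightarrow> m \<le> k \<Longrightarrow> inner_degree_le A k"
  by (meson inner_degree_le_def order_trans)

lemma inner_degree_le_pCons:
  "inner_degree_le (pCons a A) m \<longleftrightarrow> degree a \<le> m \<and> inner_degree_le A m"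
  by (auto simp: inner_degree_le_def coeff_pCons split: nat.splits)

lemma inner_degree_le_0 [simp]: "inner_degree_le 0 m" by (simp add: inner_degree_le_def)

lemma degree_poly_const_le:
  fixes A :: "'a::comm_semiring_0 poly poly"
  assumes "inner_degree_le A m"
  shows "degree (poly A [:s:]) \<le> m"
  using assms
proof (induction A)
  case (pCons a A)
  have "degree ([:s:] * poly A [:s:]) \<le> m"
    using pCons degree_mult_le[of "[:s:]" "poly A [:s:]"] by (auto simp: inner_degree_le_pCons)
  then show ?case using pCons by (auto simp: inner_degree_le_pCons intro: degree_add_le)
qed simp

text \<open>Dividing by S - s does not raise the degree in X; the coefficients are treated from the
  highest power of S downwards.\<close>

lemma inner_degree_le_cancel_const:
  fixes B :: "'a::comm_ring_1 poly poly"
  assumes "inner_degree_le ([:-[:s:], 1:] * B) m"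
  shows "inner_degree_le B m"
  unfolding inner_degree_le_def
proof
  fix j
  have step: "degree (coeff B k) \<le> m" if "degree (coeff B (Suc k)) \<le> m" for k
  proof -
    have "coeff ([:-[:s:], 1:] * B) (Suc k) = coeff B k - [:s:] * coeff B (Suc k)"
      by (simp add: mult_pCons_left)
    then have "coeff B k = coeff ([:-[:s:], 1:] * B) (Suc k) + [:s:] * coeff B (Suc k)" by simp
    moreover have "degree ([:s:] * coeff B (Suc k)) \<le> m"
      using that degree_mult_le[of "[:s:]" "coeff B (Suc k)"] by simp
    ultimately show ?thesis using assms by (simp only: inner_degree_le_def degree_add_le)
  qed
  show "degree (coeff B j) \<le> m"
  proof (cases "j \<le> Suc (degree B)")
    case True
    then show ?thesis by (rule inc_induct) (simp_all add: coeff_eq_0 step)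
  qed (simp add: coeff_eq_0)
qed

text \<open>Dividing by S - X^m lowers the bound by m; here the coefficients are treated from the
  lowest power of S upwards.\<close>

lemma inner_degree_le_cancel_monom:
  fixes Q :: "'a::idom poly poly"
  assumes "inner_degree_le ([:- ([:0, 1:] ^ m), 1:] * Q) (m + k)"
  shows "inner_degree_le Q k"
  unfolding inner_degree_le_def
proof
  fix j
  have top: "degree (coeff Q i) \<le> k"
    if eq: "coeff ([:- ([:0, 1:] ^ m), 1:] * Q) i = v - [:0, 1:] ^ m * coeff Q i" and v: "degree v \<le> k" for i v
  proof (rule ccontr)
    assume *: "\<not> degree (coeff Q i) \<le> k"
    then have "coeff Q i \<noteq> 0" by auto
    then have "degree ([:0, 1:] ^ m * coeff Q i) = m + degree (coeff Q i)"
      by (simp add: degree_mult_eq degree_power_eq)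
    moreover from this have "degree (v - [:0, 1:] ^ m * coeff Q i) = degree ([:0, 1:] ^ m * coeff Q i)"
      using * v degree_add_eq_right[of v "- ([:0, 1:] ^ m * coeff Q i)"] by simp
    ultimately have "degree (coeff ([:- ([:0, 1:] ^ m), 1:] * Q) i) = m + degree (coeff Q i)" using eq by simp
    then show False using assms * by (metis inner_degree_le_def nat_add_left_cancel_le)
  qed
  show "degree (coeff Q j) \<le> k"
  proof (induction j)
    case 0
    show ?case by (rule top[of _ 0]) (simp_all add: mult_pCons_left)
  next
    case (Suc j)
    then show ?case by (rule top[of _ "coeff Q j", rotated]) (simp_all add: mult_pCons_left)
  qed
qed

lemma coeff_poly_const:
  fixes Q :: "'a::comm_semiring_1 poly poly"
  shows "coeff (poly Q [:s:]) i = poly (map_poly (\<lambda>u. coeff u i) Q) s"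
  by (induction Q) (simp_all add: map_poly_pCons mult_pCons_left)

text \<open>The left side substitutes X = d(S) in A(X, S), which leaves a polynomial in S
  alone.\<close>

lemma poly_map_poly_pcompose:
  fixes A :: "'a::comm_ring_1 poly poly"
  shows "poly (poly (map_poly (\<lambda>u. pcompose u d) A) [:0, 1:]) s = poly (poly A [:s:]) (poly d s)"
  by (induction A) (simp_all add: map_poly_pCons poly_pcompose)

context supersingular_cubic
begin

text \<open>An approximant for all points at once: under S = x^p the polynomial S - X^p becomes -(X
  - x)^p, so A(X, x^p) - B(X, x^p) f^(n+1) vanishes to order p at x.\<close>

definition pade :: "'a poly poly \<Rightarrow> 'a poly poly \<Rightarrow> bool" where
  "pade A B \<longleftrightarrow> B \<noteq> 0 \<and> inner_degree_le A (n + 1) \<and> inner_degree_le B (n - 1) \<and>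
     degree A \<le> 2 * n + 1 \<and> degree B \<le> 2 * n - 1 \<and>
     poly A ([:0, 1:] ^ p) = poly B ([:0, 1:] ^ p) * f ^ (n + 1)"

text \<open>The unknowns are the coefficients of \<open>B\<close>. The equations say that in base p
  no exponent of B(X, X^p) f^(n+1) has last digit above n + 1. There are 2 n^2 unknowns and (n -
  1)(2 n + 2) = 2 n^2 - 2 equations.\<close>

lemma ex_pade: "\<exists>A B. pade A B"
proof -
  define I where "I = {..<n} \<times> {..<2 * n}"
  define J where "J = {n + 2..<p} \<times> {..<2 * n + 2}"
  define g where "g = (\<lambda>(i, j). monom (1 :: 'a) (i + j * p))"
  define c where "c = (\<lambda>ij (r, t). coeff (g ij * f ^ (n + 1)) (r + t * p))"
  have "card J < card I"
  proof -
    have "card J = (n - 1) * (2 * n + 2)" by (simp add: J_def p_eq)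
    also have "\<dots> < n * (2 * n)" using n_ge_2 by (cases n) (auto simp: algebra_simps)
    finally show ?thesis by (simp add: I_def)
  qed
  moreover have "finite I" "finite J" by (simp_all add: I_def J_def)
  ultimately obtain x where x: "\<exists>ij\<in>I. x ij \<noteq> 0" "\<And>rt. rt \<in> J \<Longrightarrow> (\<Sum>ij\<in>I. c ij rt * x ij) = 0"
    using homogeneous_system_nontrivial[of J I c] by blast
  define b where "b = (\<Sum>ij\<in>I. smult (x ij) (g ij))"
  define a where "a = b * f ^ (n + 1)"
  have Xp: "([:0, 1:] ^ p) ^ k = monom (1 :: 'a) (k * p)" for k
    by (simp add: monom_altdef power_mult[symmetric] mult.commute)
  define B where "B = (\<Sum>j<2 * n. monom (\<Sum>i<n. monom (x (i, j)) i) j)"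
  define A where "A = (\<Sum>t<2 * n + 2. monom (\<Sum>r<n + 2. monom (coeff a (r + t * p)) r) t)"
  have coeff_B: "coeff B j = (if j < 2 * n then \<Sum>i<n. monom (x (i, j)) i else 0)" for j
    by (simp add: B_def coeff_sum)
  have coeff_A: "coeff A t = (if t < 2 * n + 2 then \<Sum>r<n + 2. monom (coeff a (r + t * p)) r else 0)" for t
    by (simp only: A_def coeff_sum coeff_monom) simp
  have "poly B ([:0, 1:] ^ p) = (\<Sum>j<2 * n. \<Sum>i<n. smult (x (i, j)) (g (i, j)))"
    by (simp add: B_def poly_sum poly_monom Xp g_def sum_distrib_right mult_monom smult_monom)
  also have "\<dots> = (\<Sum>i<n. \<Sum>j<2 * n. smult (x (i, j)) (g (i, j)))" by (rule sum.swap)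
  also have "\<dots> = b" unfolding b_def I_def by (subst sum.cartesian_product) (simp add: case_prod_beta')
  finally have polyB: "poly B ([:0, 1:] ^ p) = b" .
  have "degree b \<le> n - 1 + (2 * n - 1) * p"
    unfolding b_def
  proof (rule degree_sum_le)
    fix ij assume "ij \<in> I"
    then have ij: "fst ij \<le> n - 1" "snd ij \<le> 2 * n - 1" by (auto simp: I_def)
    have "degree (smult (x ij) (g ij)) \<le> fst ij + snd ij * p"
      by (auto simp: g_def smult_monom degree_monom_le split: prod.splits)
    also have "\<dots> \<le> n - 1 + (2 * n - 1) * p" using ij by (intro add_mono mult_le_mono) auto
    finally show "degree (smult (x ij) (g ij)) \<le> n - 1 + (2 * n - 1) * p" .
  qed (simp add: \<open>finite I\<close>)
  then have "degree a \<le> n - 1 + (2 * n - 1) * p + 3 * (n + 1)"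
    unfolding a_def using degree_mult_le[of b "f ^ (n + 1)"] by (simp add: degree_power_eq degree_f del: power_Suc)
  \<comment> \<open>The bound is exactly (2 n + 1) p, which gives \<open>A\<close> degree at most 2
    n + 1 in S.\<close>
  also have "\<dots> = (2 * n + 1) * p" using n_ge_2 by (cases n) (simp_all add: p_eq algebra_simps)
  also have "\<dots> < p * (2 * n + 2)" using p_eq by simp
  finally have deg_a: "degree a < p * (2 * n + 2)" .
  have zero: "coeff a (r + t * p) = 0" if "t < 2 * n + 2" "n + 2 \<le> r" "r < p" for r t
  proof -
    have "coeff a (r + t * p) = (\<Sum>ij\<in>I. c ij (r, t) * x ij)"
      by (simp add: a_def b_def sum_distrib_right coeff_sum c_def mult.commute)
    also have "\<dots> = 0" using that by (intro x) (simp add: J_def)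
    finally show ?thesis .
  qed
  have "poly A ([:0, 1:] ^ p) = (\<Sum>t<2 * n + 2. \<Sum>r<n + 2. monom (coeff a (r + t * p)) (r + t * p))"
    by (simp only: A_def poly_sum poly_monom Xp sum_distrib_right mult_monom mult_1_right)
  also have "\<dots> = (\<Sum>t<2 * n + 2. \<Sum>r<p. monom (coeff a (r + t * p)) (r + t * p))"
  proof (rule sum.cong[OF refl], rule sum.mono_neutral_left)
    fix t assume "t \<in> {..<2 * n + 2}"
    then show "\<forall>r\<in>{..<p} - {..<n + 2}. monom (coeff a (r + t * p)) (r + t * p) = 0"
      using zero by auto
  qed (use n_ge_2 p_eq in auto)
  also have "\<dots> = a" using deg_a by (rule poly_eq_sum_digits)
  finally have polyA: "poly A ([:0, 1:] ^ p) = a" .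
  have "B \<noteq> 0"
  proof
    assume "B = 0"
    obtain i j where ij: "i < n" "j < 2 * n" "x (i, j) \<noteq> 0" using x(1) by (auto simp: I_def)
    have "coeff (coeff B j) i = x (i, j)" using ij by (simp add: coeff_B coeff_sum)
    then show False using \<open>B = 0\<close> ij by simp
  qed
  moreover have "inner_degree_le B (n - 1)"
    unfolding inner_degree_le_def coeff_B
    by (auto intro!: degree_sum_le order_trans[OF degree_monom_le])
  moreover have "inner_degree_le A (n + 1)"
    unfolding inner_degree_le_def coeff_A
    by (auto intro!: degree_sum_le order_trans[OF degree_monom_le] simp del: sum.lessThan_Suc)
  moreover have "degree B \<le> 2 * n - 1" by (rule degree_le) (auto simp: coeff_B)
  moreover have "degree A \<le> 2 * n + 1" by (rule degree_le) (auto simp: coeff_A simp del: sum.lessThan_Suc)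
  ultimately have "pade A B" unfolding pade_def using polyA polyB a_def by simp
  then show ?thesis by blast
qed

lemma Xp_minus_const: "\<exists>x. s = x ^ p \<and> [:0, 1:] ^ p - [:s:] = [:-x, 1:] ^ p" for s :: 'a
proof -
  have "p > 0" using p_eq by simp
  then obtain x where "x ^ p = s" using nth_root_exists[of p s] by auto
  then show ?thesis using linear_power_CHAR[of x] by auto
qed

text \<open>An approximant of least degree in S works: if B(X, s) = 0, then X^p - s divides A(X, s),
  which has degree below p and hence vanishes, and S - s can be cancelled from both.\<close>

lemma ex_primitive_pade: "\<exists>A B. pade A B \<and> (\<forall>s. poly B [:s:] \<noteq> 0)"
proof -
  obtain A0 B0 where "pade A0 B0" using ex_pade by blast
  then have "\<exists>m. \<exists>A B. pade A B \<and> degree B = m" by blast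
  then obtain A B where AB: "pade A B"
    and min: "\<And>A' B'. pade A' B' \<Longrightarrow> degree B \<le> degree B'"
    using exists_least_iff[of "\<lambda>m. \<exists>A B. pade A B \<and> degree B = m"] by (metis not_le)
  have "poly B [:s:] \<noteq> 0" for s
  proof
    assume "poly B [:s:] = 0"
    then obtain B' where B': "B = [:-[:s:], 1:] * B'" by (auto simp: poly_eq_0_iff_dvd elim: dvdE)
    have eq: "poly A ([:0, 1:] ^ p) = poly B ([:0, 1:] ^ p) * f ^ (n + 1)"
      and A_le: "inner_degree_le A (n + 1)" using AB by (simp_all add: pade_def)
    let ?v = "[:0, 1:] ^ p - [:s:]"
    have degv: "degree ?v = p" using Xp_minus_const[of s] by (auto simp: degree_linear_power)
    have v0: "?v \<noteq> 0" using degv p_eq by auto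
    have v: "poly ([:-[:s:], 1:] * C) ([:0, 1:] ^ p) = ?v * poly C ([:0, 1:] ^ p)" for C
      by (simp del: minus_pCons add: algebra_simps)
    have "?v dvd poly A ([:0, 1:] ^ p)" unfolding eq B' v by simp
    from dvd_diff[OF this diff_dvd_poly_diff[of _ "[:s:]" A]] have "?v dvd poly A [:s:]" by simp
    moreover have "degree (poly A [:s:]) < degree ?v"
      using degree_poly_const_le[OF A_le, of s] degv p_eq n_ge_2 by simp
    ultimately have "poly A [:s:] = 0" by (metis dvd_imp_degree_le not_le)
    then obtain A' where A': "A = [:-[:s:], 1:] * A'" by (auto simp: poly_eq_0_iff_dvd elim: dvdE)
    have nz: "B' \<noteq> 0" using AB B' by (auto simp: pade_def)
    have "degree A' \<le> degree A" by (cases "A' = 0") (simp_all add: A' degree_mult_eq)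
    moreover have degB: "degree B = Suc (degree B')" using nz by (simp add: B' degree_mult_eq)
    moreover have "poly A' ([:0, 1:] ^ p) = poly B' ([:0, 1:] ^ p) * f ^ (n + 1)"
      using eq v0 unfolding A' B' v by (simp add: mult.assoc)
    ultimately have "pade A' B'"
      using AB nz inner_degree_le_cancel_const[of s A' "n + 1"] inner_degree_le_cancel_const[of s B' "n - 1"]
      unfolding pade_def A'[symmetric] B'[symmetric] by auto
    then show False using min[of A' B'] degB by simp
  qed
  with AB show ?thesis by blast
qed

end

context supersingular_cubic
begin

lemma order_f: "poly f x = 0 \<Longrightarrow> order x f = 1"
  using distinct order_power_n_n[of x 1]
  by (auto simp: poly_f_eq_0_iff f_def order_mult order_0I)

lemma order_power_f: "poly f x = 0 \<Longrightarrow> order x (f ^ m) = m"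
  by (induction m) (simp_all add: order_mult order_f)

text \<open>\<open>d(x\<^sup>p)\<close> is the abscissa of \<open>p Q\<close> if \<open>Q\<close> has abscissa \<open>x\<close>.\<close>
lemma ex_multiplication_by_p:
  obtains c and d :: "'a poly" and B A :: "'a poly poly" where "c \<noteq> 0" "degree d \<le> 4 * n + 1"
    "poly d (e1 ^ p) = e1" "poly d (e2 ^ p) = e2" "poly d (e3 ^ p) = e3"
    "\<forall>s. poly B [:s:] \<noteq> 0" "\<forall>s. degree (poly A [:s:]) \<le> n + 1" "\<forall>s. degree (poly B [:s:]) \<le> n - 1"
    "\<forall>x. [:-x, 1:] ^ p dvd poly A [:x ^ p:] - poly B [:x ^ p:] * f ^ (n + 1)"
    "\<forall>x. (poly A [:x ^ p:])\<^sup>2 - [:poly f x ^ p:] * f * (poly B [:x ^ p:])\<^sup>2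
        = [:c:] * [:-x, 1:] ^ p * [:- poly d (x ^ p), 1:]"
proof -
  obtain A B where pade: "pade A B" and B0: "\<And>s. poly B [:s:] \<noteq> 0" using ex_primitive_pade by blast
  define X :: "'a poly" where "X = [:0, 1:] ^ p"
  have eq: "poly A X = poly B X * f ^ (n + 1)" and A_le: "inner_degree_le A (n + 1)"
    and B_le: "inner_degree_le B (n - 1)" and degA: "degree A \<le> 2 * n + 1" and degB: "degree B \<le> 2 * n - 1"
    using pade by (simp_all add: pade_def X_def)
  \<comment> \<open>The Frobenius twist of \<open>f\<close> in the variable S: F(X^p) = f^p and
    F(x^p) = f(x)^p.\<close>
  define F where "F = [:-[:e1 ^ p:], 1:] * [:-[:e2 ^ p:], 1:] * [:-[:e3 ^ p:], 1:]"
  have polyF: "poly F y = (y - [:e1 ^ p:]) * (y - [:e2 ^ p:]) * (y - [:e3 ^ p:])" for y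
    by (simp add: F_def del: minus_pCons)
  have "poly F X = f ^ p"
    unfolding polyF X_def f_def power_mult_distrib linear_power_CHAR ..
  have diff_p: "x ^ p - e ^ p = (x - e) ^ p" for x e :: 'a
    using diff_power_CHAR[of x e] prime_p CHAR by simp
  have F_const: "poly F [:x ^ p:] = [:poly f x ^ p:]" for x
    by (simp add: polyF poly_f power_mult_distrib diff_p mult_pCons_left)
  \<comment> \<open>The norm with f(x)^p replaced by F(S). It vanishes at S = X^p, where f F becomes
    the square of f^(n+1).\<close>
  define E where "E = A\<^sup>2 - [:f:] * F * B\<^sup>2"
  have "poly E X = 0"
    using f_power_even by (simp add: E_def eq \<open>poly F X = f ^ p\<close> algebra_simps power2_eq_square)
  then obtain Q where Q: "E = [:-X, 1:] * Q" by (auto simp: poly_eq_0_iff_dvd elim: dvdE)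
  have F_le: "inner_degree_le F 0"
    unfolding F_def
    by (intro inner_degree_le_mult[of _ 0 _ 0, simplified]) (simp_all add: inner_degree_le_pCons)
  have "inner_degree_le E (p + 1)"
    unfolding E_def power2_eq_square
  proof (rule inner_degree_le_diff)
    show "inner_degree_le (A * A) (p + 1)"
      using inner_degree_le_mult[OF A_le A_le] by (simp add: p_eq mult_2)
    have "inner_degree_le [:f:] 3" by (simp add: inner_degree_le_pCons degree_f)
    from inner_degree_le_mult[OF inner_degree_le_mult[OF this F_le] inner_degree_le_mult[OF B_le B_le]]
    show "inner_degree_le ([:f:] * F * (B * B)) (p + 1)"
      by (rule inner_degree_le_mono) (use n_ge_2 p_eq in simp)
  qed
  \<comment> \<open>Degree p + 1 in X, less the p zeros at x, leaves a linear factor whose root is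
    the abscissa sought.\<close>
  then have Q_le: "inner_degree_le Q 1"
    unfolding Q X_def by (rule inner_degree_le_cancel_monom)
  have degQ: "degree Q \<le> 4 * n + 1"
  proof (cases "Q = 0")
    case False
    have "degree (A\<^sup>2) \<le> 4 * n + 2" using degree_power_le[of A 2] degA by simp
    moreover have "degree ([:f:] * F * B\<^sup>2) \<le> 4 * n + 2"
    proof -
      have "degree F \<le> 3" unfolding F_def
        using degree_mult_le[of "[:-[:e1 ^ p:], 1:]" "[:-[:e2 ^ p:], 1:]"]
          degree_mult_le[of "[:-[:e1 ^ p:], 1:] * [:-[:e2 ^ p:], 1:]" "[:-[:e3 ^ p:], 1:]"] by simp
      then show ?thesis
        using degree_mult_le[of "[:f:]" F] degree_mult_le[of "[:f:] * F" "B\<^sup>2"]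
          degree_power_le[of B 2] degB n_ge_2 by simp
    qed
    ultimately have "degree E \<le> 4 * n + 2" unfolding E_def by (rule degree_diff_le)
    then show ?thesis using False by (simp add: Q degree_mult_eq)
  qed simp
  define c where "c = map_poly (\<lambda>u. coeff u 1) Q"
  define d0 where "d0 = map_poly (\<lambda>u. coeff u 0) Q"
  have Q_const: "poly Q [:s:] = [:poly d0 s, poly c s:]" for s
  proof (rule poly_eqI)
    fix i
    have "degree (poly Q [:s:]) \<le> 1" using Q_le by (rule degree_poly_const_le)
    then have "coeff (poly Q [:s:]) i = 0" if "i > 1" using that by (simp add: coeff_eq_0)
    moreover have "coeff (poly Q [:s:]) 0 = poly d0 s" "coeff (poly Q [:s:]) 1 = poly c s"
      unfolding d0_def c_def by (rule coeff_poly_const)+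
    ultimately show "coeff (poly Q [:s:]) i = coeff [:poly d0 s, poly c s:] i"
      by (cases "i = 0 \<or> i = 1") (auto simp: coeff_pCons split: nat.splits)
  qed
  have norm: "(poly A [:x ^ p:])\<^sup>2 - [:poly f x ^ p:] * f * (poly B [:x ^ p:])\<^sup>2
      = [:-x, 1:] ^ p * [:- poly d0 (x ^ p), - poly c (x ^ p):]" for x
  proof -
    have "poly E [:x ^ p:] = ([:x ^ p:] - X) * [:poly d0 (x ^ p), poly c (x ^ p):]"
      by (simp add: Q Q_const)
    moreover have "poly E [:x ^ p:] = (poly A [:x ^ p:])\<^sup>2 - [:poly f x ^ p:] * f * (poly B [:x ^ p:])\<^sup>2"
      by (simp add: E_def F_const algebra_simps)
    moreover have "([:x ^ p:] - X) * [:poly d0 (x ^ p), poly c (x ^ p):]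
        = (X - [:x ^ p:]) * - [:poly d0 (x ^ p), poly c (x ^ p):]" by (simp only: mult_minus_right minus_mult_left minus_diff_eq)
    ultimately show ?thesis by (simp add: linear_power_CHAR X_def)
  qed
  have degs: "degree (poly A [:s:]) \<le> n + 1" "degree (poly B [:s:]) \<le> n - 1" for s
    using A_le B_le by (auto intro: degree_poly_const_le)
  have cong: "[:-x, 1:] ^ p dvd poly A [:x ^ p:] - poly B [:x ^ p:] * f ^ (n + 1)" for x
  proof -
    have *: "[:-x, 1:] ^ p dvd poly C X - poly C [:x ^ p:]" for C
      using diff_dvd_poly_diff[of X "[:x ^ p:]" C] by (simp add: linear_power_CHAR X_def)
    have "poly A [:x ^ p:] - poly B [:x ^ p:] * f ^ (n + 1)
        = (poly B X - poly B [:x ^ p:]) * f ^ (n + 1) - (poly A X - poly A [:x ^ p:])"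
      by (simp add: eq algebra_simps)
    then show ?thesis using *[of A] *[of B] by (simp only: dvd_diff dvd_mult2)
  qed
  \<comment> \<open>Over a root e of f the point has order 2, so p Q = Q is expected. There the norm
    is a square, of even order at e, while (X - e)^p has odd order; the remaining factor must vanish
    at e.\<close>
  have root_case: "poly c (e ^ p) \<noteq> 0 \<and> poly d0 (e ^ p) = - e * poly c (e ^ p)" if e: "poly f e = 0" for e
  proof -
    define a where "a = poly A [:e ^ p:]"
    define b where "b = poly B [:e ^ p:]"
    define l where "l = [:- poly d0 (e ^ p), - poly c (e ^ p):]"
    have p0: "p > 0" using p_eq by simp
    have a2: "a\<^sup>2 = [:-e, 1:] ^ p * l" using norm[of e] e p0 by (simp add: a_def l_def zero_power)
    have b0: "b \<noteq> 0" using B0 by (simp add: b_def)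
    have "a \<noteq> 0"
    proof
      assume "a = 0"
      then have "[:-e, 1:] ^ p dvd b * f ^ (n + 1)" using cong[of e] by (simp add: a_def b_def)
      then have "p \<le> order e (b * f ^ (n + 1))" using b0 order_divides[of e p "b * f ^ (n + 1)"] by simp
      also have "\<dots> = order e b + (n + 1)" using b0 order_power_f[OF e, of "n + 1"] by (simp add: order_mult)
      also have "order e b \<le> degree b" using b0 by (rule order_degree)
      finally show False using degs(2)[of "e ^ p"] p_eq n_ge_2 by (simp add: b_def)
    qed
    then have l0: "l \<noteq> 0" using a2 by auto
    have "2 * order e a = p + order e l"
      using arg_cong[OF a2, of "order e"] \<open>a \<noteq> 0\<close> l0
      by (simp add: power2_eq_square order_mult order_power_n_n)
    then have "order e l \<noteq> 0" using p_eq by presburger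
    then have "poly l e = 0" using order_root by blast
    then have "poly d0 (e ^ p) = - e * poly c (e ^ p)" by (simp add: l_def algebra_simps) (metis add_eq_0_iff2 minus_unique)
    then show ?thesis using l0 by (auto simp: l_def)
  qed
  \<comment> \<open>A zero of \<open>c\<close> would make the linear factor constant, that is, p Q =
    O. A polynomial without zeros is constant, and dividing by it turns the root of the linear
    factor into a polynomial \<open>d\<close>.\<close>
  have c_nz: "poly c s \<noteq> 0" for s
  proof
    assume c: "poly c s = 0"
    obtain x where x: "s = x ^ p" using Xp_minus_const by blast
    show False
    proof (cases "poly f x = 0")
      case True
      then show False using root_case[OF True] c x by simp
    next
      case False
      show False
        by (rule no_p_torsion[OF False B0 degs cong, of "- poly d0 (x ^ p)"])
          (use norm[of x] c x in \<open>simp add: mult.commute\<close>)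
    qed
  qed
  then have "degree c = 0" using alg_closed_imp_poly_has_root[of c] by auto
  then obtain c0 where c0: "c = [:c0:]" by (rule degree_eq_zeroE)
  have c00: "c0 \<noteq> 0" using c_nz[of 0] c0 by simp
  define d where "d = smult (- 1 / c0) d0"
  show ?thesis
  proof (rule that[of "- c0" d B A])
    show "- c0 \<noteq> 0" using c00 by simp
    have "degree d0 \<le> degree Q" unfolding d0_def by (rule map_poly_degree_leq)
    then show "degree d \<le> 4 * n + 1" using degQ by (simp add: d_def)
    have "poly d (e ^ p) = e" if "poly f e = 0" for e
      using root_case[OF that] c00 by (simp add: d_def c0)
    then show "poly d (e1 ^ p) = e1" "poly d (e2 ^ p) = e2" "poly d (e3 ^ p) = e3"
      by (simp_all add: poly_f)
    have "[:- poly d0 s, - poly c s:] = [:- c0:] * [:- poly d s, 1:]" for s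
      using c00 by (simp add: d_def c0 mult_pCons_left)
    then show "\<forall>x. (poly A [:x ^ p:])\<^sup>2 - [:poly f x ^ p:] * f * (poly B [:x ^ p:])\<^sup>2
        = [:- c0:] * [:-x, 1:] ^ p * [:- poly d (x ^ p), 1:]"
      unfolding norm by (simp only: ac_simps) simp
  qed (use B0 degs cong in auto)
qed

text \<open>The relation up to squares comes from evaluating the norm identity at X = d(x^p), where
  its right side vanishes.\<close>

lemma ex_frobenius_affine:
  obtains \<alpha> \<beta> and q :: nat where "\<alpha> \<noteq> 0" "q = p \<or> q = p\<^sup>2"
    "\<alpha> * e1 ^ q + \<beta> = e1" "\<alpha> * e2 ^ q + \<beta> = e2" "\<alpha> * e3 ^ q + \<beta> = e3"
    "\<forall>x. \<exists>a b c. c \<noteq> 0 \<and> b \<noteq> 0 \<and> degree a \<le> n + 1 \<and> degree b \<le> n - 1 \<and>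
       [:-x, 1:] ^ p dvd a - b * f ^ (n + 1) \<and>
       a\<^sup>2 - [:poly f x ^ p:] * f * b\<^sup>2 = [:c:] * [:-x, 1:] ^ p * [:- (\<alpha> * x ^ q + \<beta>), 1:]"
proof -
  obtain c and d :: "'a poly" and B A :: "'a poly poly" where c: "c \<noteq> 0" and degd: "degree d \<le> 4 * n + 1"
    and d_e: "poly d (e1 ^ p) = e1" "poly d (e2 ^ p) = e2" "poly d (e3 ^ p) = e3"
    and B0': "\<forall>s. poly B [:s:] \<noteq> 0"
    and degs': "\<forall>s. degree (poly A [:s:]) \<le> n + 1" "\<forall>s. degree (poly B [:s:]) \<le> n - 1"
    and cong': "\<forall>x. [:-x, 1:] ^ p dvd poly A [:x ^ p:] - poly B [:x ^ p:] * f ^ (n + 1)"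
    and norm': "\<forall>x. (poly A [:x ^ p:])\<^sup>2 - [:poly f x ^ p:] * f * (poly B [:x ^ p:])\<^sup>2
        = [:c:] * [:-x, 1:] ^ p * [:- poly d (x ^ p), 1:]"
    by (rule ex_multiplication_by_p)
  note B0 = B0'[rule_format] and degs = degs'[rule_format] and cong = cong'[rule_format]
    and norm = norm'[rule_format]
  have p0: "p > 0" using p_eq by simp
  have inj: "x ^ p = y ^ p \<Longrightarrow> x = y" for x y :: 'a
    using power_CHAR_inj[of x y] CHAR prime_p by simp
  have d_pos: "degree d > 0"
  proof (rule ccontr)
    assume "\<not> degree d > 0"
    then obtain k where "d = [:k:]" by (auto elim: degree_eq_zeroE)
    then show False using d_e distinct by simp
  qed
  define A' where "A' = poly (map_poly (\<lambda>u. pcompose u d) A) [:0, 1:]"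
  define B' where "B' = poly (map_poly (\<lambda>u. pcompose u d) B) [:0, 1:]"
  have A': "poly A' s = poly (poly A [:s:]) (poly d s)" and B': "poly B' s = poly (poly B [:s:]) (poly d s)" for s
    unfolding A'_def B'_def by (rule poly_map_poly_pcompose)+
  have surj: "\<exists>x. s = x ^ p" for s :: 'a using Xp_minus_const by blast
  have diff_p: "x ^ p - e ^ p = (x - e) ^ p" for x e :: 'a
    using diff_power_CHAR[of x e] prime_p CHAR by simp
  have A'B': "(poly A' (x ^ p))\<^sup>2 = poly f x ^ p * poly f (poly d (x ^ p)) * (poly B' (x ^ p))\<^sup>2" for x
    using arg_cong[OF norm[of x], of "\<lambda>h. poly h (poly d (x ^ p))"] by (simp add: A' B')
  have eq: "(d - [:e1:]) * (d - [:e2:]) * (d - [:e3:])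
      * ([:-(e1 ^ p), 1:] * [:-(e2 ^ p), 1:] * [:-(e3 ^ p), 1:]) * B'\<^sup>2 = A'\<^sup>2"
  proof (rule poly_eqI_alg_closed)
    fix s :: 'a
    obtain x where x: "s = x ^ p" using surj[of s] by auto
    show "poly ((d - [:e1:]) * (d - [:e2:]) * (d - [:e3:])
      * ([:-(e1 ^ p), 1:] * [:-(e2 ^ p), 1:] * [:-(e3 ^ p), 1:]) * B'\<^sup>2) s = poly (A'\<^sup>2) s"
      using A'B'[of x] by (simp add: x poly_f diff_p power_mult_distrib ac_simps)
  qed
  \<comment> \<open>Otherwise \<open>A'\<close> vanishes too and the norm has a double zero at X =
    d(x^p), which forces d(x^p) = x. Then d^p = X, impossible by degree.\<close>
  have "B' \<noteq> 0"
  proof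
    assume B'0: "B' = 0"
    have "poly (d ^ p) s = poly [:0, 1:] s" for s :: 'a
    proof -
      obtain x where x: "s = x ^ p" using surj[of s] by auto
      let ?y = "poly d s" let ?l = "[:-?y, 1:]"
      have "poly (poly B [:s:]) ?y = 0" using B'0 B'[of s] by simp
      moreover have "poly (poly A [:s:]) ?y = 0" using A'B'[of x] B'0 A'[of s] x p0 by (simp add: zero_power)
      ultimately have "?l dvd poly A [:s:]" "?l dvd poly B [:s:]" by (simp_all add: poly_eq_0_iff_dvd)
      then have "?l\<^sup>2 dvd (poly A [:s:])\<^sup>2 - [:poly f x ^ p:] * f * (poly B [:s:])\<^sup>2"
        by (intro dvd_diff dvd_mult dvd_power_same)
      then have "?l * ?l dvd ?l * ([:c:] * [:-x, 1:] ^ p)"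
        using norm[of x] x by (simp add: power2_eq_square ac_simps)
      then have "?l dvd [:c:] * [:-x, 1:] ^ p" by (simp only: dvd_mult_cancel_left) simp
      then have "poly ([:c:] * [:-x, 1:] ^ p) ?y = 0" by (simp only: poly_eq_0_iff_dvd)
      then have "?y = x" using c by simp
      then show ?thesis by (simp add: x)
    qed
    then have "d ^ p = [:0, 1:]" by (rule poly_eqI_alg_closed)
    then have "degree (d ^ p) = 1" by simp
    then have "p * degree d = 1" using d_pos by (subst (asm) degree_power_eq) auto
    then have "p = 1" by simp
    then show False using p_eq n_ge_2 by simp
  qed
  have ep: "e1 ^ p \<noteq> e2 ^ p" "e1 ^ p \<noteq> e3 ^ p" "e2 ^ p \<noteq> e3 ^ p" using inj distinct by auto
  have "\<exists>\<alpha> \<beta> q. \<alpha> \<noteq> 0 \<and> (q = p \<or> q = p\<^sup>2) \<and> (\<forall>x. poly d (x ^ p) = \<alpha> * x ^ q + \<beta>)"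
  proof (cases "pderiv d = 0")
    case False
    have "degree d = 1"
      by (rule degree_eq_1_if_cubic_square[OF distinct ep d_pos \<open>B' \<noteq> 0\<close> eq False])
    then obtain \<beta> \<alpha> where d: "d = [:\<beta>, \<alpha>:]" "\<alpha> \<noteq> 0" by (metis degree1_coeffs)
    then show ?thesis by (intro exI[of _ \<alpha>] exI[of _ \<beta>] exI[of _ p]) (simp add: algebra_simps)
  next
    case True
    then obtain \<delta> where \<delta>: "d = \<delta> ^ p" using pderiv_eq_0_imp_power_CHAR[of d] prime_p CHAR by auto
    have degd': "degree d = p * degree \<delta>" using d_pos \<delta> p0 by (cases "\<delta> = 0") (simp_all add: degree_power_eq zero_power)
    then have deg\<delta>: "degree \<delta> > 0" using d_pos by simp
    obtain r1 r2 r3 where r: "e1 = r1 ^ p" "e2 = r2 ^ p" "e3 = r3 ^ p" using surj by metis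
    have rd: "r1 \<noteq> r2" "r1 \<noteq> r3" "r2 \<noteq> r3" using r distinct by auto
    have pw: "\<delta> ^ p - [:y ^ p:] = (\<delta> - [:y:]) ^ p" for y
      using diff_power_CHAR[of \<delta> "[:y:]"] prime_p CHAR by (simp add: poly_const_pow)
    define \<phi> where "\<phi> = (\<delta> - [:r1:]) * (\<delta> - [:r2:]) * (\<delta> - [:r3:])"
    have lin: "\<delta> - [:y:] \<noteq> 0" for y using deg\<delta> by auto
    have \<phi>0: "\<phi> \<noteq> 0" unfolding \<phi>_def using lin by (simp del: diff_pCons)
    \<comment> \<open>A second p-th root would give \<open>d\<close> degree at least p^2, which
      exceeds 4 n + 1.\<close>
    have "pderiv \<delta> \<noteq> 0"
    proof
      assume "pderiv \<delta> = 0"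
      then obtain \<epsilon> where "\<delta> = \<epsilon> ^ p" using pderiv_eq_0_imp_power_CHAR[of \<delta>] prime_p CHAR by auto
      then have "degree \<delta> = p * degree \<epsilon>" using deg\<delta> p0 by (cases "\<epsilon> = 0") (simp_all add: degree_power_eq zero_power)
      then have "p * p \<le> degree d" using deg\<delta> degd' by (cases "degree \<epsilon>") simp_all
      moreover have "p * p = 4 * (n * n) + 4 * n + 1" by (simp add: p_eq algebra_simps)
      moreover have "n * n > 0" using n_ge_2 by simp
      ultimately show False using degd by linarith
    qed
    \<comment> \<open>Passing to the p-th root of \<open>d\<close> replaces the roots of f by their
      p-th roots, at the cost of a square.\<close>
    have "\<phi> ^ p = \<phi> * (\<phi> ^ n)\<^sup>2" unfolding p_eq by (simp add: power_mult[symmetric] mult.commute)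
    moreover have "(d - [:e1:]) * (d - [:e2:]) * (d - [:e3:]) = \<phi> ^ p"
      unfolding \<delta> r pw \<phi>_def by (simp only: power_mult_distrib)
    ultimately have eq': "\<phi> * ([:-(e1 ^ p), 1:] * [:-(e2 ^ p), 1:] * [:-(e3 ^ p), 1:]) * (\<phi> ^ n * B')\<^sup>2 = A'\<^sup>2"
      using eq by (simp only: power_mult_distrib ac_simps)
    have "\<phi> ^ n * B' \<noteq> 0" using \<phi>0 \<open>B' \<noteq> 0\<close> by simp
    then have "degree \<delta> = 1"
      using degree_eq_1_if_cubic_square[OF rd ep deg\<delta> _ eq'[unfolded \<phi>_def] \<open>pderiv \<delta> \<noteq> 0\<close>]
      by (simp add: \<phi>_def)
    then obtain \<beta> \<alpha> where d: "\<delta> = [:\<beta>, \<alpha>:]" "\<alpha> \<noteq> 0" by (metis degree1_coeffs)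
    have "poly d (x ^ p) = \<alpha> ^ p * x ^ (p\<^sup>2) + \<beta> ^ p" for x
    proof -
      have "poly d (x ^ p) = (\<alpha> * x ^ p + \<beta>) ^ p" by (simp add: \<delta> d ac_simps)
      also have "\<dots> = (\<alpha> * x ^ p) ^ p + \<beta> ^ p"
        by (rule freshmans_dream) (simp_all add: CHAR prime_p)
      finally show ?thesis by (simp only: power_mult_distrib power_mult[symmetric] power2_eq_square)
    qed
    then show ?thesis using d by (intro exI[of _ "\<alpha> ^ p"] exI[of _ "\<beta> ^ p"] exI[of _ "p\<^sup>2"]) simp
  qed
  then obtain \<alpha> \<beta> q where \<alpha>: "\<alpha> \<noteq> 0" "q = p \<or> q = p\<^sup>2" "\<And>x. poly d (x ^ p) = \<alpha> * x ^ q + \<beta>" by blast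
  show ?thesis
  proof (rule that[OF \<alpha>(1,2)])
    show "\<alpha> * e1 ^ q + \<beta> = e1" "\<alpha> * e2 ^ q + \<beta> = e2" "\<alpha> * e3 ^ q + \<beta> = e3"
      using d_e \<alpha>(3) by simp_all
    show "\<forall>x. \<exists>a b c. c \<noteq> 0 \<and> b \<noteq> 0 \<and> degree a \<le> n + 1 \<and> degree b \<le> n - 1 \<and>
       [:-x, 1:] ^ p dvd a - b * f ^ (n + 1) \<and>
       a\<^sup>2 - [:poly f x ^ p:] * f * b\<^sup>2 = [:c:] * [:-x, 1:] ^ p * [:- (\<alpha> * x ^ q + \<beta>), 1:]"
    proof
      fix x
      show "\<exists>a b c. c \<noteq> 0 \<and> b \<noteq> 0 \<and> degree a \<le> n + 1 \<and> degree b \<le> n - 1 \<and>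
         [:-x, 1:] ^ p dvd a - b * f ^ (n + 1) \<and>
         a\<^sup>2 - [:poly f x ^ p:] * f * b\<^sup>2 = [:c:] * [:-x, 1:] ^ p * [:- (\<alpha> * x ^ q + \<beta>), 1:]"
        by (rule exI[of _ "poly A [:x ^ p:]"], rule exI[of _ "poly B [:x ^ p:]"], rule exI[of _ c])
          (intro conjI c B0 degs cong norm[of x, unfolded \<alpha>(3)])
    qed
  qed
qed

end

section \<open>Frobenius and torsion points\<close>

text \<open>\<open>multiplication_by_p\<close> ties the affine map to the curve: for each x it gives
  a function with a zero of order p over x and one further zero over the image of x.\<close>

locale supersingular_frobenius = supersingular_cubic +
  fixes \<alpha> \<beta> and q :: nat
  assumes \<alpha>_neq_0: "\<alpha> \<noteq> 0" and q_cases: "q = p \<or> q = p\<^sup>2"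
    and fixed_roots: "\<alpha> * e1 ^ q + \<beta> = e1" "\<alpha> * e2 ^ q + \<beta> = e2" "\<alpha> * e3 ^ q + \<beta> = e3"
    and multiplication_by_p: "\<forall>x. \<exists>a b c. c \<noteq> 0 \<and> b \<noteq> 0 \<and> degree a \<le> n + 1 \<and> degree b \<le> n - 1 \<and>
       [:-x, 1:] ^ p dvd a - b * f ^ (n + 1) \<and>
       a\<^sup>2 - [:poly f x ^ p:] * f * b\<^sup>2 = [:c:] * [:-x, 1:] ^ p * [:- (\<alpha> * x ^ q + \<beta>), 1:]"
begin

lemma q_pos: "q > 0" using q_cases p_eq by auto

lemma add_power_q: "(x + y) ^ q = x ^ q + y ^ q" for x y :: 'a
proof -
  have "q = p ^ 1 \<or> q = p ^ 2" using q_cases by simp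
  then obtain i where "q = CHAR('a) ^ i" unfolding CHAR by blast
  then show ?thesis using freshmans_dream'[of q i x y] prime_p CHAR by simp
qed

lemma diff_power_q: "(x - y) ^ q = x ^ q - y ^ q" for x y :: 'a
  using add_power_q[of "x - y" y] by (simp add: algebra_simps)

lemma minus_power_q: "(- x) ^ q = - (x ^ q)" for x :: 'a
  using diff_power_q[of 0 x] q_pos by (simp add: zero_power)

lemma of_nat_power_q: "of_nat m ^ q = (of_nat m :: 'a)"
  using q_pos by (induction m) (simp_all add: add_power_q zero_power)

lemma numeral_power_q: "numeral k ^ q = (numeral k :: 'a)"
  using of_nat_power_q[of "numeral k"] by simp

lemma power_p2_if_power_q: "x ^ q = x \<Longrightarrow> x ^ p\<^sup>2 = x" for x :: 'a
  using q_cases by (auto simp: power2_eq_square power_mult)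

lemma frobenius_diff_root:
  "\<alpha> * x ^ q + \<beta> - e1 = \<alpha> * (x - e1) ^ q" "\<alpha> * x ^ q + \<beta> - e2 = \<alpha> * (x - e2) ^ q"
  "\<alpha> * x ^ q + \<beta> - e3 = \<alpha> * (x - e3) ^ q"
  using fixed_roots by (simp_all add: diff_power_q algebra_simps)

text \<open>The roots of f are fixed by the map, so each difference x - e_i becomes
  \<open>\<alpha>\<close> times its q-th power. Thus f has weight 3 in \<open>\<alpha>\<close>, and
  likewise f' has weight 2 and the trace 3 x - (e1 + e2 + e3) weight 1.\<close>

lemma frobenius_f: "poly f (\<alpha> * x ^ q + \<beta>) = \<alpha> ^ 3 * poly f x ^ q"
  unfolding poly_f frobenius_diff_root by (simp add: power_mult_distrib power3_eq_cube)

lemma poly_pderiv_f: "poly (pderiv f) x = (x - e1) * (x - e2) + (x - e1) * (x - e3) + (x - e2) * (x - e3)"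
  by (simp add: f_def pderiv_mult pderiv_pCons algebra_simps)

lemma frobenius_pderiv_f: "poly (pderiv f) (\<alpha> * x ^ q + \<beta>) = \<alpha>\<^sup>2 * poly (pderiv f) x ^ q"
  unfolding poly_pderiv_f frobenius_diff_root
  by (simp add: power_mult_distrib add_power_q power2_eq_square distrib_left ac_simps)

lemma frobenius_trace:
  "3 * (\<alpha> * x ^ q + \<beta>) - (e1 + e2 + e3) = \<alpha> * (3 * x - (e1 + e2 + e3)) ^ q"
proof -
  have eq: "3 * y - (e1 + e2 + e3) = (y - e1) + (y - e2) + (y - e3)" for y by (simp add: algebra_simps)
  show ?thesis unfolding eq frobenius_diff_root add_power_q by (simp only: distrib_left)
qed

text \<open>Two functions of minimal degree with a zero of order \<open>p\<close> at the same point are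
  proportional, so their remaining zeros agree.\<close>
lemma frobenius_unique:
  assumes \<eta>: "\<eta>\<^sup>2 = poly f x" "\<eta> \<noteq> 0" and c': "c' \<noteq> 0"
    and deg: "degree a' \<le> n + 1" "degree b' \<le> n - 1"
    and cong: "[:-x, 1:] ^ p dvd a' - b' * smult (1 / \<eta> ^ p) (f ^ (n + 1))"
    and norm: "a'\<^sup>2 - f * b'\<^sup>2 = [:c':] * [:-x, 1:] ^ p * [:-m, 1:]"
  shows "\<alpha> * x ^ q + \<beta> = m"
proof (rule ccontr)
  assume neq: "\<alpha> * x ^ q + \<beta> \<noteq> m"
  define M where "M = \<alpha> * x ^ q + \<beta>"
  obtain a b c where ab: "c \<noteq> 0" "b \<noteq> 0" "degree a \<le> n + 1" "degree b \<le> n - 1"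
      "[:-x, 1:] ^ p dvd a - b * f ^ (n + 1)"
      "a\<^sup>2 - [:poly f x ^ p:] * f * b\<^sup>2 = [:c:] * [:-x, 1:] ^ p * [:- M, 1:]"
    using multiplication_by_p M_def by blast
  \<comment> \<open>Since f(x)^p is the square of \<open>\<eta> ^ p\<close>, this factor of the norm
    is absorbed into \<open>b\<close>.\<close>
  define B where "B = smult (\<eta> ^ p) b"
  define S where "S = smult (1 / \<eta> ^ p) (f ^ (n + 1))"
  have B0: "B \<noteq> 0" using ab \<eta> by (simp add: B_def)
  have BS: "B * S = b * f ^ (n + 1)" using \<eta> by (simp add: B_def S_def)
  have eqB: "[:poly f x ^ p:] * f * b\<^sup>2 = f * B\<^sup>2"
    by (simp add: B_def \<eta>(1)[symmetric] power2_eq_square power_mult_distrib smult_conv_const_mult)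
      (simp add: mult_pCons_left)
  have normB: "a\<^sup>2 - f * B\<^sup>2 = [:c:] * [:-x, 1:] ^ p * [:- M, 1:]" using ab(6) by (simp only: eqB)
  \<comment> \<open>The determinant has degree at most 2 n < p but a zero of order p at x.\<close>
  have "a * b' - a' * B = 0"
  proof (rule ccontr)
    assume nz: "a * b' - a' * B \<noteq> 0"
    have "a * b' - a' * B = (a - B * S) * b' - (a' - b' * S) * B" by (simp add: algebra_simps)
    moreover have "[:-x, 1:] ^ p dvd (a - B * S) * b'" using ab(5) BS by simp
    moreover have "[:-x, 1:] ^ p dvd (a' - b' * S) * B" using cong unfolding S_def by simp
    ultimately have "[:-x, 1:] ^ p dvd a * b' - a' * B" by (simp only: dvd_diff)
    then have "p \<le> degree (a * b' - a' * B)"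
      using nz dvd_imp_degree_le[of "[:-x, 1:] ^ p"] by (simp add: degree_linear_power)
    moreover have "degree (a * b' - a' * B) \<le> 2 * n"
    proof (rule degree_diff_le)
      show "degree (a * b') \<le> 2 * n" using degree_mult_le[of a b'] ab deg n_ge_2 by simp
      show "degree (a' * B) \<le> 2 * n"
        using degree_mult_le[of a' B] degree_smult_le[of "\<eta> ^ p" b] ab deg n_ge_2 by (simp add: B_def)
    qed
    ultimately show False using p_eq by simp
  qed
  then have proportional: "a * b' = a' * B" by simp
  let ?u = "[:-x, 1:] ^ p"
  have "?u * (B\<^sup>2 * [:c':] * [:-m, 1:]) = B\<^sup>2 * (a'\<^sup>2 - f * b'\<^sup>2)" unfolding norm by (simp only: ac_simps)
  also have "\<dots> = (a' * B)\<^sup>2 - f * b'\<^sup>2 * B\<^sup>2" by (simp add: algebra_simps power_mult_distrib)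
  also have "\<dots> = b'\<^sup>2 * (a\<^sup>2 - f * B\<^sup>2)" unfolding proportional[symmetric] by (simp add: algebra_simps power_mult_distrib)
  also have "\<dots> = ?u * (b'\<^sup>2 * [:c:] * [:-M, 1:])" unfolding normB by (simp only: ac_simps)
  finally have eq: "B\<^sup>2 * [:c':] * [:-m, 1:] = b'\<^sup>2 * [:c:] * [:-M, 1:]" by simp
  have "B\<^sup>2 * [:c':] * [:-m, 1:] \<noteq> 0" using B0 c' by simp
  then have b'0: "b' \<noteq> 0" using eq by auto
  \<comment> \<open>If the remaining zeros were different, the order at m would be odd on one side
    and even on the other.\<close>
  have "order m (B\<^sup>2 * [:c':] * [:-m, 1:]) = 2 * order m B + 1"
    using B0 c' order_power_n_n[of m 1] by (simp add: order_mult power2_eq_square order_0I)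
  moreover have "order m (b'\<^sup>2 * [:c:] * [:-M, 1:]) = 2 * order m b'"
    using b'0 ab(1) neq[folded M_def] by (simp add: order_mult power2_eq_square order_0I)
  ultimately have "2 * order m B + 1 = 2 * order m b'" using eq by metis
  then show False by presburger
qed

end

lemma (in supersingular_cubic) ex_supersingular_frobenius:
  obtains \<alpha> \<beta> q where "supersingular_frobenius e1 e2 e3 n p \<alpha> \<beta> q"
  by (rule ex_frobenius_affine)
    (rule that, intro_locales, unfold supersingular_frobenius_axioms_def, intro conjI)

text \<open>The curve \<open>Y\<^sup>2 + w Y = g\<close> through the point \<open>Q = (0,0)\<close>; completing the square gives
  \<open>y\<^sup>2 = f\<close> with \<open>Y = y - w/2\<close>.\<close>
locale marked_supersingular = supersingular_frobenius +
  fixes g w :: "'a poly"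
  assumes f_eq: "f = g + smult (1 / 4) (w\<^sup>2)" and g_0: "poly g 0 = 0" and w_0: "poly w 0 \<noteq> 0"
    and degree_w: "degree w \<le> 1"
begin

text \<open>The ordinate y = Y + w/2 of Q, where Y = 0.\<close>

definition \<eta> where "\<eta> = poly w 0 / 2"

text \<open>A polynomial that agrees with y to order p at Q: f^(n+1) = y^p y, and y^p is congruent
  to \<open>\<eta> ^ p\<close> modulo X^p.\<close>

definition S where "S = smult (1 / \<eta> ^ p) (f ^ (n + 1))"

lemma \<eta>: "\<eta>\<^sup>2 = poly f 0" "\<eta> \<noteq> 0"
  using w_0 two_neq_0 by (simp_all add: \<eta>_def f_eq g_0 power2_eq_square)

lemma poly_S_0: "poly S 0 = \<eta>"
proof -
  have "poly f 0 ^ (n + 1) = \<eta> ^ p * \<eta>"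
    by (simp add: \<eta>(1)[symmetric] p_eq power_mult[symmetric] power_add[symmetric])
  then show ?thesis using \<eta> by (simp add: S_def del: power_Suc)
qed

lemma S_square_cong: "[:0, 1:] ^ p dvd S\<^sup>2 - f"
proof -
  have "S\<^sup>2 - f = smult (1 / (poly f 0) ^ p) (f * (f ^ p - [:poly f 0 ^ p:]))"
  proof -
    have "S\<^sup>2 = smult (1 / (poly f 0) ^ p) ((f ^ (n + 1))\<^sup>2)"
      by (simp add: S_def power2_eq_square \<eta>(1)[symmetric] power_mult_distrib)
    moreover have "smult (1 / (poly f 0) ^ p) (f * [:poly f 0 ^ p:]) = f"
      using \<eta> by (simp add: mult_pCons_right \<eta>(1)[symmetric])
    ultimately show ?thesis unfolding f_power_even right_diff_distrib smult_diff_right by simp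
  qed
  then show ?thesis using f_power_CHAR_cong[of 0] by (simp add: dvd_smult)
qed

text \<open>\<open>a - b y\<close> has a pole of order at most \<open>l\<close> at infinity, a zero of order at least \<open>k\<close> at \<open>Q\<close>,
  and its remaining zeros lie above the zeros of \<open>v\<close>.\<close>
definition miller :: "nat \<Rightarrow> nat \<Rightarrow> 'a poly \<Rightarrow> 'a poly \<Rightarrow> 'a poly \<Rightarrow> bool" where
  "miller k l v a b \<longleftrightarrow> [:0, 1:] ^ k dvd a - b * S \<and> 2 * degree a \<le> l \<and> (b = 0 \<or> 2 * degree b + 3 \<le> l) \<and>
     a\<^sup>2 - f * b\<^sup>2 = [:0, 1:] ^ k * v"

text \<open>Multiplication of functions on the curve. The square of \<open>S\<close> is f only
  modulo X^p, whence the bound on k + k'. Pole orders at infinity are 2 for x and 3 for y.\<close>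

lemma miller_mult:
  assumes h: "miller k l v a b" and h': "miller k' l' v' a' b'" and le: "k + k' \<le> p"
  shows "miller (k + k') (l + l') (v * v') (a * a' + f * (b * b')) (a * b' + a' * b)"
  unfolding miller_def
proof (intro conjI)
  have "[:0, 1:] ^ (k + k') dvd (a - b * S) * (a' - b' * S)"
    unfolding power_add using h h' by (auto simp: miller_def intro: mult_dvd_mono)
  moreover have "[:0, 1:] ^ (k + k') dvd b * b' * (S\<^sup>2 - f)"
    using S_square_cong le power_le_dvd by (blast intro: dvd_mult)
  moreover have "a * a' + f * (b * b') - (a * b' + a' * b) * S
      = (a - b * S) * (a' - b' * S) - b * b' * (S\<^sup>2 - f)"
    by (simp add: algebra_simps power2_eq_square)
  ultimately show "[:0, 1:] ^ (k + k') dvd a * a' + f * (b * b') - (a * b' + a' * b) * S"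
    by (simp only: dvd_diff)
  have 1: "2 * degree (a * a') \<le> l + l'"
    using degree_mult_le[of a a'] h h' by (auto simp: miller_def)
  have 2: "2 * degree (f * (b * b')) \<le> l + l'"
  proof (cases "b = 0 \<or> b' = 0")
    case False
    then show ?thesis
      using degree_mult_le[of f "b * b'"] degree_mult_le[of b b'] h h' by (auto simp: miller_def degree_f)
  qed auto
  show "2 * degree (a * a' + f * (b * b')) \<le> l + l'"
    using degree_add_le_max[of "a * a'" "f * (b * b')"] 1 2 by linarith
  have 3: "x * y = 0 \<or> 2 * degree (x * y) + 3 \<le> i + j" if "2 * degree x \<le> i" "y = 0 \<or> 2 * degree y + 3 \<le> j"
    for x y :: "'a poly" and i j
    using that degree_mult_le[of x y] by auto
  have "a * b' = 0 \<or> 2 * degree (a * b') + 3 \<le> l + l'" by (rule 3) (use h h' in \<open>auto simp: miller_def\<close>)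
  moreover have "a' * b = 0 \<or> 2 * degree (a' * b) + 3 \<le> l' + l" by (rule 3) (use h h' in \<open>auto simp: miller_def\<close>)
  ultimately show "a * b' + a' * b = 0 \<or> 2 * degree (a * b' + a' * b) + 3 \<le> l + l'"
    using degree_add_le_max[of "a * b'" "a' * b"] by (smt (verit) add.commute add_cancel_left_left add_0_right add_mono le_max_iff_disj mult_le_mono2 order_trans order_refl max_def)
  have "(a * a' + f * (b * b'))\<^sup>2 - f * (a * b' + a' * b)\<^sup>2 = (a\<^sup>2 - f * b\<^sup>2) * (a'\<^sup>2 - f * b'\<^sup>2)"
    by (simp add: algebra_simps power2_eq_square)
  then show "(a * a' + f * (b * b'))\<^sup>2 - f * (a * b' + a' * b)\<^sup>2 = [:0, 1:] ^ (k + k') * (v * v')"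
    using h h' by (simp add: miller_def power_add ac_simps)
qed

lemma miller_one: "miller 0 0 1 1 0" by (simp add: miller_def)

lemma miller_X: "miller 1 2 [:0, 1:] [:0, 1:] 0" by (simp add: miller_def power2_eq_square)

lemma miller_power:
  assumes "miller N N [:c:] a b" "N * r \<le> p"
  shows "\<exists>a' b'. miller (N * r) (N * r) [:c ^ r:] a' b'"
  using assms(2)
proof (induction r)
  case 0
  then show ?case using miller_one by (auto simp: one_pCons)
next
  case (Suc r)
  then obtain a' b' where "miller (N * r) (N * r) [:c ^ r:] a' b'" by auto
  from miller_mult[OF assms(1) this] Suc.prems
  have "miller (N * Suc r) (N * Suc r) [:c ^ Suc r:] (a * a' + f * (b * b')) (a * b' + a' * b)"
    by (simp add: mult_pCons_left)
  then show ?case by blast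
qed

text \<open>In the original coordinates the function is A + B Y, with conjugate A - B w - B Y. The
  condition at 0 says that the conjugate does not vanish at Q, so the whole factor X^k of the norm
  belongs to the function itself.\<close>

lemma miller_function:
  assumes norm: "A\<^sup>2 - A * B * w - B\<^sup>2 * g = [:0, 1:] ^ k * v" and k: "k \<le> p"
    and nz: "poly A 0 - poly B 0 * poly w 0 \<noteq> 0"
    and degA: "2 * degree A \<le> l" and degB: "2 * degree B + 3 \<le> l"
  shows "miller k l v (A - smult (1 / 2) (B * w)) (- B)"
proof -
  define a where "a = A - smult (1 / 2) (B * w)"
  have quarter: "(1 / 4 :: 'a) = 1 / 2 * (1 / 2)" by simp
  have half: "smult (1 / 2) z + smult (1 / 2) z = z" for z :: "'a poly"
    using two_neq_0 by (simp add: smult_add_left[symmetric])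
  have "a\<^sup>2 - f * (- B)\<^sup>2 = A\<^sup>2 - (smult (1 / 2) (A * B * w) + smult (1 / 2) (A * B * w)) - B\<^sup>2 * g"
    unfolding a_def f_eq power2_eq_square quarter by (simp add: algebra_simps smult_diff_right)
  then have eq: "a\<^sup>2 - f * (- B)\<^sup>2 = [:0, 1:] ^ k * v" using norm unfolding half by simp
  have "a\<^sup>2 - (- B)\<^sup>2 * S\<^sup>2 = [:0, 1:] ^ k * v - B\<^sup>2 * (S\<^sup>2 - f)" using eq by (simp add: algebra_simps)
  moreover have "[:0, 1:] ^ k dvd B\<^sup>2 * (S\<^sup>2 - f)"
    using S_square_cong k power_le_dvd by (blast intro: dvd_mult)
  ultimately have "[:0, 1:] ^ k dvd a\<^sup>2 - (- B)\<^sup>2 * S\<^sup>2" by (simp only: dvd_diff dvd_triv_left)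
  moreover have "a\<^sup>2 - (- B)\<^sup>2 * S\<^sup>2 = (a - (- B) * S) * (a + (- B) * S)"
    by (simp add: algebra_simps power2_eq_square)
  ultimately have "[:0, 1:] ^ k dvd (a - (- B) * S) * (a + (- B) * S)" by simp
  moreover define h1 where "h1 = a - (- B) * S"
  moreover define h2 where "h2 = a + (- B) * S"
  ultimately have dvd: "[:0, 1:] ^ k dvd h1 * h2" by simp
  have "poly (a + (- B) * S) 0 = poly A 0 - poly B 0 * poly w 0"
    using two_neq_0 by (simp add: a_def poly_S_0 \<eta>_def field_simps)
  then have nz': "poly h2 0 \<noteq> 0" using nz by (simp only: h2_def not_False_eq_True)
  then have nz0: "h2 \<noteq> 0" by (metis poly_0)
  have "[:0, 1:] ^ k dvd h1"
  proof (cases "h1 = 0")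
    case False
    have "k \<le> order 0 (h1 * h2)" using dvd order_divides[of 0 k "h1 * h2"] False nz0 by simp
    also have "\<dots> = order 0 h1" using False nz0 order_0I[OF nz'] by (simp add: order_mult)
    finally show ?thesis using order_divides[of 0 k h1] by simp
  qed simp
  moreover have "2 * degree a \<le> l"
  proof -
    have "degree (smult (1 / 2) (B * w)) \<le> degree B + 1"
      using degree_smult_le[of "1 / 2" "B * w"] degree_mult_le[of B w] degree_w by simp
    moreover have "degree a \<le> max (degree A) (degree (smult (1 / 2) (B * w)))"
      unfolding a_def by (rule degree_diff_le_max)
    ultimately show ?thesis using degA degB by linarith
  qed
  ultimately show ?thesis using eq degB by (simp add: miller_def a_def h1_def)
qed

text \<open>For Q of order N, the r-th power of a function with divisor N Q - N O, times a function
  with divisor s Q + (- s Q) - (s + 1) O, has the zero of order p demanded by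
  \<open>frobenius_unique\<close>. The former function is available only for N \<le> p, since
  \<open>S\<close> is y only to order p; for smaller p one has r = 0.\<close>

lemma frobenius_0_eqI:
  assumes p: "p = N * r + s" and c: "c \<noteq> 0" and c': "c' \<noteq> 0"
    and l: "N \<le> p \<Longrightarrow> miller N N [:c:] a b" and h: "miller s (s + 1) ([:c':] * [:-m, 1:]) a' b'"
  shows "\<beta> = m"
proof -
  have "\<exists>a b. miller (N * r) (N * r) [:c ^ r:] a b"
  proof (cases r)
    case 0
    then show ?thesis using miller_one by (auto simp: one_pCons)
  next
    case (Suc r')
    then show ?thesis using p by (intro miller_power[OF l]) auto
  qed
  then obtain a1 b1 where "miller (N * r) (N * r) [:c ^ r:] a1 b1" by blast
  from miller_mult[OF this h] p have "\<exists>a b. miller p (p + 1) ([:c ^ r:] * ([:c':] * [:-m, 1:])) a b"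
    by (auto simp: add.assoc)
  then obtain a b where ab: "miller p (p + 1) ([:c ^ r:] * ([:c':] * [:-m, 1:])) a b" by blast
  have "\<alpha> * 0 ^ q + \<beta> = m"
  proof (rule frobenius_unique[OF \<eta>])
    show "c ^ r * c' \<noteq> 0" using c c' by simp
    have deg: "2 * degree a \<le> p + 1" "b = 0 \<or> 2 * degree b + 3 \<le> p + 1"
      using ab by (auto simp: miller_def)
    show "degree a \<le> n + 1" using deg(1) p_eq by linarith
    show "degree b \<le> n - 1" using deg(2) p_eq by auto
    show "[:- 0, 1:] ^ p dvd a - b * smult (1 / \<eta> ^ p) (f ^ (n + 1))"
      using ab by (simp add: miller_def S_def)
    have "[:c ^ r:] * ([:c':] * [:-m, 1:]) = [:c ^ r * c':] * [:-m, 1:]"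
      by (simp add: mult_pCons_left)
    then show "a\<^sup>2 - f * b\<^sup>2 = [:c ^ r * c':] * [:- 0, 1:] ^ p * [:- m, 1:]"
      using ab by (simp only: miller_def minus_zero ac_simps) 
  qed
  then show ?thesis using q_pos by (simp add: zero_power)
qed

end

section \<open>The Hasse invariant\<close>

lemma map_poly_ring_hom_mult:
  fixes h :: "'a::comm_ring_1 \<Rightarrow> 'b::comm_ring_1"
  assumes "h 0 = 0" "\<And>x y. h (x + y) = h x + h y" "\<And>x y. h (x * y) = h x * h y"
  shows "map_poly h (P * Q) = map_poly h P * map_poly h Q"
proof (rule poly_eqI)
  fix i
  have hsum: "h (\<Sum>j\<in>A. k j) = (\<Sum>j\<in>A. h (k j))" if "finite A" for k and A :: "nat set"
    using that by (induction A rule: finite_induct) (simp_all add: assms)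
  show "coeff (map_poly h (P * Q)) i = coeff (map_poly h P * map_poly h Q) i"
    by (simp add: coeff_map_poly assms coeff_mult hsum)
qed

lemma map_poly_ring_hom_add:
  fixes h :: "'a::comm_ring_1 \<Rightarrow> 'b::comm_ring_1"
  assumes "h 0 = 0" "\<And>x y. h (x + y) = h x + h y"
  shows "map_poly h (P + Q) = map_poly h P + map_poly h Q"
  by (rule poly_eqI) (simp add: coeff_map_poly assms)

text \<open>The substitution \<open>z = 1\<close>, followed by exchanging the order of the variables \<open>x\<close> and \<open>y\<close>.\<close>
definition dehom :: "'a::comm_ring_1 poly poly poly \<Rightarrow> 'a poly poly" where
  "dehom F = poly (map_poly (map_poly (\<lambda>c. [:poly c 1:])) F) [:[:0, 1:]:]"

lemma dehom_add: "dehom (F + G) = dehom F + dehom G"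
  and dehom_mult: "dehom (F * G) = dehom F * dehom G"
  for F :: "'a::comm_ring_1 poly poly poly"
proof -
  let ?h = "\<lambda>c. [:poly c 1:] :: 'a poly"
  have h: "map_poly ?h (P + Q) = map_poly ?h P + map_poly ?h Q"
    "map_poly ?h (P * Q) = map_poly ?h P * map_poly ?h Q" for P Q
    by (intro map_poly_ring_hom_add map_poly_ring_hom_mult; simp add: mult_pCons_left)+
  show "dehom (F + G) = dehom F + dehom G" "dehom (F * G) = dehom F * dehom G"
    unfolding dehom_def
    by (subst map_poly_ring_hom_add map_poly_ring_hom_mult; simp add: h)+
qed

lemma dehom_basic:
  "dehom 0 = 0" "dehom 1 = 1" "dehom [:[:[:a:]:]:] = [:[:a:]:]" "dehom (monom 1 1) = [:[:0, 1:]:]"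
  "dehom [:monom 1 1:] = [:0, 1:]" "dehom [:[:monom 1 1:]:] = 1"
  for a :: "'a::comm_ring_1"
  by (simp_all add: dehom_def map_poly_pCons map_poly_monom poly_monom one_pCons monom_Suc monom_0 mult_pCons_left)

lemma dehom_power: "dehom (F ^ m) = dehom F ^ m" for F :: "'a::comm_ring_1 poly poly poly"
  by (induction m) (simp_all add: dehom_basic dehom_mult)

lemma dehom_diff: "dehom (F - G) = dehom F - dehom G" for F :: "'a::comm_ring_1 poly poly poly"
  using dehom_add[of "F - G" G] by simp

lemma coeff_dehom: "coeff (coeff (dehom F) j) i = poly (coeff (coeff F i) j) 1"
  for F :: "'a::comm_ring_1 poly poly poly"
proof (induction F arbitrary: i)
  case (pCons u F)
  have "dehom (pCons u F) = map_poly (\<lambda>c. [:poly c 1:]) u + [:[:0, 1:]:] * dehom F"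
    by (simp add: dehom_def map_poly_pCons)
  then have "coeff (dehom (pCons u F)) j = [:poly (coeff u j) 1:] + [:0, 1:] * coeff (dehom F) j"
    by (simp add: coeff_map_poly mult_pCons_left)
  then show ?case using pCons by (cases i) (simp_all add: mult_pCons_left)
qed (simp add: dehom_basic)

definition homogeneous :: "nat \<Rightarrow> 'a::zero poly poly poly \<Rightarrow> bool" where
  "homogeneous m F \<longleftrightarrow> (\<forall>i j k. coeff (coeff (coeff F i) j) k \<noteq> 0 \<longrightarrow> i + j + k = m)"

lemma homogeneous_add: "homogeneous m F \<Longrightarrow> homogeneous m G \<Longrightarrow> homogeneous m (F + G)"
  for F :: "'a::comm_monoid_add poly poly poly"
  unfolding homogeneous_def by (metis add_0 coeff_add)

lemma homogeneous_diff: "homogeneous m F \<Longrightarrow> homogeneous m G \<Longrightarrow> homogeneous m (F - G)"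
  for F :: "'a::ab_group_add poly poly poly"
  unfolding homogeneous_def by (metis diff_0_right coeff_diff)

lemma homogeneous_mult:
  fixes F :: "'a::comm_semiring_0 poly poly poly"
  assumes "homogeneous m F" "homogeneous k G"
  shows "homogeneous (m + k) (F * G)"
  unfolding homogeneous_def
proof (intro allI impI)
  fix i j l
  assume "coeff (coeff (coeff (F * G) i) j) l \<noteq> 0"
  then have "(\<Sum>a\<le>i. \<Sum>b\<le>j. \<Sum>c\<le>l. coeff (coeff (coeff F a) b) c
      * coeff (coeff (coeff G (i - a)) (j - b)) (l - c)) \<noteq> 0"
    by (simp add: coeff_mult coeff_sum)
  then obtain a where a: "a \<le> i" "(\<Sum>b\<le>j. \<Sum>c\<le>l. coeff (coeff (coeff F a) b) c
      * coeff (coeff (coeff G (i - a)) (j - b)) (l - c)) \<noteq> 0"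
    by (meson atMost_iff sum.not_neutral_contains_not_neutral)
  then obtain b where b: "b \<le> j" "(\<Sum>c\<le>l. coeff (coeff (coeff F a) b) c
      * coeff (coeff (coeff G (i - a)) (j - b)) (l - c)) \<noteq> 0"
    by (meson atMost_iff sum.not_neutral_contains_not_neutral)
  then obtain c where c: "c \<le> l" "coeff (coeff (coeff F a) b) c
      * coeff (coeff (coeff G (i - a)) (j - b)) (l - c) \<noteq> 0"
    by (meson atMost_iff sum.not_neutral_contains_not_neutral)
  have "coeff (coeff (coeff F a) b) c \<noteq> 0" "coeff (coeff (coeff G (i - a)) (j - b)) (l - c) \<noteq> 0"
    using c(2) by auto
  then have "a + b + c = m" "(i - a) + (j - b) + (l - c) = k"
    using assms unfolding homogeneous_def by blast+
  then show "i + j + l = m + k" using a b c by linarith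
qed

lemma homogeneous_basic:
  "homogeneous 0 (1 :: 'a::comm_semiring_1 poly poly poly)" "homogeneous 0 [:[:[:a:]:]:]"
  "homogeneous 1 (monom 1 1 :: 'a::comm_semiring_1 poly poly poly)"
  "homogeneous 1 ([:monom 1 1:] :: 'a::comm_semiring_1 poly poly poly)"
  "homogeneous 1 ([:[:monom 1 1:]:] :: 'a::comm_semiring_1 poly poly poly)"
  by (auto simp: homogeneous_def one_pCons monom_Suc monom_0 coeff_pCons split: nat.splits if_splits)

lemma homogeneous_power: "homogeneous m F \<Longrightarrow> homogeneous (m * k) (F ^ k)"
  for F :: "'a::comm_semiring_1 poly poly poly"
  by (induction k) (auto simp: homogeneous_basic intro: homogeneous_mult)

lemma homogeneous_weier_cubic: "homogeneous 3 (weier_cubic a1 a2 a3 a4 (a6 :: 'a::comm_ring_1))"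
proof -
  define x y z where "x = (monom 1 1 :: 'a poly poly poly)" and "y = ([:monom 1 1:] :: 'a poly poly poly)"
    and "z = ([:[:monom 1 1:]:] :: 'a poly poly poly)"
  define c where "c = (\<lambda>a :: 'a. [:[:[:a:]:]:])"
  have x: "homogeneous 1 x" and y: "homogeneous 1 y" and z: "homogeneous 1 z" and c: "homogeneous 0 (c a)" for a
    unfolding x_def y_def z_def c_def by (rule homogeneous_basic)+
  note mult = homogeneous_mult
  have "homogeneous 3 (y * y * z)" "homogeneous 3 (c a1 * x * y * z)" "homogeneous 3 (c a3 * y * (z * z))"
      "homogeneous 3 (x * x * x)" "homogeneous 3 (c a2 * (x * x) * z)" "homogeneous 3 (c a4 * x * (z * z))"
      "homogeneous 3 (c a6 * (z * z * z))"
    using mult[OF mult[OF y y] z] mult[OF mult[OF mult[OF c x] y] z] mult[OF mult[OF c y] mult[OF z z]]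
      mult[OF mult[OF x x] x] mult[OF mult[OF c mult[OF x x]] z] mult[OF mult[OF c x] mult[OF z z]]
      mult[OF c mult[OF mult[OF z z] z]]
    by (simp_all add: numeral_3_eq_3)
  then show ?thesis
    unfolding weier_cubic_def Let_def power2_eq_square power3_eq_cube
      x_def[symmetric] y_def[symmetric] z_def[symmetric] c_def[symmetric]
    unfolding c_def by (intro homogeneous_add homogeneous_diff)
qed

lemma coeff_eq_poly_1_if_unique:
  fixes c :: "'a::comm_semiring_1 poly"
  assumes "\<And>i. coeff c i \<noteq> 0 \<Longrightarrow> i = m"
  shows "poly c 1 = coeff c m"
proof -
  have "c = monom (coeff c m) m" by (rule poly_eqI) (use assms in \<open>auto simp: coeff_monom\<close>)
  then have "poly c 1 = poly (monom (coeff c m) m) 1" by simp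
  then show ?thesis by (simp add: poly_monom)
qed

text \<open>The power of the cubic is homogeneous of degree 3 (p - 1), so the exponents of x and y
  determine that of z, and setting z = 1 loses nothing.\<close>

lemma hasse_invariant_dehom:
  "hasse_invariant p a1 a2 a3 a4 a6
    = coeff (coeff ([:- [:a6, a4, a2, 1:], [:a3, a1:], 1:] ^ (p - 1)) (p - 1)) (p - 1)"
proof -
  let ?F = "weier_cubic a1 a2 a3 a4 a6"
  have hom: "homogeneous (3 * (p - 1)) (?F ^ (p - 1))"
    by (rule homogeneous_power[OF homogeneous_weier_cubic])
  have "hasse_invariant p a1 a2 a3 a4 a6 = poly (coeff (coeff (?F ^ (p - 1)) (p - 1)) (p - 1)) 1"
    unfolding hasse_invariant_def
    by (rule coeff_eq_poly_1_if_unique[symmetric]) (use hom in \<open>force simp: homogeneous_def\<close>)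
  also have "\<dots> = coeff (coeff (dehom ?F ^ (p - 1)) (p - 1)) (p - 1)"
    by (simp add: coeff_dehom[symmetric] dehom_power)
  also have "dehom ?F = [:- [:a6, a4, a2, 1:], [:a3, a1:], 1:]"
    unfolding weier_cubic_def Let_def dehom_add dehom_diff dehom_mult dehom_power dehom_basic
    by (simp add: power2_eq_square power3_eq_cube mult_pCons_left mult_pCons_right one_pCons)
  finally show ?thesis .
qed

lemma CHAR_dvd_choose:
  assumes "prime p" "p \<le> m" "m \<le> 2 * p - 2"
  shows "p dvd (m choose (p - 1))"
proof -
  have "fact (p - 1) * fact (m - (p - 1)) * (m choose (p - 1)) = (fact m :: nat)"
    using assms by (intro binomial_fact_lemma) simp
  moreover have "p dvd fact m" using assms by (simp add: prime_dvd_fact_iff)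
  ultimately have "p dvd fact (p - 1) * fact (m - (p - 1)) * (m choose (p - 1))" by simp
  moreover have "\<not> p dvd fact (p - 1)" "\<not> p dvd fact (m - (p - 1))"
    using assms prime_gt_1_nat[of p] by (simp_all add: prime_dvd_fact_iff) 
  ultimately show ?thesis using assms(1) by (simp add: prime_dvd_mult_iff)
qed

text \<open>A power X^m with p \<le> m \<le> 2 p - 2 contributes a binomial coefficient divisible by
  p. Hence the coefficient behind the Hasse invariant survives both completing the square in y and
  translating x.\<close>

lemma coeff_pcompose_shift:
  fixes Q :: "'b::idom poly"
  assumes p: "prime CHAR('b)" and deg: "degree Q \<le> 2 * CHAR('b) - 2"
  shows "coeff (pcompose Q [:s, 1:]) (CHAR('b) - 1) = coeff Q (CHAR('b) - 1)"
proof -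
  let ?p = "CHAR('b)"
  have "pcompose Q [:s, 1:] = (\<Sum>m\<le>degree Q. smult (coeff Q m) ([:s, 1:] ^ m))"
    by (simp add: pcompose_altdef poly_altdef coeff_map_poly degree_map_poly mult_pCons_left)
  then have "coeff (pcompose Q [:s, 1:]) (?p - 1)
      = (\<Sum>m\<le>degree Q. coeff Q m * coeff ([:s, 1:] ^ m) (?p - 1))"
    by (simp add: coeff_sum)
  also have "\<dots> = (\<Sum>m\<le>degree Q. if m = ?p - 1 then coeff Q m else 0)"
  proof (rule sum.cong[OF refl])
    fix m assume m: "m \<in> {..degree Q}"
    consider "m < ?p - 1" | "m = ?p - 1" | "?p \<le> m" by linarith
    then show "coeff Q m * coeff ([:s, 1:] ^ m) (?p - 1) = (if m = ?p - 1 then coeff Q m else 0)"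
    proof cases
      case 1
      then show ?thesis by (simp add: coeff_eq_0 degree_linear_power)
    next
      case 2
      have "coeff ([:s, 1:] ^ m) m = 1" using lead_coeff_power[of "[:s, 1:]" m] by (simp add: degree_linear_power)
      then show ?thesis using 2 by simp
    next
      case 3
      then have "?p dvd (m choose (?p - 1))" using p m deg by (intro CHAR_dvd_choose) auto
      then have "of_nat (m choose (?p - 1)) = (0 :: 'b)" by (simp only: of_nat_eq_0_iff_char_dvd)
      moreover have "?p > 0" using p prime_gt_0_nat by blast
      ultimately show ?thesis using 3 by (simp add: coeff_linear_poly_power)
    qed
  qed
  also have "\<dots> = coeff Q (?p - 1)" by (auto simp: coeff_eq_0)
  finally show ?thesis .
qed

lemma pcompose_power: "pcompose (P ^ m) Q = pcompose P Q ^ m" for P :: "'a::comm_semiring_1 poly"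
  by (induction m) (simp_all add: pcompose_mult pcompose_1)

text \<open>The cubic f of y^2 = f after completing the square, that is, the 2-division polynomial
  divided by 4.\<close>

definition weier_2div :: "'a::field \<Rightarrow> 'a \<Rightarrow> 'a \<Rightarrow> 'a \<Rightarrow> 'a \<Rightarrow> 'a poly" where
  "weier_2div a1 a2 a3 a4 a6 = [:weier_b6 a1 a2 a3 a4 a6 / 4, weier_b4 a1 a2 a3 a4 a6 / 2,
     weier_b2 a1 a2 a3 a4 a6 / 4, 1:]"

text \<open>Completing the square turns the power into (y^2 - f)^(2 n), whose coefficient at y^(2 n)
  is (-f)^n times the middle binomial coefficient, which is prime to p.\<close>

lemma coeff_weier_2div_power_eq_0:
  fixes a1 a2 a3 a4 a6 :: "'a::field"
  assumes p: "prime CHAR('a)" "CHAR('a) = 2 * n + 1" "n > 0"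
    and hasse: "hasse_invariant CHAR('a) a1 a2 a3 a4 a6 = 0"
  shows "coeff (weier_2div a1 a2 a3 a4 a6 ^ n) (2 * n) = 0"
proof -
  let ?p = "CHAR('a)"
  have two: "(2 :: 'a) \<noteq> 0" using two_neq_0_if_CHAR[where 'a = 'a] p by simp
  have "(4 :: 'a) = 2 * 2" by simp
  then have four: "(4 :: 'a) \<noteq> 0" using two by (metis mult_eq_0_iff)
  have "(8 :: 'a) = 2 * 4" "(16 :: 'a) = 4 * 4" by simp_all
  then have nz: "(8 :: 'a) \<noteq> 0" "(16 :: 'a) \<noteq> 0" using two four by (metis mult_eq_0_iff)+
  define d where "d = weier_2div a1 a2 a3 a4 a6"
  define s where "s = [:a3 / 2, a1 / 2:]"
  have d_eq: "d - s * s = [:a6, a4, a2, 1:]"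
    using two four nz
    by (simp add: d_def s_def weier_2div_def weier_b2_def weier_b4_def weier_b6_def mult_pCons_left
        mult_pCons_right power2_eq_square field_simps)
  have s_eq: "s + s = [:a3, a1:]" using two by (simp add: s_def)
  have P_eq: "[:- [:a6, a4, a2, 1:], [:a3, a1:], 1:] = pcompose [:- d, 0, 1:] [:s, 1:]"
    unfolding d_eq[symmetric] s_eq[symmetric]
    by (simp add: pcompose_pCons mult_pCons_left mult_pCons_right algebra_simps)
  have "hasse_invariant ?p a1 a2 a3 a4 a6
      = coeff (coeff (pcompose ([:- d, 0, 1:] ^ (?p - 1)) [:s, 1:]) (?p - 1)) (?p - 1)"
    unfolding hasse_invariant_dehom P_eq by (simp add: pcompose_power)
  also have "coeff (pcompose ([:- d, 0, 1:] ^ (?p - 1)) [:s, 1:]) (?p - 1) = coeff ([:- d, 0, 1:] ^ (?p - 1)) (?p - 1)"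
    using coeff_pcompose_shift[of "[:- d, 0, 1:] ^ (?p - 1)" s] p degree_power_le[of "[:- d, 0, 1:]" "?p - 1"]
    by simp
  also have "\<dots> = of_nat (2 * n choose n) * (- d) ^ n"
  proof -
    have "[:- d, 0, 1:] = monom 1 2 + [:- d:]" by (simp add: monom_altdef power2_eq_square mult_pCons_left)
    then have "[:- d, 0, 1:] ^ (2 * n)
        = (\<Sum>k\<le>2 * n. of_nat (2 * n choose k) * monom 1 2 ^ k * [:- d:] ^ (2 * n - k))"
      by (simp only: binomial_ring)
    also have "\<dots> = (\<Sum>k\<le>2 * n. monom (of_nat (2 * n choose k) * (- d) ^ (2 * n - k)) (2 * k))"
      by (intro sum.cong refl) (simp add: monom_power poly_const_pow of_nat_poly mult_monom monom_0[symmetric] del: monom_0)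
    finally have "coeff ([:- d, 0, 1:] ^ (2 * n)) (2 * n)
        = (\<Sum>k\<le>2 * n. if k = n then of_nat (2 * n choose k) * (- d) ^ (2 * n - k) else 0)"
      by (simp add: coeff_sum)
    also have "\<dots> = of_nat (2 * n choose n) * (- d) ^ n" by simp
    finally show ?thesis using p by simp
  qed
  also have "coeff (of_nat (2 * n choose n) * (- d) ^ n) (?p - 1)
      = of_nat (2 * n choose n) * ((-1) ^ n * coeff (d ^ n) (2 * n))"
  proof -
    have "(- d) ^ n = smult ((-1) ^ n) (d ^ n)" by (metis smult_power smult_minus_left smult_1_left)
    then show ?thesis using p by (simp add: of_nat_poly mult_pCons_left)
  qed
  finally have "of_nat (2 * n choose n) * ((-1) ^ n * coeff (d ^ n) (2 * n)) = 0" using hasse by simp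
  moreover have "of_nat (2 * n choose n) \<noteq> (0 :: 'a)"
  proof
    assume "of_nat (2 * n choose n) = (0 :: 'a)"
    then have "?p dvd (2 * n choose n)" by (simp only: of_nat_eq_0_iff_char_dvd)
    moreover have "fact n * fact (2 * n - n) * (2 * n choose n) = (fact (2 * n) :: nat)"
      by (intro binomial_fact_lemma) simp
    ultimately have "?p dvd fact (2 * n)" by (metis dvd_mult)
    then show False using p by (simp add: prime_dvd_fact_iff)
  qed
  ultimately show ?thesis by (simp add: d_def)
qed

lemma numeral_neq_0_if_CHAR:
  assumes "prime CHAR('a::field)" "CHAR('a) \<ge> 5"
  shows "(2 :: 'a) \<noteq> 0" "(3 :: 'a) \<noteq> 0" "(4 :: 'a) \<noteq> 0" "(12 :: 'a) \<noteq> 0" "(48 :: 'a) \<noteq> 0"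
    "(864 :: 'a) \<noteq> 0" "(1728 :: 'a) \<noteq> 0" "(16 :: 'a) \<noteq> 0"
proof -
  have small: "of_nat m \<noteq> (0 :: 'a)" if "m > 0" "m < 5" for m
  proof
    assume "of_nat m = (0 :: 'a)"
    then have "CHAR('a) dvd m" by (simp only: of_nat_eq_0_iff_char_dvd)
    then have "CHAR('a) \<le> m" using that by (intro dvd_imp_le) auto
    then show False using assms that by simp
  qed
  show 2: "(2 :: 'a) \<noteq> 0" and 3: "(3 :: 'a) \<noteq> 0" using small[of 2] small[of 3] by simp_all
  have "(4 :: 'a) = 2 ^ 2" "(12 :: 'a) = 2 ^ 2 * 3" "(48 :: 'a) = 2 ^ 4 * 3" "(864 :: 'a) = 2 ^ 5 * 3 ^ 3"
    "(1728 :: 'a) = 2 ^ 6 * 3 ^ 3" "(16 :: 'a) = 2 ^ 4" by simp_all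
  then show "(4 :: 'a) \<noteq> 0" "(12 :: 'a) \<noteq> 0" "(48 :: 'a) \<noteq> 0" "(864 :: 'a) \<noteq> 0" "(1728 :: 'a) \<noteq> 0"
    "(16 :: 'a) \<noteq> 0" using 2 3 by (metis mult_eq_0_iff power_not_zero)+
qed

section \<open>Weierstrass models with a given j-invariant\<close>

definition weier_c6 :: "'a::comm_ring_1 \<Rightarrow> 'a \<Rightarrow> 'a \<Rightarrow> 'a \<Rightarrow> 'a \<Rightarrow> 'a" where
  "weier_c6 a1 a2 a3 a4 a6 = - ((weier_b2 a1 a2 a3 a4 a6) ^ 3)
     + 36 * weier_b2 a1 a2 a3 a4 a6 * weier_b4 a1 a2 a3 a4 a6 - 216 * weier_b6 a1 a2 a3 a4 a6"

lemma weier_b8_eq: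
  "4 * weier_b8 a1 a2 a3 a4 a6 = weier_b2 a1 a2 a3 a4 a6 * weier_b6 a1 a2 a3 a4 a6 - (weier_b4 a1 a2 a3 a4 a6)\<^sup>2"
  for a1 :: "'a::comm_ring_1"
  by (simp add: weier_b2_def weier_b4_def weier_b6_def weier_b8_def power2_eq_square algebra_simps)

lemma weier_disc_eq:
  "1728 * weier_disc a1 a2 a3 a4 a6 = (weier_c4 a1 a2 a3 a4 a6) ^ 3 - (weier_c6 a1 a2 a3 a4 a6)\<^sup>2"
  for a1 :: "'a::comm_ring_1"
proof -
  have "1728 * (- (b2\<^sup>2 * b8) - 8 * b4 ^ 3 - 27 * b6\<^sup>2 + 9 * b2 * b4 * b6)
      = (b2\<^sup>2 - 24 * b4) ^ 3 - (- (b2 ^ 3) + 36 * b2 * b4 - 216 * b6)\<^sup>2"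
    if "4 * b8 = b2 * b6 - b4\<^sup>2" for b2 b4 b6 b8 :: 'a
  proof -
    have "1728 * (b2\<^sup>2 * b8) = 432 * b2\<^sup>2 * (4 * b8)" by simp
    then have "1728 * (b2\<^sup>2 * b8) = 432 * b2\<^sup>2 * (b2 * b6 - b4\<^sup>2)" unfolding that .
    then show ?thesis by (simp add: algebra_simps power2_eq_square power3_eq_cube)
  qed
  from this[OF weier_b8_eq] show ?thesis unfolding weier_disc_def Let_def weier_c4_def weier_c6_def .
qed

lemma pcompose_weier_2div:
  fixes a1 a2 a3 a4 a6 :: "'a::field"
  assumes "prime CHAR('a)" "CHAR('a) \<ge> 5"
  shows "pcompose (weier_2div a1 a2 a3 a4 a6) [:- weier_b2 a1 a2 a3 a4 a6 / 12, 1:]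
    = [:- weier_c6 a1 a2 a3 a4 a6 / 864, - weier_c4 a1 a2 a3 a4 a6 / 48, 0, 1:]"
proof -
  note nz = numeral_neq_0_if_CHAR[OF assms]
  define k where "k = weier_b2 a1 a2 a3 a4 a6 / 12"
  have b2: "weier_b2 a1 a2 a3 a4 a6 = 12 * k" using nz by (simp add: k_def)
  have h1: "12 * k / 4 = 3 * k"
  proof -
    have "12 * k = 4 * (3 * k)" by simp
    then show ?thesis using nz by (metis nonzero_mult_div_cancel_left)
  qed
  have h2: "- (- ((12 * k) ^ 3) + 36 * (12 * k) * b4 - 216 * b6) / 864 = b6 / 4 - k * (b4 / 2) + 2 * k ^ 3" for b4 b6
  proof -
    have "864 * (b6 / 4) = 216 * b6" "864 * (k * (b4 / 2)) = 432 * (k * b4)"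
      using nz by (simp_all add: field_simps)
    then have "- (- ((12 * k) ^ 3) + 36 * (12 * k) * b4 - 216 * b6) = 864 * (b6 / 4 - k * (b4 / 2) + 2 * k ^ 3)"
      by (simp only: power_mult_distrib distrib_left right_diff_distrib) simp
    then show ?thesis by (simp only: nonzero_mult_div_cancel_left[OF nz(6)])
  qed
  have h3: "- ((12 * k)\<^sup>2 - 24 * b4) / 48 = b4 / 2 - 3 * k\<^sup>2" for b4
  proof -
    have "48 * (b4 / 2) = 24 * b4" using nz by (simp add: field_simps)
    then have "- ((12 * k)\<^sup>2 - 24 * b4) = 48 * (b4 / 2 - 3 * k\<^sup>2)"
      by (simp only: power_mult_distrib right_diff_distrib) simp
    then show ?thesis by (simp only: nonzero_mult_div_cancel_left[OF nz(5)])
  qed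
  have h4: "- (12 * k) / 12 = - k" using nz by simp
  have "pcompose [:A, B, 3 * k, 1:] [:- k, 1:] = [:A - k * B + 2 * k ^ 3, B - 3 * k\<^sup>2, 0, 1:]" for A B
    by (simp add: pcompose_pCons mult_pCons_left mult_pCons_right power2_eq_square power3_eq_cube algebra_simps)
  then show ?thesis unfolding weier_2div_def weier_c6_def weier_c4_def b2 h1 h2 h3 h4 .
qed

lemma degree_weier_2div: "degree (weier_2div a1 a2 a3 a4 a6) = 3"
  by (simp add: weier_2div_def)

text \<open>Supersingularity is asserted of some model with invariant j, whereas the level
  structures need explicit models. Equal invariants give c4' = v^2 c4 and c6' = v^3 c6, with v the
  square of the usual scaling parameter; the short cubics then differ by a scaling of x.\<close>

lemma coeff_weier_2div_power_if_weier_j_eq: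
  fixes a1 a2 a3 a4 a6 :: "'a::alg_closed_field"
  assumes p: "prime CHAR('a)" "CHAR('a) = 2 * n + 1" "n \<ge> 2"
    and disc: "weier_disc a1 a2 a3 a4 a6 \<noteq> 0" "weier_disc a1' a2' a3' a4' a6' \<noteq> 0"
    and j: "weier_j a1' a2' a3' a4' a6' = weier_j a1 a2 a3 a4 a6"
    and zero: "coeff (weier_2div a1 a2 a3 a4 a6 ^ n) (2 * n) = 0"
  shows "coeff (weier_2div a1' a2' a3' a4' a6' ^ n) (2 * n) = 0"
proof -
  have p5: "CHAR('a) \<ge> 5" using p by simp
  note nz = numeral_neq_0_if_CHAR[OF p(1) p5]
  define c4 where "c4 = weier_c4 a1 a2 a3 a4 a6"
  define c6 where "c6 = weier_c6 a1 a2 a3 a4 a6"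
  define c4' where "c4' = weier_c4 a1' a2' a3' a4' a6'"
  define c6' where "c6' = weier_c6 a1' a2' a3' a4' a6'"
  define D where "D = weier_disc a1 a2 a3 a4 a6"
  define D' where "D' = weier_disc a1' a2' a3' a4' a6'"
  have D: "1728 * D = c4 ^ 3 - c6\<^sup>2" "1728 * D' = c4' ^ 3 - c6'\<^sup>2"
    unfolding D_def D'_def c4_def c6_def c4'_def c6'_def by (rule weier_disc_eq)+
  have D0: "D \<noteq> 0" "D' \<noteq> 0" using disc by (simp_all add: D_def D'_def)
  have "c4' ^ 3 * D = c4 ^ 3 * D'"
    using j D0 by (simp add: weier_j_def c4_def c4'_def D_def D'_def field_simps)
  then have "c4' ^ 3 * (1728 * D) = c4 ^ 3 * (1728 * D')" by simp
  then have cross: "c4' ^ 3 * c6\<^sup>2 = c4 ^ 3 * c6'\<^sup>2" unfolding D by (simp add: algebra_simps)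
  have nonzero: "c4 \<noteq> 0 \<or> c6 \<noteq> 0" "c4' \<noteq> 0 \<or> c6' \<noteq> 0" using D D0 nz by auto
  have "\<exists>v. v \<noteq> 0 \<and> c4' = v\<^sup>2 * c4 \<and> c6' = v ^ 3 * c6"
  proof -
    \<comment> \<open>The cases c4 = 0 and c6 = 0 are j = 0 and j = 1728, where \<open>v\<close> is
      a cube root or a square root; otherwise it is a quotient.\<close>
    consider "c4 = 0" | "c4 \<noteq> 0" "c6 = 0" | "c4 \<noteq> 0" "c6 \<noteq> 0" by blast
    then show ?thesis
    proof cases
      case 1
      then have "c6 \<noteq> 0" "c4' = 0" using nonzero cross by auto
      then have "c6' \<noteq> 0" using nonzero by auto
      obtain v where v: "v ^ 3 = c6' / c6" using nth_root_exists[of 3 "c6' / c6"] by auto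
      have "v \<noteq> 0" using v \<open>c6 \<noteq> 0\<close> \<open>c6' \<noteq> 0\<close> by auto
      then show ?thesis using v \<open>c6 \<noteq> 0\<close> \<open>c4' = 0\<close> 1 by (intro exI[of _ v]) simp
    next
      case 2
      then have "c6' = 0" using cross by auto
      then have "c4' \<noteq> 0" using nonzero by auto
      obtain v where v: "v ^ 2 = c4' / c4" using nth_root_exists[of 2 "c4' / c4"] by auto
      have "v \<noteq> 0" using v 2 \<open>c4' \<noteq> 0\<close> by auto
      then show ?thesis using v 2 \<open>c6' = 0\<close> by (intro exI[of _ v]) simp
    next
      case 3
      have c4': "c4' \<noteq> 0" using cross 3 nonzero by (cases "c4' = 0") auto
      have c6': "c6' \<noteq> 0" using cross 3 c4' by auto
      define v where "v = c6' * c4 / (c6 * c4')"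
      have "v\<^sup>2 * c4 * (c6\<^sup>2 * c4'\<^sup>2) = c4 ^ 3 * c6'\<^sup>2"
        using 3 c4' by (simp add: v_def power_divide power_mult_distrib power2_eq_square power3_eq_cube)
      also have "\<dots> = c4' * (c6\<^sup>2 * c4'\<^sup>2)"
        unfolding cross[symmetric] by (simp add: power2_eq_square power3_eq_cube)
      finally have v4: "v\<^sup>2 * c4 = c4'" using 3 c4' by simp
      have "v ^ 3 * c6 = v\<^sup>2 * c4 * (v * c6 / c4)" using 3 by (simp add: power2_eq_square power3_eq_cube)
      also have "\<dots> = c6'" unfolding v4 using 3 c4' by (simp add: v_def)
      finally show ?thesis using v4 3 c4' c6' by (intro exI[of _ v]) (auto simp: v_def)
    qed
  qed
  then obtain v where v: "v \<noteq> 0" "c4' = v\<^sup>2 * c4" "c6' = v ^ 3 * c6" by blast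
  have shift: "coeff (pcompose (h ^ n) [:s, 1:]) (2 * n) = coeff (h ^ n) (2 * n)"
    if "degree h = 3" for h :: "'a poly" and s
    using coeff_pcompose_shift[of "h ^ n" s] p degree_power_le[of h n] that by simp
  define T where "T = [:- c6 / 864, - c4 / 48, 0, 1:]"
  have T: "coeff (T ^ n) (2 * n) = 0"
    using shift[OF degree_weier_2div] zero pcompose_weier_2div[OF p(1) p5]
    unfolding T_def c4_def c6_def by (metis pcompose_power)
  have T': "[:- c6' / 864, - c4' / 48, 0, 1:] = smult (v ^ 3) (pcompose T [:0, 1 / v:])"
    using v(1) unfolding v(2,3) T_def
    by (simp add: pcompose_pCons mult_pCons_left mult_pCons_right power2_eq_square power3_eq_cube)
  have "coeff (weier_2div a1' a2' a3' a4' a6' ^ n) (2 * n) = coeff ([:- c6' / 864, - c4' / 48, 0, 1:] ^ n) (2 * n)"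
    using shift[OF degree_weier_2div] pcompose_weier_2div[OF p(1) p5]
    unfolding c4'_def c6'_def by (metis pcompose_power)
  also have "\<dots> = coeff (smult ((v ^ 3) ^ n) (pcompose (T ^ n) [:0, 1 / v:])) (2 * n)"
    unfolding T' smult_power[symmetric] pcompose_power ..
  also have "\<dots> = (v ^ 3) ^ n * ((1 / v) ^ (2 * n) * coeff (T ^ n) (2 * n))"
    by (simp add: coeff_pcompose_linear)
  finally show ?thesis using T by simp
qed

lemma monic_cubic_splits:
  fixes c0 c1 c2 :: "'a::alg_closed_field"
  shows "\<exists>e1 e2 e3. [:c0, c1, c2, 1:] = [:-e1, 1:] * [:-e2, 1:] * [:-e3, 1:]"
proof -
  obtain e1 where "poly [:c0, c1, c2, 1:] e1 = 0"
    using alg_closed_imp_poly_has_root[of "[:c0, c1, c2, 1:]"] by auto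
  then have c0: "c0 = - (e1 * (c1 + e1 * (c2 + e1)))" by (simp add: algebra_simps add_eq_0_iff2)
  define d1 d0 where "d1 = c2 + e1" and "d0 = c1 + e1 * d1"
  have 1: "[:c0, c1, c2, 1:] = [:-e1, 1:] * [:d0, d1, 1:]"
    by (simp add: c0 d1_def d0_def mult_pCons_left algebra_simps)
  obtain e2 where "poly [:d0, d1, 1:] e2 = 0"
    using alg_closed_imp_poly_has_root[of "[:d0, d1, 1:]"] by auto
  then have d0: "d0 = - (e2 * (d1 + e2))" by (simp add: algebra_simps add_eq_0_iff2)
  have 2: "[:d0, d1, 1:] = [:-e2, 1:] * [:-(- (d1 + e2)), 1:]"
    by (simp add: d0 mult_pCons_left algebra_simps)
  show ?thesis unfolding 1 2 mult.assoc[symmetric] by blast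
qed

lemma weier_disc_eq_0_if_double_root:
  fixes a1 a2 a3 a4 a6 :: "'a::field"
  assumes "prime CHAR('a)" "CHAR('a) \<ge> 5"
    and eq: "weier_2div a1 a2 a3 a4 a6 = [:-e, 1:] * [:-e, 1:] * [:-e', 1:]"
  shows "weier_disc a1 a2 a3 a4 a6 = 0"
proof -
  note nz = numeral_neq_0_if_CHAR[OF assms(1,2)]
  define b2 b4 b6 b8 where "b2 = weier_b2 a1 a2 a3 a4 a6" and "b4 = weier_b4 a1 a2 a3 a4 a6"
    and "b6 = weier_b6 a1 a2 a3 a4 a6" and "b8 = weier_b8 a1 a2 a3 a4 a6"
  have "b6 / 4 = - (e * e * e')" "b4 / 2 = e * e + e * e' + e * e'" "b2 / 4 = - (e + e + e')"
  proof -
    have "[:-e, 1:] * [:-e, 1:] * [:-e', 1:] = [:- (e * e * e'), e * e + e * e' + e * e', - (e + e + e'), 1:]"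
      by (simp add: mult_pCons_left mult_pCons_right algebra_simps)
    from eq[unfolded this weier_2div_def, folded b2_def b4_def b6_def]
    show "b6 / 4 = - (e * e * e')" "b4 / 2 = e * e + e * e' + e * e'" "b2 / 4 = - (e + e + e')"
      by (simp_all only: pCons_eq_iff)
  qed
  then have b: "b6 = - 4 * (e * e * e')" "b4 = 2 * (e * e + e * e' + e * e')" "b2 = - 4 * (e + e + e')"
    using nz by (simp_all add: field_simps)
  have b8: "4 * b8 = b2 * b6 - b4\<^sup>2" unfolding b2_def b4_def b6_def b8_def by (rule weier_b8_eq)
  have "4 * (- (b2\<^sup>2 * b8) - 8 * b4 ^ 3 - 27 * b6\<^sup>2 + 9 * b2 * b4 * b6) = 0"
    using b b8 by algebra
  then show ?thesis
    using nz(3) unfolding weier_disc_def Let_def b2_def b4_def b6_def b8_def mult_eq_0_iff by blast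
qed

lemma ex_supersingular_frobenius_if_weier_j:
  fixes a1 a2 a3 a4 a6 :: "'a::alg_closed_field"
  assumes p: "prime p" "CHAR('a) = p" "p \<ge> 5"
    and ss: "supersingular_j (weier_j a1 a2 a3 a4 a6)" and disc: "weier_disc a1 a2 a3 a4 a6 \<noteq> 0"
  obtains e1 e2 e3 :: 'a and n \<alpha> \<beta> q where "supersingular_frobenius e1 e2 e3 n p \<alpha> \<beta> q"
    "weier_2div a1 a2 a3 a4 a6 = [:-e1, 1:] * [:-e2, 1:] * [:-e3, 1:]"
proof -
  have "odd p" using p(1,3) prime_odd_nat[of p] by auto
  then obtain n where n: "p = 2 * n + 1" by (elim oddE)
  have n2: "n \<ge> 2" using n p by simp
  obtain b1 b2 b3 b4 b6 where b: "weier_disc b1 b2 b3 b4 b6 \<noteq> 0"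
      "weier_j a1 a2 a3 a4 a6 = weier_j b1 b2 b3 b4 b6" "hasse_invariant p b1 b2 b3 b4 b6 = 0"
    using ss p(2) unfolding supersingular_j_def by blast
  have zero: "coeff (weier_2div a1 a2 a3 a4 a6 ^ n) (2 * n) = 0"
  proof (rule coeff_weier_2div_power_if_weier_j_eq[OF _ _ n2 b(1) disc b(2)])
    show "coeff (weier_2div b1 b2 b3 b4 b6 ^ n) (2 * n) = 0"
      by (rule coeff_weier_2div_power_eq_0) (use p n n2 b(3) in auto)
  qed (use p n in auto)
  obtain e1 e2 e3 where e: "weier_2div a1 a2 a3 a4 a6 = [:-e1, 1:] * [:-e2, 1:] * [:-e3, 1:]"
    unfolding weier_2div_def using monic_cubic_splits by blast
  have double: "weier_2div a1 a2 a3 a4 a6 \<noteq> [:-x, 1:] * [:-x, 1:] * [:-y, 1:]" for x y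
    using weier_disc_eq_0_if_double_root[of a1 a2 a3 a4 a6 x y] p disc by auto
  interpret supersingular_cubic e1 e2 e3 n p
  proof
    show "e1 \<noteq> e2" using double[of e1 e3] e by auto
    show "e1 \<noteq> e3" using double[of e1 e2] e by (auto simp: mult.commute mult.left_commute)
    show "e2 \<noteq> e3" using double[of e2 e1] e by (auto simp: mult.commute mult.left_commute)
  qed (use p n n2 zero e in auto)
  obtain \<alpha> \<beta> q where "supersingular_frobenius e1 e2 e3 n p \<alpha> \<beta> q" by (rule ex_supersingular_frobenius)
  then show ?thesis using e by (rule that)
qed

section \<open>Level structures\<close>

context supersingular_frobenius
begin

lemma sum_roots: "f = [:c0, c1, c2, 1:] \<Longrightarrow> e1 + e2 + e3 = - c2"
proof -
  assume "f = [:c0, c1, c2, 1:]"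
  moreover have "coeff f 2 = - (e1 + e2 + e3)"
    by (simp add: f_def mult_pCons_left numeral_2_eq_2)
  ultimately show ?thesis by (simp add: numeral_2_eq_2 eq_neg_iff_add_eq_0 add.commute)
qed

text \<open>On y^2 = x^3 + a x^2 + x the marked point (0, 0) lies over a fixed root. At 0 the
  derivative 1 has weight 2 and the trace a has weight 1 in \<open>\<alpha>\<close>, so a^2 is
  invariant.\<close>

lemma level_2:
  assumes f: "f = [:0, 1, a, 1:]"
  shows "(a\<^sup>2) ^ q = a\<^sup>2"
proof -
  have "poly f 0 = 0" by (simp add: f)
  then have \<beta>: "\<beta> = 0" using fixed_roots q_pos by (auto simp: poly_f_eq_0_iff zero_power)
  have "\<alpha>\<^sup>2 = 1" using frobenius_pderiv_f[of 0] q_pos by (simp add: f \<beta> pderiv_pCons zero_power)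
  moreover have "\<alpha> * a ^ q = a" using frobenius_trace[of 0] q_pos by (simp add: sum_roots[OF f] \<beta> zero_power)
  ultimately have "a\<^sup>2 = 1 * (a ^ q)\<^sup>2" by (metis power_mult_distrib)
  also have "(a ^ q)\<^sup>2 = (a\<^sup>2) ^ q" by (simp only: power_mult[symmetric] mult.commute)
  finally show ?thesis by simp
qed

text \<open>The parameters of the Tate normal form \<open>Y\<^sup>2 + (1 - c) X Y - b Y = X\<^sup>3 - b X\<^sup>2\<close> of the curve
  with marked point of abscissa \<open>x\<close>.\<close>
definition tate_a2 where
  "tate_a2 x = 3 * x - (e1 + e2 + e3) - (poly (pderiv f) x)\<^sup>2 / (4 * poly f x)"
definition tate_b where "tate_b x = - (tate_a2 x ^ 3) / (4 * poly f x)"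
definition tate_c where "tate_c x = 1 - poly (pderiv f) x / (2 * poly f x) * tate_a2 x"

text \<open>Moving the point (x, y) to the origin with horizontal tangent gives A1 = f'/y, A2 =
  \<open>tate_a2 x\<close> and A3 = 2 y. Then b = - A2^3 / A3^2 and c = 1 - A1 A2 / A3 involve y
  only through y^2 = f, and both have weight 0 in \<open>\<alpha>\<close>.\<close>

lemma frobenius_tate:
  "tate_b (\<alpha> * x ^ q + \<beta>) = tate_b x ^ q" "tate_c (\<alpha> * x ^ q + \<beta>) = tate_c x ^ q"
proof -
  have a2: "tate_a2 (\<alpha> * x ^ q + \<beta>) = \<alpha> * tate_a2 x ^ q"
  proof -
    have "(\<alpha>\<^sup>2 * poly (pderiv f) x ^ q)\<^sup>2 / (4 * (\<alpha> ^ 3 * poly f x ^ q))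
        = \<alpha> * ((poly (pderiv f) x)\<^sup>2 / (4 * poly f x)) ^ q"
    proof -
      have "(\<alpha>\<^sup>2 * poly (pderiv f) x ^ q)\<^sup>2 = \<alpha> ^ 3 * (\<alpha> * ((poly (pderiv f) x)\<^sup>2) ^ q)"
        by (simp add: power_mult_distrib power2_eq_square power3_eq_cube)
      then show ?thesis
        using \<alpha>_neq_0 by (simp add: power_divide power_mult_distrib numeral_power_q)
    qed
    then show ?thesis
      unfolding tate_a2_def frobenius_f frobenius_pderiv_f frobenius_trace diff_power_q[of "3 * x - _"]
      by (simp add: right_diff_distrib)
  qed
  show "tate_b (\<alpha> * x ^ q + \<beta>) = tate_b x ^ q"
    unfolding tate_b_def a2 frobenius_f using \<alpha>_neq_0
    by (simp add: power_divide power_mult_distrib numeral_power_q minus_power_q power_mult[symmetric] mult.commute)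
  have "\<alpha>\<^sup>2 * u / (2 * (\<alpha> ^ 3 * v)) * (\<alpha> * z) = u / (2 * v) * z" for u v z
    using \<alpha>_neq_0 by (simp add: power2_eq_square power3_eq_cube)
  then show "tate_c (\<alpha> * x ^ q + \<beta>) = tate_c x ^ q"
    unfolding tate_c_def a2 frobenius_f frobenius_pderiv_f diff_power_q
    by (simp add: power_divide power_mult_distrib numeral_power_q)
qed

end

section \<open>Levels 3, 5 and 7: marked torsion points\<close>

context marked_supersingular
begin

lemma poly_pderiv_f_eq: "poly (pderiv f) x = poly (pderiv g) x + poly w x * poly (pderiv w) x / 2"
proof -
  have "pderiv f = pderiv g + smult (1 / 4) (w * pderiv w + w * pderiv w)"
    by (simp add: f_eq pderiv_add pderiv_smult power2_eq_square pderiv_mult)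
  moreover have "1 / 4 * (z + z) = z / 2" for z :: 'a
  proof -
    have "1 / 4 * (z + z) = 2 * z / (2 * 2)" by simp
    then show ?thesis by (simp only: mult_divide_mult_cancel_left[OF two_neq_0])
  qed
  ultimately show ?thesis by (simp only: poly_add poly_smult poly_mult)
qed

lemma frobenius_0: "\<alpha> * 0 ^ q + \<beta> = \<beta>" using q_pos by (simp add: zero_power)

text \<open>On Y^2 + a X Y + Y = X^3 the function Y has divisor 3 Q - 3 O, and Q and -Q share the
  abscissa 0, so both residues of p give \<open>\<beta>\<close> = 0. The values f(0) = 1/4 and f'(0)
  = a/2 then determine how a transforms.\<close>

lemma level_3:
  assumes g: "g = [:0, 0, 0, 1:]" and w: "w = [:1, a:]" and p3: "p \<noteq> 3"
  shows "(a ^ 3) ^ q = a ^ 3"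
proof -
  have l: "miller 3 3 [:-1:] (0 - smult (1 / 2) (1 * w)) (- 1)" if "3 \<le> p"
    by (rule miller_function) (use that in \<open>simp_all add: g w power3_eq_cube mult_pCons_left\<close>)
  have l2: "miller 2 (2 + 1) ([:-1:] * [:-0, 1:]) (0 - smult (1 / 2) (1 * w)) (- 1)" if "3 \<le> p"
    by (rule miller_function) (use that in \<open>simp_all add: g w power2_eq_square mult_pCons_left\<close>)
  have X: "miller 1 (1 + 1) ([:1:] * [:-0, 1:]) [:0, 1:] 0" using miller_X by (simp add: mult_pCons_left numeral_2_eq_2)
  have p_ge: "3 \<le> p" using p_eq n_ge_2 by simp
  have "\<not> 3 dvd p" using prime_p p3 by (metis prime_nat_iff numeral_eq_one_iff semiring_norm(86))
  then have "p = 3 * (p div 3) + 1 \<or> p = 3 * (p div 3) + 2" by presburger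
  then have \<beta>: "\<beta> = 0"
  proof
    assume "p = 3 * (p div 3) + 1"
    then show ?thesis by (rule frobenius_0_eqI[OF _ _ _ l X]) simp_all
  next
    assume "p = 3 * (p div 3) + 2"
    then show ?thesis by (rule frobenius_0_eqI[OF _ _ _ l l2[OF p_ge]]) simp_all
  qed
  note nz = four_neq_0
  have fix0: "\<alpha> * 0 ^ q + \<beta> = 0" using frobenius_0 \<beta> by simp
  have "1 / 4 = \<alpha> ^ 3 * (1 / 4) ^ q" using frobenius_f[of 0, unfolded fix0] by (simp add: f_eq g w)
  then have \<alpha>3: "\<alpha> ^ 3 = 1" using nz by (simp add: power_divide numeral_power_q)
  have "a / 2 = \<alpha>\<^sup>2 * (a / 2) ^ q"
    using frobenius_pderiv_f[of 0, unfolded fix0 poly_pderiv_f_eq] by (simp add: g w pderiv_pCons)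
  then have "a = \<alpha>\<^sup>2 * a ^ q" using two_neq_0 by (simp add: power_divide numeral_power_q)
  then have "a ^ 3 = (\<alpha>\<^sup>2) ^ 3 * (a ^ q) ^ 3" by (metis power_mult_distrib)
  also have "(\<alpha>\<^sup>2) ^ 3 = 1" using \<alpha>3 by (metis power_commutes power_mult mult.commute one_power2)
  also have "(a ^ q) ^ 3 = (a ^ 3) ^ q" by (simp only: power_mult[symmetric] mult.commute)
  finally show ?thesis by simp
qed

end

context marked_supersingular
begin

lemma miller_X': "miller 1 (1 + 1) ([:1:] * [:-0, 1:]) [:0, 1:] 0"
  using miller_X by (simp add: mult_pCons_left numeral_2_eq_2)

text \<open>Denominators are cleared: \<open>h\<close> is 4 f(x), \<open>k\<close> is 2 f'(x), and
  \<open>u\<close> is \<open>tate_a2 x\<close>.\<close>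

lemma tate_eq:
  assumes g: "g = [:0, 0, -b, 1:]" and w: "w = [:-b, 1 - c:]"
    and h: "h = 4 * (x ^ 3 - b * x\<^sup>2) + ((1 - c) * x - b)\<^sup>2" "h \<noteq> 0"
    and k: "k = 2 * (3 * x\<^sup>2 - 2 * b * x) + ((1 - c) * x - b) * (1 - c)"
    and u: "4 * u * h = (12 * x - 4 * b + (1 - c)\<^sup>2) * h - k\<^sup>2"
  shows "tate_b x = - (u ^ 3) / h" "tate_c x = 1 - k / h * u"
proof -
  note nz = four_neq_0
  have fx: "4 * poly f x = h"
  proof -
    have "4 * poly f x = 4 * poly g x + (poly w x)\<^sup>2" using nz by (simp add: f_eq distrib_left)
    then show ?thesis by (simp add: g w h algebra_simps power2_eq_square power3_eq_cube)
  qed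
  have f'x: "2 * poly (pderiv f) x = k"
  proof -
    have "2 * poly (pderiv f) x = 2 * poly (pderiv g) x + poly w x * poly (pderiv w) x"
      using two_neq_0 by (simp add: poly_pderiv_f_eq distrib_left)
    then show ?thesis by (simp add: g w k pderiv_pCons algebra_simps power2_eq_square)
  qed
  have f_coeffs: "f = [:b\<^sup>2 / 4, - (b * (1 - c)) / 2, (1 - c)\<^sup>2 / 4 - b, 1:]"
  proof -
    have "w\<^sup>2 = [:b\<^sup>2, - (b * (1 - c) + b * (1 - c)), (1 - c)\<^sup>2:]"
      by (simp add: w power2_eq_square mult_pCons_left algebra_simps)
    moreover have "- (b * (1 - c) + b * (1 - c)) / 4 = - (b * (1 - c)) / 2"
    proof -
      have "- (b * (1 - c) + b * (1 - c)) / 4 = 2 * - (b * (1 - c)) / (2 * 2)" by (simp add: algebra_simps)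
      then show ?thesis by (simp only: mult_divide_mult_cancel_left[OF two_neq_0])
    qed
    ultimately show ?thesis by (simp add: f_eq g)
  qed
  have T: "4 * (3 * x - (e1 + e2 + e3)) = 12 * x - 4 * b + (1 - c)\<^sup>2"
    unfolding sum_roots[OF f_coeffs] using nz by (simp add: algebra_simps)
  have "4 * tate_a2 x * h = 4 * u * h"
  proof -
    have "4 * tate_a2 x = 4 * (3 * x - (e1 + e2 + e3)) - 4 * ((poly (pderiv f) x)\<^sup>2 / h)"
      unfolding tate_a2_def fx by (simp add: right_diff_distrib)
    then have "4 * tate_a2 x * h = 4 * (3 * x - (e1 + e2 + e3)) * h - 4 * (poly (pderiv f) x)\<^sup>2"
      using h(2) by (simp add: left_diff_distrib)
    also have "4 * (poly (pderiv f) x)\<^sup>2 = k\<^sup>2" unfolding f'x[symmetric] by (simp add: power_mult_distrib)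
    finally show ?thesis unfolding T u .
  qed
  then have a2: "tate_a2 x = u" using nz h(2) by simp
  show "tate_b x = - (u ^ 3) / h" unfolding tate_b_def a2 fx ..
  have "poly (pderiv f) x / (2 * poly f x) = (2 * poly (pderiv f) x) / (2 * (2 * poly f x))"
    by (simp only: mult_divide_mult_cancel_left[OF two_neq_0])
  also have "2 * (2 * poly f x) = h" using fx by simp
  finally show "tate_c x = 1 - k / h * u" unfolding tate_c_def a2 f'x by simp
qed

lemma tate_0:
  assumes g: "g = [:0, 0, -b, 1:]" and w: "w = [:-b, 1 - c:]" and b: "b \<noteq> 0"
  shows "tate_b 0 = b" "tate_c 0 = c"
proof -
  have "tate_b 0 = - ((- b) ^ 3) / b\<^sup>2" "tate_c 0 = 1 - - (b * (1 - c)) / b\<^sup>2 * - b"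
    by (rule tate_eq[OF g w, where k = "- (b * (1 - c))"];
        use b in \<open>simp add: power2_eq_square algebra_simps\<close>)+
  then show "tate_b 0 = b" "tate_c 0 = c" using b by (simp_all add: power2_eq_square power3_eq_cube)
qed

text \<open>For b = c the point Q has order 5 and 2 Q has abscissa b; X^2 - Y - X Y has divisor 5 Q
  - 5 O. Replacing Q by 2 Q sends b to -1/b, which fixes t = b - 11 - 1/b.\<close>

lemma level_5:
  assumes g: "g = [:0, 0, -b, 1:]" and w: "w = [:-b, 1 - b:]" and b: "b \<noteq> 0" and p5: "p \<noteq> 5"
    and t: "t * b = b\<^sup>2 - 11 * b - 1"
  shows "t ^ q = t"
proof -
  note simps = g w power2_eq_square mult_pCons_left mult_pCons_right algebra_simps
  have X5: "[:0, 1:] ^ k = monom (1 :: 'a) k" for k by (simp add: monom_altdef)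
  have l: "miller 5 5 [:-1:] ([:0, 0, 1:] - smult (1 / 2) ([:-1, -1:] * w)) (- [:-1, -1:])" if "5 \<le> p"
    by (rule miller_function) (use that b in \<open>simp_all add: simps X5 monom_Suc monom_0 eval_nat_numeral\<close>)
  \<comment> \<open>Residues 2 and 3 use Y and X^2 - Y, whose last zero lies over b. For residue 4
    the function with divisor 5 Q - 5 O serves, its fifth zero being the residual one.\<close>
  have F2: "miller 2 (2 + 1) ([:-1:] * [:-b, 1:]) (0 - smult (1 / 2) (1 * w)) (- 1)"
    by (rule miller_function) (use p_eq n_ge_2 b in \<open>simp_all add: simps\<close>)
  have F3: "miller 3 (3 + 1) ([:1:] * [:-b, 1:]) ([:0, 0, 1:] - smult (1 / 2) ([:-1:] * w)) (- [:-1:])"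
    by (rule miller_function) (use p_eq n_ge_2 b in \<open>simp_all add: simps X5 monom_Suc monom_0 eval_nat_numeral\<close>)
  have F4: "miller 4 (4 + 1) ([:-1:] * [:-0, 1:]) ([:0, 0, 1:] - smult (1 / 2) ([:-1, -1:] * w)) (- [:-1, -1:])"
    by (rule miller_function) (use p_eq n_ge_2 b in \<open>simp_all add: simps X5 monom_Suc monom_0 eval_nat_numeral\<close>)
  have "\<not> 5 dvd p" using prime_p p5 by (metis prime_nat_iff numeral_eq_one_iff semiring_norm(86))
  then have "p mod 5 \<noteq> 0" by (simp add: dvd_eq_mod_eq_0)
  moreover have "p mod 5 < 5" by simp
  ultimately have "p mod 5 \<in> {1, 2, 3, 4}" by (simp only: insert_iff empty_iff) linarith
  moreover have "p = 5 * (p div 5) + p mod 5" by simp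
  ultimately consider "p = 5 * (p div 5) + 1" | "p = 5 * (p div 5) + 2" | "p = 5 * (p div 5) + 3"
    | "p = 5 * (p div 5) + 4"
    by (metis insert_iff empty_iff)
  then have "\<beta> = 0 \<or> \<beta> = b"
  proof cases
    case 1
    then have "\<beta> = 0" by (rule frobenius_0_eqI[OF _ _ _ l miller_X']) simp_all
    then show ?thesis ..
  next
    case 2
    then have "\<beta> = b" by (rule frobenius_0_eqI[OF _ _ _ l F2]) simp_all
    then show ?thesis ..
  next
    case 3
    then have "\<beta> = b" by (rule frobenius_0_eqI[OF _ _ _ l F3]) simp_all
    then show ?thesis ..
  next
    case 4
    then have "\<beta> = 0" by (rule frobenius_0_eqI[OF _ _ _ l F4]) simp_all
    then show ?thesis ..
  qed
  then have \<beta>: "\<alpha> * 0 ^ q + \<beta> = 0 \<or> \<alpha> * 0 ^ q + \<beta> = b" by (simp only: frobenius_0)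
  have tb: "tate_b b = - 1 / b"
  proof -
    have "tate_b b = - (b ^ 3) / b ^ 4"
      by (rule tate_eq(1)[OF g w _ _ refl]) (use b in \<open>simp_all add: algebra_simps eval_nat_numeral\<close>)
    then show ?thesis using b by (simp add: eval_nat_numeral)
  qed
  define D where "D = b ^ q"
  have "D = tate_b (\<alpha> * 0 ^ q + \<beta>)" using frobenius_tate(1)[of 0] tate_0(1)[OF g w b] by (simp add: D_def)
  then have D: "D = b \<or> D = - 1 / b" using \<beta> tate_0(1)[OF g w b] tb by auto
  have D0: "D \<noteq> 0" using b by (simp add: D_def)
  have "t ^ q * D = D\<^sup>2 - 11 * D - 1"
    using arg_cong[OF t, of "\<lambda>z. z ^ q"]
    by (simp add: D_def power_mult_distrib diff_power_q numeral_power_q power_mult[symmetric] mult.commute)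
  also have "\<dots> = t * D"
    using D
  proof
    assume "D = - 1 / b"
    then have bD: "b * D = - 1" using b by simp
    have "b * b * (D\<^sup>2 - 11 * D - 1) = b * b * (t * D)"
      using bD t by algebra
    then show ?thesis using b by simp
  qed (simp add: t)
  finally show ?thesis using D0 by simp
qed

text \<open>This is the universal curve with a point of order 7: 2 Q and 3 Q have abscissas b and c,
  and d = b / c. Replacing Q by 2 Q or 3 Q sends d to (d - 1)/d or 1/(1 - d), a cyclic group of
  order 3 that fixes t.\<close>

lemma level_7:
  assumes bc: "b = d ^ 3 - d\<^sup>2" "c = d\<^sup>2 - d"
    and g: "g = [:0, 0, -b, 1:]" and w: "w = [:-b, 1 - c:]" and d: "d \<noteq> 0" "d \<noteq> 1" and p7: "p \<noteq> 7"
    and t: "t * (d\<^sup>2 - d) = d ^ 3 - 8 * d\<^sup>2 + 5 * d + 1"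
  shows "t ^ q = t"
proof -
  have c0: "c \<noteq> 0" using d bc by (simp add: power2_eq_square)
  have b_eq: "b = d * c" by (simp add: bc algebra_simps power2_eq_square power3_eq_cube)
  then have b0: "b \<noteq> 0" using d c0 by simp
  note simps = g w bc mult_pCons_left mult_pCons_right algebra_simps
  have X: "[:0, 1:] ^ k = monom (1 :: 'a) k" for k by (simp add: monom_altdef)
  note norm_simps = simps X monom_Suc monom_0 eval_nat_numeral
  have w0: "poly w 0 \<noteq> 0" using b0 w by simp
  \<comment> \<open>The pole order 7 is that of X^2 Y, and vanishing to order 7 at Q fixes the
    coefficients up to scale. The residual zeros of the next functions lie over s Q, where s Q and
    (7 - s) Q share their abscissa.\<close>
  have l: "miller 7 7 [:-1:] ([:0, 0, d\<^sup>2, d + 1:] - smult (1 / 2) ([:- d\<^sup>2, - (2 * d + 1), -1:] * w)) (- [:- d\<^sup>2, - (2 * d + 1), -1:])"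
    if "7 \<le> p"
    by (rule miller_function) (use that w0 d in \<open>simp_all add: norm_simps\<close>)
  have F2: "miller 2 (2 + 1) ([:-1:] * [:-b, 1:]) (0 - smult (1 / 2) (1 * w)) (- 1)"
    by (rule miller_function) (use p_eq n_ge_2 w0 in \<open>simp_all add: norm_simps\<close>)
  have F3: "miller 3 (3 + 1) ([:1:] * [:-c, 1:]) ([:0, 0, 1:] - smult (1 / 2) ([:-1:] * w)) (- [:-1:])"
    by (rule miller_function) (use p_eq n_ge_2 w0 in \<open>simp_all add: norm_simps\<close>)
  have F4: "miller 4 (4 + 1) ([:-1:] * [:-c, 1:]) ([:0, 0, d:] - smult (1 / 2) ([:-d, -1:] * w)) (- [:-d, -1:])"
    by (rule miller_function) (use p_eq n_ge_2 w0 d in \<open>simp_all add: norm_simps\<close>)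
  have F5: "miller 5 (5 + 1) ([:1:] * [:-b, 1:]) ([:0, 0, d\<^sup>2, 1:] - smult (1 / 2) ([:- d\<^sup>2, - (1 + d):] * w)) (- [:- d\<^sup>2, - (1 + d):])"
    by (rule miller_function) (use p_eq n_ge_2 w0 d in \<open>simp_all add: norm_simps\<close>)
  have F6: "miller 6 (6 + 1) ([:-1:] * [:-0, 1:])
      ([:0, 0, d\<^sup>2, d + 1:] - smult (1 / 2) ([:- d\<^sup>2, - (2 * d + 1), -1:] * w)) (- [:- d\<^sup>2, - (2 * d + 1), -1:])" if "6 \<le> p"
    by (rule miller_function) (use that w0 d in \<open>simp_all add: norm_simps\<close>)
  have "\<not> 7 dvd p" using prime_p p7 by (metis prime_nat_iff numeral_eq_one_iff semiring_norm(86))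
  then have "p mod 7 \<noteq> 0" by (simp add: dvd_eq_mod_eq_0)
  moreover have "p mod 7 < 7" by simp
  ultimately have "p mod 7 \<in> {1, 2, 3, 4, 5, 6}" by (simp only: insert_iff empty_iff) linarith
  moreover have "p = 7 * (p div 7) + p mod 7" by simp
  ultimately consider "p = 7 * (p div 7) + 1" | "p = 7 * (p div 7) + 2" | "p = 7 * (p div 7) + 3"
    | "p = 7 * (p div 7) + 4" | "p = 7 * (p div 7) + 5" | "p = 7 * (p div 7) + 6"
    by (metis insert_iff empty_iff)
  then have "\<beta> = 0 \<or> \<beta> = b \<or> \<beta> = c"
  proof cases
    case 1
    then have "\<beta> = 0" by (rule frobenius_0_eqI[OF _ _ _ l miller_X']) simp_all
    then show ?thesis by blast
  next
    case 2
    then have "\<beta> = b" by (rule frobenius_0_eqI[OF _ _ _ l F2]) simp_all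
    then show ?thesis by blast
  next
    case 3
    then have "\<beta> = c" by (rule frobenius_0_eqI[OF _ _ _ l F3]) simp_all
    then show ?thesis by blast
  next
    case 4
    then have "\<beta> = c" by (rule frobenius_0_eqI[OF _ _ _ l F4]) simp_all
    then show ?thesis by blast
  next
    case 5
    then have "\<beta> = b" by (rule frobenius_0_eqI[OF _ _ _ l F5]) simp_all
    then show ?thesis by blast
  next
    case 6
    then have "6 \<le> p" by simp
    have "\<beta> = 0" by (rule frobenius_0_eqI[OF 6 _ _ l F6[OF \<open>6 \<le> p\<close>]]) simp_all
    then show ?thesis by blast
  qed
  then have \<beta>: "\<alpha> * 0 ^ q + \<beta> = 0 \<or> \<alpha> * 0 ^ q + \<beta> = b \<or> \<alpha> * 0 ^ q + \<beta> = c" by (simp only: frobenius_0)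
  have d1: "d - 1 \<noteq> 0" using d by simp
  have cd: "c = d * (d - 1)" by (simp add: bc algebra_simps power2_eq_square)
  have tb: "tate_b b / tate_c b = (d - 1) / d"
  proof -
    define u h k where "u = d * (d - 1)\<^sup>2" and "h = (d\<^sup>2 * (d - 1)\<^sup>2 * d)\<^sup>2"
      and "k = 2 * (3 * b\<^sup>2 - 2 * b * b) + ((1 - c) * b - b) * (1 - c)"
    have k: "k = d ^ 3 * (d - 1)\<^sup>2 * (d\<^sup>2 + d - 1)"
      by (simp add: k_def bc algebra_simps eval_nat_numeral)
    have h0: "h \<noteq> 0" using d d1 by (simp add: h_def)
    have h: "h = 4 * (b ^ 3 - b * b\<^sup>2) + ((1 - c) * b - b)\<^sup>2"
      by (simp add: h_def bc algebra_simps eval_nat_numeral)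
    have u: "4 * u * h = (12 * b - 4 * b + (1 - c)\<^sup>2) * h - k\<^sup>2"
      unfolding k h_def u_def bc by (simp add: algebra_simps eval_nat_numeral)
    have 1: "tate_b b = - (u ^ 3) / h" "tate_c b = 1 - k / h * u"
      by (rule tate_eq[OF g w h h0 k_def u])+
    have tb1: "tate_b b = - ((d - 1)\<^sup>2) / d ^ 3"
      unfolding 1 u_def h_def using d d1 by (simp add: divide_simps) (simp add: eval_nat_numeral)
    have tb2: "tate_c b = - (d - 1) / d\<^sup>2"
    proof -
      have kh: "k / h * u = (d\<^sup>2 + d - 1) / d\<^sup>2"
        unfolding k u_def h_def using d d1 by (simp add: divide_simps) (simp add: eval_nat_numeral)
      show ?thesis unfolding 1 kh using d by (simp add: divide_simps)
    qed
    show ?thesis unfolding tb1 tb2 using d d1 by (simp add: divide_simps) (simp add: eval_nat_numeral algebra_simps)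
  qed
  have tc: "tate_b c / tate_c c = 1 / (1 - d)"
  proof -
    define u h k where "u = d * (d - 1)" and "h = (d * (d - 1) ^ 3)\<^sup>2"
      and "k = 2 * (3 * c\<^sup>2 - 2 * b * c) + ((1 - c) * c - b) * (1 - c)"
    have k: "k = d * (d - 1) ^ 3 * (d\<^sup>2 - 3 * d + 1)"
      by (simp add: k_def bc algebra_simps eval_nat_numeral)
    have h0: "h \<noteq> 0" using d d1 by (simp add: h_def)
    have h: "h = 4 * (c ^ 3 - b * c\<^sup>2) + ((1 - c) * c - b)\<^sup>2"
      by (simp add: h_def bc algebra_simps eval_nat_numeral)
    have u: "4 * u * h = (12 * c - 4 * b + (1 - c)\<^sup>2) * h - k\<^sup>2"
      unfolding k h_def u_def bc by (simp add: algebra_simps eval_nat_numeral)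
    have 1: "tate_b c = - (u ^ 3) / h" "tate_c c = 1 - k / h * u"
      by (rule tate_eq[OF g w h h0 k_def u])+
    have tb1: "tate_b c = - d / (d - 1) ^ 3"
      unfolding 1 u_def h_def using d d1 by (simp add: divide_simps) (simp add: eval_nat_numeral)
    have tb2: "tate_c c = d / (d - 1)\<^sup>2"
    proof -
      have kh: "k / h * u = (d\<^sup>2 - 3 * d + 1) / (d - 1)\<^sup>2"
        unfolding k u_def h_def using d d1 by (simp add: divide_simps) (simp add: eval_nat_numeral)
      show ?thesis unfolding 1 kh using d1 by (simp add: divide_simps) (simp add: eval_nat_numeral algebra_simps)
    qed
    show ?thesis unfolding tb1 tb2 using d d1 by (simp add: divide_simps) (simp add: eval_nat_numeral algebra_simps)
  qed
  \<comment> \<open>Since d = b / c, its q-th power is the same quotient of Tate parameters taken at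
    p Q, whose abscissa is 0, b or c.\<close>
  define D where "D = d ^ q"
  have "d = tate_b 0 / tate_c 0" using tate_0[OF g w b0] b_eq c0 by simp
  then have "D = tate_b (\<alpha> * 0 ^ q + \<beta>) / tate_c (\<alpha> * 0 ^ q + \<beta>)"
    unfolding D_def frobenius_tate by (metis power_divide)
  then have D: "D = d \<or> D = (d - 1) / d \<or> D = 1 / (1 - d)"
    using \<beta> \<open>d = tate_b 0 / tate_c 0\<close> tb tc by auto
  have "t ^ q * (D\<^sup>2 - D) = D ^ 3 - 8 * D\<^sup>2 + 5 * D + 1"
    using arg_cong[OF t, of "\<lambda>z. z ^ q"]
    by (simp add: D_def power_mult_distrib diff_power_q add_power_q numeral_power_q power_mult[symmetric] mult.commute)
  also have "\<dots> = t * (D\<^sup>2 - D)"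
    using D
  proof (elim disjE)
    assume "D = (d - 1) / d"
    then have dD: "d * D = d - 1" using d by simp
    have "d ^ 3 * (D ^ 3 - 8 * D\<^sup>2 + 5 * D + 1) = d ^ 3 * (t * (D\<^sup>2 - D))" using dD t by algebra
    then show ?thesis using d by simp
  next
    assume "D = 1 / (1 - d)"
    then have dD: "(1 - d) * D = 1" using d by simp
    have "(1 - d) ^ 3 * (D ^ 3 - 8 * D\<^sup>2 + 5 * D + 1) = (1 - d) ^ 3 * (t * (D\<^sup>2 - D))" using dD t by algebra
    then show ?thesis using d by simp
  qed (simp add: t)
  finally have eq: "t ^ q * (D\<^sup>2 - D) = t * (D\<^sup>2 - D)" .
  have "D\<^sup>2 - D = (d * (d - 1)) ^ q"
    by (simp add: D_def right_diff_distrib diff_power_q power_mult_distrib power2_eq_square)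
  then show ?thesis using eq d by simp
qed

end

section \<open>Hauptmoduln and the factorisation of R_N\<close>

lemma (in supersingular_frobenius) power_p2_if_fixed:
  fixes t Y :: 'a
  assumes "t ^ q = t" "Y = t + numeral c / t + numeral k"
  shows "Y ^ p\<^sup>2 = Y"
  by (rule power_p2_if_power_q) (simp add: assms add_power_q power_divide numeral_power_q)

lemma ex_hauptmodul:
  fixes Y c k :: "'a::alg_closed_field"
  assumes "c \<noteq> 0"
  obtains t where "t \<noteq> 0" "Y = t + c / t + k" "Y * t = t\<^sup>2 + k * t + c"
proof -
  obtain t where "poly [:c, k - Y, 1:] t = 0"
    using alg_closed_imp_poly_has_root[of "[:c, k - Y, 1:]"] by auto
  then have t: "Y * t = t\<^sup>2 + k * t + c" by (simp add: algebra_simps power2_eq_square)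
  then have t0: "t \<noteq> 0" using assms by auto
  have "Y = (t\<^sup>2 + k * t + c) / t" using t t0 by (metis nonzero_mult_div_cancel_right)
  also have "\<dots> = t + c / t + k" using t0 by (simp add: field_simps power2_eq_square)
  finally show ?thesis using that t t0 by blast
qed

text \<open>Up to a power of t, R_2(j, Y) is the product of \<open>j * t - (t + 16) ^ 3\<close> and
  its image under t -> 4096/t. If the second factor vanishes, t is replaced by its image, which
  gives the same Y. The other levels follow this pattern.\<close>

lemma R_N_2_hauptmodul:
  fixes j Y :: "'a::alg_closed_field"
  assumes "R_N 2 j Y = 0" "(4096 :: 'a) \<noteq> 0"
  obtains t where "t \<noteq> 0" "Y = t + 4096 / t + 128" "j * t = (t + 16) ^ 3"
proof -
  obtain t where t0: "t \<noteq> 0" and Y: "Y = t + 4096 / t + 128" and Yt: "Y * t = t\<^sup>2 + 128 * t + 4096"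
    using ex_hauptmodul[OF assms(2)] .
  have R: "j\<^sup>2 - j * (Y\<^sup>2 - 207 * Y + 3456) + (Y + 144) ^ 3 = 0" using assms(1) by (simp add: R_N_def)
  have "(j * t - (t + 16) ^ 3) * (j * t\<^sup>2 - (t + 256) ^ 3) = 0"
  proof -
    have "t ^ 3 * j\<^sup>2 - j * t * ((Y * t)\<^sup>2 - 207 * (Y * t) * t + 3456 * t\<^sup>2) + (Y * t + 144 * t) ^ 3 = 0"
      using R by algebra
    then show ?thesis unfolding Yt by algebra
  qed
  then consider "j * t = (t + 16) ^ 3" | "j * t\<^sup>2 = (t + 256) ^ 3" by auto
  then show ?thesis
  proof cases
    case 1
    then show ?thesis using that t0 Y by blast
  next
    case 2
    define s where "s = 4096 / t"
    have st: "s * t = 4096" using t0 by (simp add: s_def)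
    have "t ^ 3 * (j * s) = t ^ 3 * (s + 16) ^ 3" using 2 st by algebra
    then have "j * s = (s + 16) ^ 3" using t0 by simp
    moreover have "s \<noteq> 0" using st assms(2) by auto
    moreover have "Y = s + 4096 / s + 128" using Y t0 assms(2) by (simp add: s_def)
    ultimately show ?thesis using that by blast
  qed
qed

lemma R_N_3_hauptmodul:
  fixes j Y :: "'a::alg_closed_field"
  assumes "R_N 3 j Y = 0" "(729 :: 'a) \<noteq> 0"
  obtains t where "t \<noteq> 0" "Y = t + 729 / t + 54" "j * t = (t + 27) * (t + 3) ^ 3"
proof -
  obtain t where t0: "t \<noteq> 0" and Y: "Y = t + 729 / t + 54" and Yt: "Y * t = t\<^sup>2 + 54 * t + 729"
    using ex_hauptmodul[OF assms(2)] .
  have R: "j\<^sup>2 - j * Y * (Y\<^sup>2 - 126 * Y + 2944) + Y * (Y + 192) ^ 3 = 0" using assms(1) by (simp add: R_N_def)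
  have "(j * t - (t + 27) * (t + 3) ^ 3) * (j * t ^ 3 - (t + 27) * (t + 243) ^ 3) = 0"
  proof -
    have "t ^ 4 * j\<^sup>2 - j * t * (Y * t) * ((Y * t)\<^sup>2 - 126 * (Y * t) * t + 2944 * t\<^sup>2)
        + (Y * t) * (Y * t + 192 * t) ^ 3 = 0"
      using R by algebra
    then show ?thesis unfolding Yt by algebra
  qed
  then consider "j * t = (t + 27) * (t + 3) ^ 3" | "j * t ^ 3 = (t + 27) * (t + 243) ^ 3" by auto
  then show ?thesis
  proof cases
    case 1
    then show ?thesis using that t0 Y by blast
  next
    case 2
    define s where "s = 729 / t"
    have st: "s * t = 729" using t0 by (simp add: s_def)
    have "t ^ 4 * ((s + 27) * (s + 3) ^ 3) = (s * t + 27 * t) * (s * t + 3 * t) ^ 3" by algebra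
    also have "\<dots> = 729 * ((t + 27) * (t + 243) ^ 3)" unfolding st by algebra
    also have "\<dots> = (s * t) * (j * t ^ 3)" unfolding 2 st ..
    also have "\<dots> = t ^ 4 * (j * s)" by algebra
    finally have "j * s = (s + 27) * (s + 3) ^ 3" using t0 by simp
    moreover have "s \<noteq> 0" using st assms(2) by auto
    moreover have "Y = s + 729 / s + 54" using Y t0 assms(2) by (simp add: s_def)
    ultimately show ?thesis using that by blast
  qed
qed

lemma R_N_5_hauptmodul:
  fixes j Y :: "'a::alg_closed_field"
  assumes "R_N 5 j Y = 0" "(125 :: 'a) \<noteq> 0"
  obtains t where "t \<noteq> 0" "Y = t + 125 / t + 22" "j * t = (t\<^sup>2 + 10 * t + 5) ^ 3"
proof -
  obtain t where t0: "t \<noteq> 0" and Y: "Y = t + 125 / t + 22" and Yt: "Y * t = t\<^sup>2 + 22 * t + 125"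
    using ex_hauptmodul[OF assms(2)] .
  have R: "j\<^sup>2 - j * (Y ^ 5 - 80 * Y ^ 4 + 1890 * Y ^ 3 - 12600 * Y\<^sup>2 + 7776 * Y + 3456)
      + (Y\<^sup>2 + 216 * Y + 144) ^ 3 = 0" using assms(1) by (simp add: R_N_def)
  have "(j * t - (t\<^sup>2 + 10 * t + 5) ^ 3) * (j * t ^ 5 - (t\<^sup>2 + 250 * t + 3125) ^ 3) = 0"
  proof -
    have "t ^ 6 * j\<^sup>2 - j * t * ((Y * t) ^ 5 - 80 * (Y * t) ^ 4 * t + 1890 * (Y * t) ^ 3 * t\<^sup>2
        - 12600 * (Y * t)\<^sup>2 * t ^ 3 + 7776 * (Y * t) * t ^ 4 + 3456 * t ^ 5)
        + ((Y * t)\<^sup>2 + 216 * (Y * t) * t + 144 * t\<^sup>2) ^ 3 = 0"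
      using R by algebra
    then show ?thesis unfolding Yt by algebra
  qed
  then consider "j * t = (t\<^sup>2 + 10 * t + 5) ^ 3" | "j * t ^ 5 = (t\<^sup>2 + 250 * t + 3125) ^ 3" by auto
  then show ?thesis
  proof cases
    case 1
    then show ?thesis using that t0 Y by blast
  next
    case 2
    define s where "s = 125 / t"
    have st: "s * t = 125" using t0 by (simp add: s_def)
    have "t\<^sup>2 * (s\<^sup>2 + 10 * s + 5) = (s * t)\<^sup>2 + 10 * (s * t) * t + 5 * t\<^sup>2" by algebra
    then have 5: "t\<^sup>2 * (s\<^sup>2 + 10 * s + 5) = 5 * (t\<^sup>2 + 250 * t + 3125)" unfolding st by simp
    have "t ^ 6 * (s\<^sup>2 + 10 * s + 5) ^ 3 = (t\<^sup>2 * (s\<^sup>2 + 10 * s + 5)) ^ 3" by algebra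
    also have "\<dots> = (s * t) * (j * t ^ 5)" unfolding 5 power_mult_distrib 2 st by simp
    also have "\<dots> = t ^ 6 * (j * s)" by algebra
    finally have "t ^ 6 * (j * s) = t ^ 6 * (s\<^sup>2 + 10 * s + 5) ^ 3" ..
    then have "j * s = (s\<^sup>2 + 10 * s + 5) ^ 3" using t0 by simp
    moreover have "s \<noteq> 0" using st assms(2) by auto
    moreover have "Y = s + 125 / s + 22" using Y t0 assms(2) by (simp add: s_def)
    ultimately show ?thesis using that by blast
  qed
qed

lemma R_N_7_hauptmodul:
  fixes j Y :: "'a::alg_closed_field"
  assumes "R_N 7 j Y = 0" "(49 :: 'a) \<noteq> 0"
  obtains t where "t \<noteq> 0" "Y = t + 49 / t + 13" "j * t = (t\<^sup>2 + 13 * t + 49) * (t\<^sup>2 + 5 * t + 1) ^ 3"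
proof -
  obtain t where t0: "t \<noteq> 0" and Y: "Y = t + 49 / t + 13" and Yt: "Y * t = t\<^sup>2 + 13 * t + 49"
    using ex_hauptmodul[OF assms(2)] .
  have R: "j\<^sup>2 - j * Y * (Y\<^sup>2 - 21 * Y + 8) * (Y ^ 4 - 42 * Y ^ 3 + 454 * Y\<^sup>2 - 1008 * Y - 1280)
      + Y\<^sup>2 * (Y\<^sup>2 + 224 * Y + 448) ^ 3 = 0" using assms(1) by (simp add: R_N_def)
  \<comment> \<open>\<open>M\<close> is Y t. Up to powers of t, the factor Y^2 - 21 Y + 8 is u + v,
    the cubed factor is u v, and the quartic is (u + v)^2 - 3 u v, so that u^3 + v^3
    appears.\<close>
  define M where "M = t\<^sup>2 + 13 * t + 49"
  define u where "u = t\<^sup>2 * (t\<^sup>2 + 5 * t + 1)"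
  define v where "v = t\<^sup>2 + 245 * t + 2401"
  have sum: "M\<^sup>2 - 21 * M * t + 8 * t\<^sup>2 = u + v" unfolding M_def u_def v_def by algebra
  have prod: "t\<^sup>2 * (M\<^sup>2 + 224 * M * t + 448 * t\<^sup>2) = u * v" unfolding M_def u_def v_def by algebra
  have quartic: "M ^ 4 - 42 * M ^ 3 * t + 454 * M\<^sup>2 * t\<^sup>2 - 1008 * M * t ^ 3 - 1280 * t ^ 4 = (u + v)\<^sup>2 - 3 * (u * v)"
    unfolding sum[symmetric] prod[symmetric] by algebra
  have "t ^ 8 * j\<^sup>2 - j * t * M * (M\<^sup>2 - 21 * M * t + 8 * t\<^sup>2)
      * (M ^ 4 - 42 * M ^ 3 * t + 454 * M\<^sup>2 * t\<^sup>2 - 1008 * M * t ^ 3 - 1280 * t ^ 4)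
      + M\<^sup>2 * (M\<^sup>2 + 224 * M * t + 448 * t\<^sup>2) ^ 3 = 0"
    unfolding M_def Yt[symmetric] using R by algebra
  then have "t ^ 6 * (t ^ 8 * j\<^sup>2) - t ^ 6 * (j * t * M * (u + v) * ((u + v)\<^sup>2 - 3 * (u * v)))
      + M\<^sup>2 * (t\<^sup>2 * (M\<^sup>2 + 224 * M * t + 448 * t\<^sup>2)) ^ 3 = 0"
    unfolding sum quartic by algebra
  then have "(t ^ 7 * j - M * u ^ 3) * (t ^ 7 * j - M * v ^ 3) = 0" unfolding prod by algebra
  then consider "t ^ 7 * j = M * u ^ 3" | "t ^ 7 * j = M * v ^ 3" by auto
  then show ?thesis
  proof cases
    case 1
    then have "t ^ 6 * (j * t) = t ^ 6 * (M * (t\<^sup>2 + 5 * t + 1) ^ 3)" unfolding u_def by algebra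
    then have "j * t = M * (t\<^sup>2 + 5 * t + 1) ^ 3" using t0 by simp
    then show ?thesis using that t0 Y unfolding M_def by blast
  next
    case 2
    define s where "s = 49 / t"
    have st: "s * t = 49" using t0 by (simp add: s_def)
    have "t\<^sup>2 * (s\<^sup>2 + 5 * s + 1) = (s * t)\<^sup>2 + 5 * (s * t) * t + t\<^sup>2" by algebra
    then have v: "v = t\<^sup>2 * (s\<^sup>2 + 5 * s + 1)" unfolding st v_def by simp
    have "s * (t\<^sup>2 + 13 * t + 49) = (s * t) * t + 13 * (s * t) + 49 * s"
      "t * (s\<^sup>2 + 13 * s + 49) = (s * t) * s + 13 * (s * t) + 49 * t" by algebra+
    then have M: "s * M = t * (s\<^sup>2 + 13 * s + 49)" unfolding st M_def by simp
    have "t ^ 7 * (j * s) = (s * M) * v ^ 3" using 2 by algebra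
    then have "t ^ 7 * (j * s) = t ^ 7 * ((s\<^sup>2 + 13 * s + 49) * (s\<^sup>2 + 5 * s + 1) ^ 3)" unfolding M v by algebra
    then have "j * s = (s\<^sup>2 + 13 * s + 49) * (s\<^sup>2 + 5 * s + 1) ^ 3" using t0 by simp
    moreover have "s \<noteq> 0" using st assms(2) by auto
    moreover have "Y = s + 49 / s + 13" using Y t0 assms(2) by (simp add: s_def)
    ultimately show ?thesis using that by blast
  qed
qed

lemma numeral_prime_power_neq_0:
  fixes N k p :: nat
  assumes "CHAR('a::idom) = p" "prime p" "prime N" "p \<noteq> N"
  shows "of_nat (N ^ k) \<noteq> (0 :: 'a)"
proof
  assume "of_nat (N ^ k) = (0 :: 'a)"
  then have "p dvd N ^ k" unfolding assms(1)[symmetric] by (simp only: of_nat_eq_0_iff_char_dvd)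
  then have "p dvd N" using assms(2) prime_dvd_power by blast
  then show False using assms primes_dvd_imp_eq by blast
qed

section \<open>Supersingular roots for p at least 5\<close>

lemma supersingular_roots_level_2:
  fixes j Y :: "'k::alg_closed_field"
  assumes p: "prime p" "CHAR('k) = p" "p \<ge> 5" and ss: "supersingular_j j" and R: "R_N 2 j Y = 0"
  shows "Y ^ p\<^sup>2 = Y"
proof -
  note nz = numeral_neq_0_if_CHAR[where 'a = 'k, unfolded p(2), OF p(1,3)]
  have "(4096 :: 'k) \<noteq> 0" using numeral_prime_power_neq_0[OF p(2,1), of 2 12] p(3) by simp
  then obtain t where t: "t \<noteq> 0" "Y = t + 4096 / t + 128" "j * t = (t + 16) ^ 3"
    using R_N_2_hauptmodul[OF R] by blast
  \<comment> \<open>This makes the discriminant 16 (a^2 - 4) of y^2 = x^3 + a x^2 + x equal to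
    t.\<close>
  obtain a where a: "a\<^sup>2 = 4 + t / 16" using nth_root_exists[of 2 "4 + t / 16"] by auto
  have t_eq: "16 * a\<^sup>2 - 64 = t" unfolding a using nz by (simp add: distrib_left)
  have disc: "weier_disc 0 a 0 1 0 = t"
    unfolding t_eq[symmetric] weier_disc_def Let_def weier_b2_def weier_b4_def weier_b6_def weier_b8_def
    by (simp add: power_mult_distrib)
  have c4: "weier_c4 0 a 0 1 0 = t + 16"
    unfolding t_eq[symmetric] weier_c4_def weier_b2_def weier_b4_def by (simp add: power_mult_distrib)
  have "weier_j 0 a 0 1 0 = j" unfolding weier_j_def disc c4 t(3)[symmetric] using t(1) by simp
  then have ss': "supersingular_j (weier_j 0 a 0 1 0)" using ss by simp
  have disc': "weier_disc 0 a 0 1 0 \<noteq> 0" using disc t(1) by simp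
  obtain e1 e2 e3 :: 'k and n \<alpha> \<beta> q where sf: "supersingular_frobenius e1 e2 e3 n p \<alpha> \<beta> q"
    and e: "weier_2div 0 a 0 1 0 = [:-e1, 1:] * [:-e2, 1:] * [:-e3, 1:]"
    by (rule ex_supersingular_frobenius_if_weier_j[OF p ss' disc'])
  interpret supersingular_frobenius e1 e2 e3 n p \<alpha> \<beta> q by (rule sf)
  have "f = [:0, 1, a, 1:]"
    unfolding f_def e[symmetric] weier_2div_def weier_b2_def weier_b4_def weier_b6_def using nz by simp
  then have "(a\<^sup>2) ^ q = a\<^sup>2" by (rule level_2)
  then have "t ^ q = t" unfolding t_eq[symmetric] by (simp add: diff_power_q power_mult_distrib numeral_power_q)
  then show ?thesis using t(2) by (rule power_p2_if_fixed)
qed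

lemma supersingular_roots_level_3:
  fixes j Y :: "'k::alg_closed_field"
  assumes p: "prime p" "CHAR('k) = p" "p \<ge> 5" and ss: "supersingular_j j" and R: "R_N 3 j Y = 0"
  shows "Y ^ p\<^sup>2 = Y"
proof -
  note nz = numeral_neq_0_if_CHAR[where 'a = 'k, unfolded p(2), OF p(1,3)]
  have "(729 :: 'k) \<noteq> 0" using numeral_prime_power_neq_0[OF p(2,1), of 3 6] p(3) by simp
  then obtain t where t: "t \<noteq> 0" "Y = t + 729 / t + 54" "j * t = (t + 27) * (t + 3) ^ 3"
    using R_N_3_hauptmodul[OF R] by blast
  \<comment> \<open>This makes the discriminant a^3 - 27 of Y^2 + a X Y + Y = X^3 equal to
    t.\<close>
  obtain a where a: "a ^ 3 = t + 27" using nth_root_exists[of 3 "t + 27"] by auto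
  have t_eq: "a ^ 3 - 27 = t" using a by simp
  have disc: "weier_disc a 0 1 0 0 = t"
    unfolding t_eq[symmetric] weier_disc_def Let_def weier_b2_def weier_b4_def weier_b6_def weier_b8_def
    by (simp add: power2_eq_square power3_eq_cube)
  have c4: "weier_c4 a 0 1 0 0 = a * (t + 3)"
    unfolding t_eq[symmetric] weier_c4_def weier_b2_def weier_b4_def
    by (simp add: power2_eq_square power3_eq_cube algebra_simps)
  have "weier_j a 0 1 0 0 = j"
    unfolding weier_j_def disc c4 power_mult_distrib a t(3)[symmetric] using t(1) by simp
  then have ss': "supersingular_j (weier_j a 0 1 0 0)" using ss by simp
  have disc': "weier_disc a 0 1 0 0 \<noteq> 0" using disc t(1) by simp
  obtain e1 e2 e3 :: 'k and n \<alpha> \<beta> q where sf: "supersingular_frobenius e1 e2 e3 n p \<alpha> \<beta> q"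
    and e: "weier_2div a 0 1 0 0 = [:-e1, 1:] * [:-e2, 1:] * [:-e3, 1:]"
    by (rule ex_supersingular_frobenius_if_weier_j[OF p ss' disc'])
  interpret supersingular_frobenius e1 e2 e3 n p \<alpha> \<beta> q by (rule sf)
  interpret marked_supersingular e1 e2 e3 n p \<alpha> \<beta> q "[:0, 0, 0, 1:]" "[:1, a:]"
  proof
    have quarter: "(a + a) / 4 = a / 2"
    proof -
      have "(a + a) / 4 = 2 * a / (2 * 2)" by simp
      then show ?thesis by (simp only: mult_divide_mult_cancel_left[OF two_neq_0])
    qed
    show "f = [:0, 0, 0, 1:] + smult (1 / 4) ([:1, a:]\<^sup>2)"
      unfolding f_def e[symmetric] weier_2div_def weier_b2_def weier_b4_def weier_b6_def
      using quarter nz by (simp add: power2_eq_square mult_pCons_left)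
  qed simp_all
  have "(a ^ 3) ^ q = a ^ 3" by (rule level_3) (use p in auto)
  then have "t ^ q = t" unfolding t_eq[symmetric] by (simp add: diff_power_q numeral_power_q)
  then show ?thesis using t(2) by (rule power_p2_if_fixed)
qed

lemma (in supersingular_frobenius) marked_supersingular_tate:
  assumes "f = weier_2div (1 - c) (- b) (- b) 0 0" "b \<noteq> 0"
  shows "marked_supersingular e1 e2 e3 n p \<alpha> \<beta> q [:0, 0, -b, 1:] [:-b, 1 - c:]"
proof
  have quarter: "(x + x) / 4 = x / 2" for x :: 'a
  proof -
    have "(x + x) / 4 = 2 * x / (2 * 2)" by simp
    then show ?thesis by (simp only: mult_divide_mult_cancel_left[OF two_neq_0])
  qed
  note nz = four_neq_0
  have "[:-b, 1 - c:]\<^sup>2 = [:b * b, - ((1 - c) * b) + - ((1 - c) * b), (1 - c) * (1 - c):]"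
    by (simp add: power2_eq_square mult_pCons_left mult.commute)
  moreover have "1 / 4 * (- ((1 - c) * b) + - ((1 - c) * b)) = - ((1 - c) * b) / 2"
    using quarter[of "- ((1 - c) * b)"] by (simp only: times_divide_eq_left mult_1)
  ultimately have "[:0, 0, -b, 1:] + smult (1 / 4) ([:-b, 1 - c:]\<^sup>2)
      = [:b * b / 4, - ((1 - c) * b) / 2, - b + (1 - c) * (1 - c) / 4, 1:]"
    by (simp only: smult_pCons smult_0_right add_pCons add_0 add_0_right) simp
  moreover have "- b + (1 - c) * (1 - c) / 4 = ((1 - c)\<^sup>2 + 4 * - b) / 4"
    using nz by (simp add: add_divide_distrib power2_eq_square diff_divide_distrib)
  ultimately show "f = [:0, 0, -b, 1:] + smult (1 / 4) ([:-b, 1 - c:]\<^sup>2)"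
    unfolding assms(1) weier_2div_def weier_b2_def weier_b4_def weier_b6_def
    using nz by (simp add: power2_eq_square)
qed (use assms in simp_all)

lemma weier_disc_tate:
  "weier_disc (1 - c) (- b) (- b) 0 0 = b ^ 3 * (16 * b\<^sup>2 - b * (8 * c\<^sup>2 + 20 * c - 1) - c * (1 - c) ^ 3)"
  for b c :: "'a::idom"
  unfolding weier_disc_def Let_def weier_b2_def weier_b4_def weier_b6_def weier_b8_def
  by (simp add: algebra_simps eval_nat_numeral)

lemma supersingular_roots_level_5:
  fixes j Y :: "'k::alg_closed_field"
  assumes p: "prime p" "CHAR('k) = p" "p \<ge> 5" and p5: "p \<noteq> 5"
    and ss: "supersingular_j j" and R: "R_N 5 j Y = 0"
  shows "Y ^ p\<^sup>2 = Y"
proof -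
  have "(125 :: 'k) \<noteq> 0" using numeral_prime_power_neq_0[OF p(2,1), of 5 3] p5 by simp
  then obtain t where t: "t \<noteq> 0" "Y = t + 125 / t + 22" "j * t = (t\<^sup>2 + 10 * t + 5) ^ 3"
    using R_N_5_hauptmodul[OF R] by blast
  \<comment> \<open>The quadratic is t = b - 11 - 1/b with the denominator cleared, the covering of
    X_0(5) by X_1(5).\<close>
  obtain b where "poly [:-1, - (t + 11), 1:] b = 0"
    using alg_closed_imp_poly_has_root[of "[:-1, - (t + 11), 1:]"] by auto
  then have tb: "t * b = b\<^sup>2 - 11 * b - 1" by (simp add: algebra_simps power2_eq_square)
  then have b: "b \<noteq> 0" by auto
  have disc: "weier_disc (1 - b) (- b) (- b) 0 0 = b ^ 6 * t"
  proof -
    have "weier_disc (1 - b) (- b) (- b) 0 0 = b ^ 5 * (b\<^sup>2 - 11 * b - 1)"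
      unfolding weier_disc_tate by (simp add: algebra_simps eval_nat_numeral)
    then show ?thesis unfolding tb[symmetric] by (simp add: eval_nat_numeral)
  qed
  have c4: "weier_c4 (1 - b) (- b) (- b) 0 0 = b\<^sup>2 * (t\<^sup>2 + 10 * t + 5)"
    unfolding weier_c4_def weier_b2_def weier_b4_def using tb by algebra
  have "weier_j (1 - b) (- b) (- b) 0 0 = (b ^ 6 * (j * t)) / (b ^ 6 * t)"
    unfolding weier_j_def disc c4 t(3) by (simp add: power_mult_distrib power_mult[symmetric])
  also have "\<dots> = j" using b t(1) by simp
  finally have ss': "supersingular_j (weier_j (1 - b) (- b) (- b) 0 0)" using ss by simp
  have disc': "weier_disc (1 - b) (- b) (- b) 0 0 \<noteq> 0" using disc t(1) b by simp
  obtain e1 e2 e3 :: 'k and n \<alpha> \<beta> q where sf: "supersingular_frobenius e1 e2 e3 n p \<alpha> \<beta> q"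
    and e: "weier_2div (1 - b) (- b) (- b) 0 0 = [:-e1, 1:] * [:-e2, 1:] * [:-e3, 1:]"
    by (rule ex_supersingular_frobenius_if_weier_j[OF p ss' disc'])
  interpret supersingular_frobenius e1 e2 e3 n p \<alpha> \<beta> q by (rule sf)
  interpret marked_supersingular e1 e2 e3 n p \<alpha> \<beta> q "[:0, 0, -b, 1:]" "[:-b, 1 - b:]"
    by (rule marked_supersingular_tate) (use e b in \<open>simp_all add: f_def\<close>)
  have "t ^ q = t" by (rule level_5[OF refl refl b p5 tb])
  then show ?thesis using t(2) by (rule power_p2_if_fixed)
qed

lemma supersingular_roots_level_7:
  fixes j Y :: "'k::alg_closed_field"
  assumes p: "prime p" "CHAR('k) = p" "p \<ge> 5" and p7: "p \<noteq> 7"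
    and ss: "supersingular_j j" and R: "R_N 7 j Y = 0"
  shows "Y ^ p\<^sup>2 = Y"
proof -
  have "(49 :: 'k) \<noteq> 0" using numeral_prime_power_neq_0[OF p(2,1), of 7 2] p7 by simp
  then obtain t where t: "t \<noteq> 0" "Y = t + 49 / t + 13"
      "j * t = (t\<^sup>2 + 13 * t + 49) * (t\<^sup>2 + 5 * t + 1) ^ 3"
    using R_N_7_hauptmodul[OF R] by blast
  \<comment> \<open>A root d is a point of X_1(7) above t; the cubic clears the denominator d^2 - d
    in the formula for t.\<close>
  obtain d where "poly [:1, 5 + t, - (8 + t), 1:] d = 0"
    using alg_closed_imp_poly_has_root[of "[:1, 5 + t, - (8 + t), 1:]"] by auto
  then have "1 + d * (5 + t + d * (d - (8 + t))) = 0" by (simp add: algebra_simps)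
  then have td: "t * (d\<^sup>2 - d) = d ^ 3 - 8 * d\<^sup>2 + 5 * d + 1" by algebra
  have d: "d \<noteq> 0" "d \<noteq> 1" using td by auto
  define c where "c = d\<^sup>2 - d"
  define b where "b = d ^ 3 - d\<^sup>2"
  have c: "c \<noteq> 0" using d by (simp add: c_def power2_eq_square)
  have b_eq: "b = d * c" by (simp add: b_def c_def algebra_simps power2_eq_square power3_eq_cube)
  have b: "b \<noteq> 0" using b_eq c d by simp
  have disc: "weier_disc (1 - c) (- b) (- b) 0 0 = c ^ 8 * t"
  proof -
    have "16 * d\<^sup>2 * c - d * (8 * c\<^sup>2 + 20 * c - 1) - (1 - c) ^ 3 = (d - 1) ^ 3 * (d ^ 3 - 8 * d\<^sup>2 + 5 * d + 1)"
      unfolding c_def by (simp add: algebra_simps eval_nat_numeral)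
    moreover have "weier_disc (1 - c) (- b) (- b) 0 0
        = c ^ 4 * d ^ 3 * (16 * d\<^sup>2 * c - d * (8 * c\<^sup>2 + 20 * c - 1) - (1 - c) ^ 3)"
      unfolding weier_disc_tate b_eq by (simp add: algebra_simps eval_nat_numeral)
    moreover have "c ^ 4 * d ^ 3 * ((d - 1) ^ 3 * z) = c ^ 7 * z" for z
    proof -
      have "c = d * (d - 1)" by (simp add: c_def algebra_simps power2_eq_square)
      then have "c ^ 7 * z = c ^ 4 * (d * (d - 1)) ^ 3 * z" by (simp add: eval_nat_numeral)
      then show ?thesis by (simp only: power_mult_distrib mult.assoc)
    qed
    ultimately have "weier_disc (1 - c) (- b) (- b) 0 0 = c ^ 7 * (d ^ 3 - 8 * d\<^sup>2 + 5 * d + 1)" by simp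
    then show ?thesis unfolding td[symmetric] c_def[symmetric] by (simp add: eval_nat_numeral)
  qed
  \<comment> \<open>\<open>P\<close> is t^2 + 5 t + 1 with its denominator c^2 cleared, just as (d^2
    - d + 1)^3 is t^2 + 13 t + 49.\<close>
  define P where "P = d ^ 6 - 11 * d ^ 5 + 30 * d ^ 4 - 15 * d ^ 3 - 10 * d\<^sup>2 + 5 * d + 1"
  have c4: "weier_c4 (1 - c) (- b) (- b) 0 0 = (d\<^sup>2 - d + 1) * P"
    unfolding weier_c4_def weier_b2_def weier_b4_def b_eq c_def P_def by algebra
  have ct: "c * t = d ^ 3 - 8 * d\<^sup>2 + 5 * d + 1" using td by (simp add: c_def mult.commute)
  have 1: "c\<^sup>2 * (t\<^sup>2 + 13 * t + 49) = (d\<^sup>2 - d + 1) ^ 3"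
  proof -
    have "c\<^sup>2 * (t\<^sup>2 + 13 * t + 49) = (c * t)\<^sup>2 + 13 * c * (c * t) + 49 * c\<^sup>2" by algebra
    also have "\<dots> = (d\<^sup>2 - d + 1) ^ 3" unfolding ct unfolding c_def by algebra
    finally show ?thesis .
  qed
  have 2: "c\<^sup>2 * (t\<^sup>2 + 5 * t + 1) = P"
  proof -
    have "c\<^sup>2 * (t\<^sup>2 + 5 * t + 1) = (c * t)\<^sup>2 + 5 * c * (c * t) + c\<^sup>2" by algebra
    also have "\<dots> = P" unfolding ct unfolding c_def P_def by algebra
    finally show ?thesis .
  qed
  have "((d\<^sup>2 - d + 1) * P) ^ 3 = c ^ 8 * (j * t)"
    unfolding power_mult_distrib 1[symmetric] 2[symmetric] t(3) by algebra
  then have "weier_j (1 - c) (- b) (- b) 0 0 = (c ^ 8 * (j * t)) / (c ^ 8 * t)"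
    unfolding weier_j_def disc c4 by simp
  also have "\<dots> = j" using c t(1) by simp
  finally have ss': "supersingular_j (weier_j (1 - c) (- b) (- b) 0 0)" using ss by simp
  have disc': "weier_disc (1 - c) (- b) (- b) 0 0 \<noteq> 0" using disc t(1) c by simp
  obtain e1 e2 e3 :: 'k and n \<alpha> \<beta> q where sf: "supersingular_frobenius e1 e2 e3 n p \<alpha> \<beta> q"
    and e: "weier_2div (1 - c) (- b) (- b) 0 0 = [:-e1, 1:] * [:-e2, 1:] * [:-e3, 1:]"
    by (rule ex_supersingular_frobenius_if_weier_j[OF p ss' disc'])
  interpret supersingular_frobenius e1 e2 e3 n p \<alpha> \<beta> q by (rule sf)
  interpret marked_supersingular e1 e2 e3 n p \<alpha> \<beta> q "[:0, 0, -b, 1:]" "[:-b, 1 - c:]"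
    by (rule marked_supersingular_tate) (use e b in \<open>simp_all add: f_def\<close>)
  have "t ^ q = t" by (rule level_7[OF b_def c_def refl refl d p7 td])
  then show ?thesis using t(2) by (rule power_p2_if_fixed)
qed

section \<open>Characteristics 2 and 3\<close>

text \<open>For p = 2 the Hasse invariant is a1, and a1 = 0 makes c4 a multiple of 2.\<close>

lemma supersingular_j_eq_0_if_CHAR_2:
  assumes "CHAR('k::field) = 2" "supersingular_j (j :: 'k)"
  shows "j = 0"
proof -
  obtain a1 a2 a3 a4 a6 where a: "j = weier_j a1 a2 a3 a4 a6" "hasse_invariant 2 a1 a2 a3 a4 a6 = 0"
    using assms unfolding supersingular_j_def by auto
  have two: "(2 :: 'k) = 0" using of_nat_CHAR[where 'a = 'k] assms(1) by simp
  have a1: "a1 = 0" using a(2) by (simp add: hasse_invariant_dehom)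
  have "weier_c4 a1 a2 a3 a4 a6 = 2 * (8 * a2\<^sup>2 - 12 * weier_b4 a1 a2 a3 a4 a6)"
    unfolding weier_c4_def weier_b2_def a1 by (simp add: algebra_simps power2_eq_square)
  then show ?thesis using a(1) two by (simp add: weier_j_def)
qed

text \<open>For p = 3 the Hasse invariant a1^2 - 2 a2 is b2 modulo 3, and b2 = 0 makes c4 a multiple
  of 3.\<close>

lemma supersingular_j_eq_0_if_CHAR_3:
  assumes "CHAR('k::field) = 3" "supersingular_j (j :: 'k)"
  shows "j = 0"
proof -
  obtain a1 a2 a3 a4 a6 where a: "j = weier_j a1 a2 a3 a4 a6" "hasse_invariant 3 a1 a2 a3 a4 a6 = 0"
    using assms unfolding supersingular_j_def by auto
  have three: "(3 :: 'k) = 0" using of_nat_CHAR[where 'a = 'k] assms(1) by simp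
  have "a1\<^sup>2 - 2 * a2 = 0"
    using a(2) by (simp add: hasse_invariant_dehom power2_eq_square mult_pCons_left numeral_2_eq_2 algebra_simps)
  then have "weier_b2 a1 a2 a3 a4 a6 = 3 * (2 * a2)" unfolding weier_b2_def by (simp add: algebra_simps)
  then have b2: "weier_b2 a1 a2 a3 a4 a6 = 0" using three by simp
  have "weier_c4 a1 a2 a3 a4 a6 = 3 * (- 8 * weier_b4 a1 a2 a3 a4 a6)"
    unfolding weier_c4_def b2 by simp
  then show ?thesis using a(1) three by (simp add: weier_j_def)
qed

theorem theorem6p1:
  fixes j Y :: "'k::alg_closed_field" and N p :: nat
  assumes "N \<in> {2, 3, 5, 7}"
    and "prime p" and "p \<noteq> N"
    and "CHAR('k) = p"
    and "supersingular_j j"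
    and "R_N N j Y = 0"
  shows "Y ^ (p^2) = Y"
proof -
  have "p = 2 \<or> p = 3 \<or> p \<ge> 5"
  proof -
    have "p \<noteq> 4" using assms(2) prime_product[of 2 2] by auto
    then show ?thesis using prime_ge_2_nat[OF assms(2)] by linarith
  qed
  then consider "p = 2" | "p = 3" | "p \<ge> 5" by blast
  then show ?thesis
  proof cases
    case 1
    have even: "of_nat (2 * m) = (0 :: 'k)" for m
      using 1 assms(4) by (simp only: of_nat_eq_0_iff_char_dvd) simp
    \<comment> \<open>With j = 0, the vanishing of these coefficients reduces every R_N to a power
      of Y.\<close>
    have zero: "(192 :: 'k) = 0" "(216 :: 'k) = 0" "(144 :: 'k) = 0" "(224 :: 'k) = 0" "(448 :: 'k) = 0"
      using even[of 96] even[of 108] even[of 72] even[of 112] even[of 224] by simp_all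
    have "j = 0" using supersingular_j_eq_0_if_CHAR_2 assms(4,5) 1 by blast
    then have "Y = 0" using assms(1,3,6) 1 zero by (auto simp: R_N_def)
    then show ?thesis using 1 by simp
  next
    case 2
    have three: "of_nat (3 * m) = (0 :: 'k)" for m
      using 2 assms(4) by (simp only: of_nat_eq_0_iff_char_dvd) simp
    have zero: "(144 :: 'k) = 0" "(216 :: 'k) = 0" "(225 :: 'k) = 0" "(447 :: 'k) = 0" "(3 :: 'k) = 0"
      using three[of 48] three[of 72] three[of 75] three[of 149] three[of 1] by simp_all
    have j: "j = 0" using supersingular_j_eq_0_if_CHAR_3 assms(4,5) 2 by blast
    have "Y = 0 \<or> Y = - 1"
    proof (cases "N = 7")
      case True
      \<comment> \<open>Modulo 3 this quadratic is the square of Y + 1, the source of the one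
        nonzero root.\<close>
      have "Y\<^sup>2 + 224 * Y + 448 = (Y + 1)\<^sup>2 + (225 * Y - 3 * Y + 447)" by (simp add: algebra_simps power2_eq_square)
      then have "Y\<^sup>2 + 224 * Y + 448 = (Y + 1)\<^sup>2" using zero by simp
      then have "Y\<^sup>2 * ((Y + 1)\<^sup>2) ^ 3 = 0" using assms(6) j True by (simp add: R_N_def)
      then show ?thesis by (auto simp: eq_neg_iff_add_eq_0)
    next
      case False
      then show ?thesis using assms(1,3,6) 2 zero j by (auto simp: R_N_def)
    qed
    then show ?thesis using 2 by auto
  next
    case 3
    note level = assms(2,4) 3
    from assms(1) consider "N = 2" | "N = 3" | "N = 5" | "N = 7" by auto
    then show ?thesis
    proof cases
      case 1
      then show ?thesis using supersingular_roots_level_2[OF level assms(5)] assms(6) by simp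
    next
      case 2
      then show ?thesis using supersingular_roots_level_3[OF level assms(5)] assms(6) by simp
    next
      case 3
      then show ?thesis using supersingular_roots_level_5[OF level _ assms(5)] assms(3,6) by simp
    next
      case 4
      then show ?thesis using supersingular_roots_level_7[OF level _ assms(5)] assms(3,6) by simp
    qed
  qed
qed

end
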